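(* Suppose that $f\in\mathcal Z$ and let $F$ be an analytic function in $\mathbb D$ which is convexity preserving. Then, for every $p>0$, $$M_p(r, f\star F)\,\le\, M_p(r, f),\qquad 0<r<1.$$
   Context: $\mathbb D=\{z\in\mathbb C:|z|<1\}$. For analytic $f$ in $\mathbb D$, $0\le r<1$ and $0<p<\infty$, $M_p(r,f)=\left(\int_{-\pi}^{\pi}|f(re^{it})|^p\,\frac{dt}{2\pi}\right)^{1/p}$. For $f(z)=\sum_{n\ge0}a_nz^n$ and $g(z)=\sum_{n\ge0}b_nz^n$ analytic in $\mathbb D$, the (Hadamard) convolution is $(f\star g)(z)=\sum_{n\ge0}a_nb_nz^n$, $z\in\mathbb D$. An analytic function $F$ in $\mathbb D$ is convexity preserving if for every analytic $f$ in $\mathbb D$ the range of $f\star F$ is contained in the closed convex hull of the range of $f$. A domain $D\subset\mathbb C$ is Steiner symmetric if its intersection with each vertical line is either empty, or the whole line, or a segment placed symmetrically with respect to the real axis. $\mathcal Z$ is the class of all functions $f$ which are analytic and univalent (injective) in $\mathbb D$ with $f(0)=0$, $f'(0)>0$, and whose image $f(\mathbb D)$ is a Steiner symmetric domain. *)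

theory Defs
  imports "HOL-Complex_Analysis.Complex_Analysis"
begin

abbreviation unit_disc :: "complex set" ("\<D>")
  where "\<D> \<equiv> ball 0 1"

text \<open>The integral is over a continuous function on a compact interval when \<open>f\<close> is
  holomorphic on the unit disc, \<open>0 \<le> r < 1\<close> and \<open>p > 0\<close>.\<close>

definition integral_mean :: "real \<Rightarrow> real \<Rightarrow> (complex \<Rightarrow> complex) \<Rightarrow> real"
  where "integral_mean p r f =
    (integral {-pi..pi} (\<lambda>t. cmod (f (of_real r * exp (\<i> * of_real t))) powr p / (2 * pi))) powr (1 / p)"

definition convolution :: "(complex \<Rightarrow> complex) \<Rightarrow> (complex \<Rightarrow> complex) \<Rightarrow> complex \<Rightarrow> complex"
    (infixl "\<star>" 70)
  where "(f \<star> g) z =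
    (\<Sum>n. fps_nth (fps_expansion f 0) n * fps_nth (fps_expansion g 0) n * z ^ n)"

definition convexity_preserving :: "(complex \<Rightarrow> complex) \<Rightarrow> bool"
  where "convexity_preserving F \<longleftrightarrow> F holomorphic_on \<D> \<and>
    (\<forall>f. f holomorphic_on \<D> \<longrightarrow> (f \<star> F) ` \<D> \<subseteq> closure (convex hull (f ` \<D>)))"

text \<open>A bounded vertical section of an open set is relatively open, so a segment placed
  symmetrically with respect to the real axis is an open interval \<open>{-h<..<h}\<close> here.\<close>

definition steiner_symmetric_domain :: "complex set \<Rightarrow> bool"
  where "steiner_symmetric_domain D \<longleftrightarrow> open D \<and> connected D \<and> D \<noteq> {} \<and>
    (\<forall>x::real. let S = {y::real. Complex x y \<in> D} in
       S = {} \<or> S = UNIV \<or> (\<exists>h>0. S = {-h<..<h}))"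

definition class_Z :: "(complex \<Rightarrow> complex) set" ("\<Z>")
  where "\<Z> = {f. f holomorphic_on \<D> \<and> inj_on f \<D> \<and> f 0 = 0 \<and>
    deriv f 0 \<in> \<real> \<and> Re (deriv f 0) > 0 \<and> steiner_symmetric_domain (f ` \<D>)}"

end

theory Submission
  imports Defs "HOL-Real_Asymp.Real_Asymp"
begin

text \<open>
  For \<open>\<rho> < 1\<close> the function \<open>g z = (f \<star> F) (\<rho> z)\<close> is an average of rotations of \<open>f\<close> with the
  nonnegative weight \<open>P s = 2 Re (F (\<rho> e\<^sup>i\<^sup>s)) - 1\<close> of mean \<open>1\<close>. Jensen's inequality settles
  \<open>p \<ge> 1\<close> and also gives, for every real \<open>x\<close>, that the mean of \<open>\<bar>Re g - x\<bar>\<close> on a circle is at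
  most that of \<open>\<bar>Re f - x\<bar>\<close>.

  For \<open>p < 1\<close> the argument is a linear form of Baernstein's method. For holomorphic \<open>h\<close> let \<open>u\<^sub>h (x, y)\<close> be the circular
  mean of the logarithmic potential of the segment from \<open>x - iy\<close> to \<open>x + iy\<close>, evaluated along
  \<open>h (r e\<^sup>i\<^sup>t)\<close>; then \<open>u\<^sub>g \<le> u\<^sub>f\<close> in the upper half-plane. Indeed, the image \<open>\<Omega>\<close> of the disc of
  radius \<open>r\<close> under \<open>f\<close> is again Steiner symmetric. Outside \<open>\<Omega>\<close>, Jensen's formula shows that
  \<open>u\<^sub>g - u\<^sub>f\<close> increases in \<open>y\<close>, and as \<open>y\<close> tends to infinity its limit is \<open>\<pi>\<close> times the mean of
  \<open>\<bar>Re g - x\<bar> - \<bar>Re f - x\<bar>\<close>. Inside \<open>\<Omega>\<close>, the function \<open>u\<^sub>f\<close> is harmonic and \<open>u\<^sub>g\<close> is subharmonic, so the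
  maximum principle applies. Integrating \<open>u\<^sub>g \<le> u\<^sub>f\<close> over half-circles compares the means of the
  potentials of centred discs, and \<open>\<bar>w\<bar> powr p\<close> is a positive mixture of these potentials up to a
  constant.
\<close>

text \<open>Averaging rotations can be compared directly only through convex functions, and |w| powr
  p is not convex for p < 1. Segment potentials bridge this gap: for a tall segment they are pi *
  |Re w - x|, a convex function, up to a term independent of w and a vanishing error; summed over
  the vertical chords of a disc they give radial functions. Steiner symmetry is what carries the
  comparison from y = infinity down to every y: above the real axis a vertical ray that starts
  outside \<Omega> never enters it, and a segment whose upper end lies in \<Omega> stays in it. The
  weight is nonnegative because 1 / (1 - z), the unit of the convolution, maps the disc into the
  half-plane Re w > 1/2; constants give F 0 = 1. The radius \<rho> is there because F need not have
  boundary values. Subharmonicity is never treated abstractly: a smoothing parameter \<delta> makes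
  the Laplacian of the potential of g exist and be positive, so that the second derivative test at a
  maximum suffices; then \<delta> tends to 0.\<close>

abbreviation cint :: "(real \<Rightarrow> 'a::banach) \<Rightarrow> 'a"
  where "cint \<equiv> integral {-pi..pi}"

section \<open>Logarithmic potentials of vertical segments\<close>

text \<open>The antiderivative in Y of ln |X + i Y| that vanishes at Y = 0. With division by zero
  equal to 0, it reads Y ln |Y| - Y for X = 0.\<close>

definition line_primitive :: "real \<Rightarrow> real \<Rightarrow> real"
  where "line_primitive X Y = X * arctan (Y / X) + Y * ln (X\<^sup>2 + Y\<^sup>2) / 2 - Y"

lemma line_primitive_minus: "line_primitive X (- Y) = - line_primitive X Y"
  by (simp add: line_primitive_def arctan_minus)

lemma line_primitive_abs: "line_primitive \<bar>X\<bar> Y = line_primitive X Y"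
  by (simp add: line_primitive_def abs_if arctan_minus)

lemma line_primitive_DERIV:
  assumes "X \<noteq> 0 \<or> Y \<noteq> 0"
  shows "(line_primitive X has_real_derivative ln (X\<^sup>2 + Y\<^sup>2) / 2) (at Y)"
proof -
  have pos: "X\<^sup>2 + Y\<^sup>2 > 0"
    using assms by (simp add: sum_power2_gt_zero_iff)
  have eq: "X * (1 / X / (1 + (Y / X)\<^sup>2)) + (1 * ln (X\<^sup>2 + Y\<^sup>2) + 2 * Y / (X\<^sup>2 + Y\<^sup>2) * Y) / 2 - 1
      = ln (X\<^sup>2 + Y\<^sup>2) / 2"
  proof (cases "X = 0")
    case True
    then show ?thesis using assms by (simp add: field_simps power2_eq_square)
  next
    case False
    have A: "X * (1 / X / (1 + (Y / X)\<^sup>2)) = X\<^sup>2 / (X\<^sup>2 + Y\<^sup>2)"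
      using False pos by (simp add: divide_simps power2_eq_square)
    have B: "X\<^sup>2 / s + 2 * Y / s * Y / 2 = (X\<^sup>2 + Y\<^sup>2) / s" for s
      by (simp add: add_divide_distrib power2_eq_square)
    have "X * (1 / X / (1 + (Y / X)\<^sup>2)) + 2 * Y / (X\<^sup>2 + Y\<^sup>2) * Y / 2 = (X\<^sup>2 + Y\<^sup>2) / (X\<^sup>2 + Y\<^sup>2)"
      by (simp only: A B)
    then have "X * (1 / X / (1 + (Y / X)\<^sup>2)) + 2 * Y / (X\<^sup>2 + Y\<^sup>2) * Y / 2 = 1"
      using divide_self[of "X\<^sup>2 + Y\<^sup>2"] pos by linarith
    then show ?thesis by (simp only: add_divide_distrib mult_1)
  qed
  have "((\<lambda>Y. X * arctan (Y / X)) has_real_derivative X * (1 / X / (1 + (Y / X)\<^sup>2))) (at Y)"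
    by (cases "X = 0") (auto intro!: derivative_eq_intros simp: divide_inverse)
  moreover have "((\<lambda>Y. ln (X\<^sup>2 + Y\<^sup>2)) has_real_derivative 2 * Y / (X\<^sup>2 + Y\<^sup>2)) (at Y)"
    using pos by (auto intro!: derivative_eq_intros)
  ultimately have "((\<lambda>Y. X * arctan (Y / X) + Y * ln (X\<^sup>2 + Y\<^sup>2) / 2 - Y) has_real_derivative
     X * (1 / X / (1 + (Y / X)\<^sup>2)) + (1 * ln (X\<^sup>2 + Y\<^sup>2) + 2 * Y / (X\<^sup>2 + Y\<^sup>2) * Y) / 2 - 1) (at Y)"
    by (intro DERIV_diff DERIV_add DERIV_mult DERIV_ident DERIV_cdivide)
  then show ?thesis unfolding eq line_primitive_def[abs_def] .
qed

text \<open>Points with X = 0, where the formula divides by zero, are included: arctan is bounded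
  and multiplied by X, and sqrt s * ln s tends to 0. Curves may thus cross the segment, and \<delta>
  may tend to 0.\<close>

lemma isCont_line_primitive: "isCont (\<lambda>(X, Y). line_primitive X Y) (X0, Y0)"
proof -
  have c1: "isCont (\<lambda>z::real\<times>real. fst z * arctan (snd z / fst z)) (X0, Y0)"
  proof (cases "X0 = 0")
    case False
    then show ?thesis by (intro continuous_intros) auto
  next
    case True
    have "((\<lambda>z::real\<times>real. fst z * arctan (snd z / fst z)) \<longlongrightarrow> 0) (at (X0, Y0))"
    proof (rule Lim_null_comparison)
      show "\<forall>\<^sub>F z::real\<times>real in at (X0, Y0). norm (fst z * arctan (snd z / fst z)) \<le> \<bar>fst z\<bar> * (pi/2)"
      proof (rule always_eventually, rule allI)
        fix z :: "real \<times> real"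
        have "\<bar>arctan (snd z / fst z)\<bar> \<le> pi / 2"
          using arctan_bounded[of "snd z / fst z"] by linarith
        then show "norm (fst z * arctan (snd z / fst z)) \<le> \<bar>fst z\<bar> * (pi/2)"
          unfolding real_norm_def abs_mult by (intro mult_left_mono) auto
      qed
      have "((\<lambda>z::real\<times>real. \<bar>fst z\<bar> * (pi/2)) \<longlongrightarrow> \<bar>fst (X0,Y0)\<bar> * (pi/2)) (at (X0, Y0))"
        by (intro tendsto_intros)
      then show "((\<lambda>z::real\<times>real. \<bar>fst z\<bar> * (pi/2)) \<longlongrightarrow> 0) (at (X0, Y0))"
        using True by simp
    qed
    then show ?thesis using True by (simp add: isCont_def)
  qed
  have c2: "isCont (\<lambda>z::real\<times>real. snd z * ln ((fst z)\<^sup>2 + (snd z)\<^sup>2)) (X0, Y0)"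
  proof (cases "X0 = 0 \<and> Y0 = 0")
    case False
    then have "X0\<^sup>2 + Y0\<^sup>2 \<noteq> 0" by simp
    then show ?thesis by (intro continuous_intros) auto
  next
    case True
    let ?u = "\<lambda>s::real. \<bar>sqrt s * ln s\<bar>"
    have lim0: "(?u \<longlongrightarrow> 0) (at_right 0)" by real_asymp
    have "\<forall>\<^sub>F z::real\<times>real in at (0,0). (fst z)\<^sup>2 + (snd z)\<^sup>2 \<in> {0<..}"
      unfolding eventually_at_filter
      by (rule always_eventually) (auto simp: sum_power2_gt_zero_iff)
    moreover have "((\<lambda>z::real\<times>real. (fst z)\<^sup>2 + (snd z)\<^sup>2) \<longlongrightarrow> (fst (0::real,0::real))\<^sup>2 + (snd (0::real,0::real))\<^sup>2) (at (0,0))"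
      by (intro tendsto_intros)
    ultimately have "filterlim (\<lambda>z::real\<times>real. (fst z)\<^sup>2 + (snd z)\<^sup>2) (at_right 0) (at (0,0))"
      unfolding filterlim_at by (auto elim: eventually_mono)
    then have lim: "((\<lambda>z::real\<times>real. ?u ((fst z)\<^sup>2 + (snd z)\<^sup>2)) \<longlongrightarrow> 0) (at (0,0))"
      by (rule filterlim_compose[OF lim0])
    have "((\<lambda>z::real\<times>real. snd z * ln ((fst z)\<^sup>2 + (snd z)\<^sup>2)) \<longlongrightarrow> 0) (at (0, 0))"
    proof (rule Lim_null_comparison[OF _ lim], rule always_eventually, rule allI)
      fix z :: "real \<times> real"
      have "\<bar>snd z\<bar> \<le> sqrt ((fst z)\<^sup>2 + (snd z)\<^sup>2)" by (rule real_le_rsqrt) auto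
      then show "norm (snd z * ln ((fst z)\<^sup>2 + (snd z)\<^sup>2)) \<le> ?u ((fst z)\<^sup>2 + (snd z)\<^sup>2)"
        unfolding real_norm_def abs_mult by (intro mult_right_mono) auto
    qed
    then show ?thesis using True by (simp add: isCont_def)
  qed
  have "isCont (\<lambda>z::real\<times>real. fst z * arctan (snd z / fst z)
      + snd z * ln ((fst z)\<^sup>2 + (snd z)\<^sup>2) / 2 - snd z) (X0, Y0)"
    by (intro continuous_diff continuous_add continuous_divide c1 c2 continuous_const continuous_snd continuous_ident) auto
  moreover have "(\<lambda>z::real\<times>real. fst z * arctan (snd z / fst z)
      + snd z * ln ((fst z)\<^sup>2 + (snd z)\<^sup>2) / 2 - snd z) = (\<lambda>(X, Y). line_primitive X Y)"
    by (auto simp: fun_eq_iff line_primitive_def)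
  ultimately show ?thesis by simp
qed

lemma continuous_on_line_primitive [continuous_intros]:
  assumes "continuous_on S a" "continuous_on S b"
  shows "continuous_on S (\<lambda>x. line_primitive (a x) (b x))"
proof -
  have "continuous_on UNIV (\<lambda>(X, Y). line_primitive X Y)"
    using isCont_line_primitive by (auto simp: continuous_on_eq_continuous_at)
  from continuous_on_compose2[OF this continuous_on_Pair[OF assms]] show ?thesis
    by simp
qed

text \<open>For X > 0, arctan (t / X) = pi / 2 - arctan (X / t) and ln (X^2 + t^2) = 2 ln t + ln (1
  + X^2 / t^2), where both corrections contribute O(X^2 / t). The term pi / 2 * |X| is the source of
  |Re w - x| for tall segments.\<close>

lemma line_primitive_asymp:
  assumes "t > 0"
  shows "\<bar>line_primitive X t - (pi / 2 * \<bar>X\<bar> + (t * ln t - t))\<bar> \<le> 2 * X\<^sup>2 / t"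
proof (cases "X = 0")
  case True
  then show ?thesis using assms by (simp add: line_primitive_def ln_realpow)
next
  case False
  define X' where "X' = \<bar>X\<bar>"
  have X': "X' > 0" "X'\<^sup>2 = X\<^sup>2" using False by (auto simp: X'_def)
  have "arctan (t / X') = pi / 2 - arctan (X' / t)"
    using arctan_inverse[of "X' / t"] X' assms by (simp add: sgn_if)
  moreover have "ln (X'\<^sup>2 + t\<^sup>2) = 2 * ln t + ln (1 + X'\<^sup>2 / t\<^sup>2)"
  proof -
    have "X'\<^sup>2 + t\<^sup>2 = t\<^sup>2 * (1 + X'\<^sup>2 / t\<^sup>2)" using assms by (simp add: field_simps)
    moreover have "1 + X'\<^sup>2 / t\<^sup>2 > 0" by (simp add: add_pos_nonneg)
    ultimately show ?thesis using assms by (simp add: ln_mult_pos ln_realpow)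
  qed
  moreover have "X' * (pi / 2 - a) + t * (2 * l + m) / 2 - t - (pi / 2 * X' + (t * l - t)) = t * m / 2 - X' * a"
    for a l m by (simp add: algebra_simps add_divide_distrib)
  ultimately have eq: "line_primitive X t - (pi / 2 * \<bar>X\<bar> + (t * ln t - t)) =
     t * ln (1 + X'\<^sup>2 / t\<^sup>2) / 2 - X' * arctan (X' / t)"
    by (subst line_primitive_abs[symmetric], unfold X'_def[symmetric] line_primitive_def) simp
  have "0 \<le> ln (1 + X'\<^sup>2 / t\<^sup>2)" "ln (1 + X'\<^sup>2 / t\<^sup>2) \<le> X'\<^sup>2 / t\<^sup>2"
    by (auto simp: ln_add_one_self_le_self)
  then have 1: "0 \<le> t * ln (1 + X'\<^sup>2 / t\<^sup>2)" "t * ln (1 + X'\<^sup>2 / t\<^sup>2) \<le> t * (X'\<^sup>2 / t\<^sup>2)"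
    using assms by (auto intro: mult_left_mono simp del: times_divide_eq_right)
  have "0 \<le> arctan (X' / t)" "arctan (X' / t) \<le> X' / t"
    using X' assms by (auto intro: arctan_le_self)
  then have 2: "0 \<le> X' * arctan (X' / t)" "X' * arctan (X' / t) \<le> X' * (X' / t)"
    using X' by (auto intro: mult_left_mono simp del: times_divide_eq_right)
  have "t * (X'\<^sup>2 / t\<^sup>2) = X\<^sup>2 / t" "X' * (X' / t) = X\<^sup>2 / t"
    using assms X' by (auto simp: power2_eq_square)
  moreover have "X\<^sup>2 / t \<ge> 0" using assms by simp
  ultimately show ?thesis unfolding eq using 1 2 by linarith
qed

lemma line_integral_ln:
  assumes "a \<le> b"
  shows "((\<lambda>t. ln ((Re \<zeta> - x)\<^sup>2 + \<delta>\<^sup>2 + (t - Im \<zeta>)\<^sup>2) / 2) has_integral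
    (line_primitive (sqrt ((Re \<zeta> - x)\<^sup>2 + \<delta>\<^sup>2)) (b - Im \<zeta>)
      - line_primitive (sqrt ((Re \<zeta> - x)\<^sup>2 + \<delta>\<^sup>2)) (a - Im \<zeta>))) {a..b}"
\<comment> \<open>At t = Im \<zeta> the integrand is singular if \<delta> = 0 and x = Re \<zeta>,
  hence the exceptional point.\<close>
proof (rule fundamental_theorem_of_calculus_strong[of "{Im \<zeta>}"])
  let ?c = "sqrt ((Re \<zeta> - x)\<^sup>2 + \<delta>\<^sup>2)"
  show "continuous_on {a..b} (\<lambda>t. line_primitive ?c (t - Im \<zeta>))"
    by (intro continuous_intros)
  fix t assume "t \<in> {a..b} - {Im \<zeta>}"
  then have "?c \<noteq> 0 \<or> t - Im \<zeta> \<noteq> 0" by auto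
  from line_primitive_DERIV[OF this]
  have "((\<lambda>t. line_primitive ?c (t - Im \<zeta>)) has_real_derivative ln (?c\<^sup>2 + (t - Im \<zeta>)\<^sup>2) / 2 * 1) (at t)"
    by (rule DERIV_chain2) (auto intro!: derivative_eq_intros)
  then show "((\<lambda>t. line_primitive ?c (t - Im \<zeta>)) has_vector_derivative
      ln ((Re \<zeta> - x)\<^sup>2 + \<delta>\<^sup>2 + (t - Im \<zeta>)\<^sup>2) / 2) (at t)"
    by (simp add: has_real_derivative_iff_has_vector_derivative)
qed (use assms in auto)

text \<open>\<open>seg 0 \<zeta> x y\<close> is the logarithmic potential at \<open>\<zeta>\<close> of the vertical segment from
  \<open>x - iy\<close> to \<open>x + iy\<close>. For \<open>\<delta> \<noteq> 0\<close> it is smoothed so that its Laplacian in \<open>(x, y)\<close> exists and is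
  positive for \<open>y > 0\<close>.\<close>

definition seg :: "real \<Rightarrow> complex \<Rightarrow> real \<Rightarrow> real \<Rightarrow> real"
  where "seg \<delta> \<zeta> x y = line_primitive (sqrt ((Re \<zeta> - x)\<^sup>2 + \<delta>\<^sup>2)) (y + Im \<zeta>)
    + line_primitive (sqrt ((Re \<zeta> - x)\<^sup>2 + \<delta>\<^sup>2)) (y - Im \<zeta>)"

lemma continuous_on_seg [continuous_intros]:
  assumes "continuous_on S d" "continuous_on S z" "continuous_on S u" "continuous_on S v"
  shows "continuous_on S (\<lambda>s. seg (d s) (z s) (u s) (v s))"
  unfolding seg_def by (intro continuous_intros assms)

lemma seg_0 [simp]: "seg \<delta> \<zeta> x 0 = 0"
  using line_primitive_minus[of _ "Im \<zeta>"] by (simp add: seg_def)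

lemma seg_diff_integral:
  assumes "a \<le> b"
  shows "((\<lambda>t. ln ((Re \<zeta> - x)\<^sup>2 + \<delta>\<^sup>2 + (t - Im \<zeta>)\<^sup>2) / 2
      + ln ((Re \<zeta> - x)\<^sup>2 + \<delta>\<^sup>2 + (t + Im \<zeta>)\<^sup>2) / 2) has_integral
    (seg \<delta> \<zeta> x b - seg \<delta> \<zeta> x a)) {a..b}"
  using has_integral_add[OF line_integral_ln[OF assms, of \<zeta> x \<delta>]
      line_integral_ln[OF assms, of "cnj \<zeta>" x \<delta>]]
  by (simp add: seg_def algebra_simps)

lemma seg_integral:
  assumes "y \<ge> 0"
  shows "((\<lambda>t. ln (cmod (\<zeta> - Complex x t))) has_integral seg 0 \<zeta> x y) {-y..y}"
proof -
  have "ln ((Re \<zeta> - x)\<^sup>2 + 0\<^sup>2 + (t - Im \<zeta>)\<^sup>2) / 2 = ln (cmod (\<zeta> - Complex x t))" for t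
    by (simp add: cmod_def ln_sqrt power2_commute)
  then show ?thesis
    using line_integral_ln[of "-y" y \<zeta> x 0] assms line_primitive_minus[of _ "y + Im \<zeta>"]
    by (simp add: seg_def add.commute)
qed

section \<open>Laplacians and the maximum principle\<close>

lemma second_derivative_nonpos_at_max:
  fixes h h' :: "real \<Rightarrow> real"
  assumes "e > 0"
    and der: "\<And>s. \<bar>s\<bar> < e \<Longrightarrow> (h has_real_derivative h' s) (at s)"
    and der2: "(h' has_real_derivative c) (at 0)"
    and max: "\<And>s. \<bar>s\<bar> < e \<Longrightarrow> h s \<le> h 0"
  shows "c \<le> 0"
proof (rule ccontr)
  assume "\<not> c \<le> 0"
  then have "c > 0" by simp
  have "h' 0 = 0"
    using DERIV_local_max[of h "h' 0" 0 e] der[of 0] \<open>e > 0\<close> max by auto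
  from DERIV_pos_inc_right[OF der2 \<open>c > 0\<close>] obtain d
    where d: "d > 0" "\<And>s. s > 0 \<Longrightarrow> s < d \<Longrightarrow> h' 0 < h' (0 + s)" by blast
  define s where "s = min d e / 2"
  have s: "s > 0" "s < d" "s < e" using d \<open>e > 0\<close> by (auto simp: s_def min_def)
  obtain z where z: "z > 0" "z < s" "h s - h 0 = (s - 0) * h' z"
    using MVT2[of 0 s h h'] s der by auto
  have "h' z > 0" using d(2)[of z] z s \<open>h' 0 = 0\<close> by simp
  then have "s * h' z > 0" using s by simp
  then have "h s > h 0" using z by simp
  then show False using max[of s] s by simp
qed

text \<open>Second derivatives are required only along the horizontal and the vertical line through
  \<open>w\<close>, with first derivatives nearby; this is exactly what the second derivative test
  at a maximum uses.\<close>

definition has_laplacian :: "(complex \<Rightarrow> real) \<Rightarrow> real \<Rightarrow> complex \<Rightarrow> bool"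
  where "has_laplacian u L w \<longleftrightarrow> (\<exists>e>0. \<exists>ux uy uxx uyy.
    (\<forall>s. \<bar>s\<bar> < e \<longrightarrow> ((\<lambda>s. u (w + of_real s)) has_real_derivative ux s) (at s)) \<and>
    (\<forall>s. \<bar>s\<bar> < e \<longrightarrow> ((\<lambda>s. u (w + \<i> * of_real s)) has_real_derivative uy s) (at s)) \<and>
    (ux has_real_derivative uxx) (at 0) \<and> (uy has_real_derivative uyy) (at 0) \<and> L = uxx + uyy)"

lemma has_laplacian_diff:
  assumes "has_laplacian u L w" "has_laplacian v M w"
  shows "has_laplacian (\<lambda>z. u z - v z) (L - M) w"
proof -
  from assms(1) obtain e ux uy uxx uyy where 1: "e > 0"
    "\<And>s. \<bar>s\<bar> < e \<Longrightarrow> ((\<lambda>s. u (w + of_real s)) has_real_derivative ux s) (at s)"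
    "\<And>s. \<bar>s\<bar> < e \<Longrightarrow> ((\<lambda>s. u (w + \<i> * of_real s)) has_real_derivative uy s) (at s)"
    "(ux has_real_derivative uxx) (at 0)" "(uy has_real_derivative uyy) (at 0)" "L = uxx + uyy"
    unfolding has_laplacian_def by blast
  from assms(2) obtain e' vx vy vxx vyy where 2: "e' > 0"
    "\<And>s. \<bar>s\<bar> < e' \<Longrightarrow> ((\<lambda>s. v (w + of_real s)) has_real_derivative vx s) (at s)"
    "\<And>s. \<bar>s\<bar> < e' \<Longrightarrow> ((\<lambda>s. v (w + \<i> * of_real s)) has_real_derivative vy s) (at s)"
    "(vx has_real_derivative vxx) (at 0)" "(vy has_real_derivative vyy) (at 0)" "M = vxx + vyy"
    unfolding has_laplacian_def by blast
  show ?thesis unfolding has_laplacian_def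
    apply (rule exI[of _ "min e e'"], intro conjI)
    subgoal using 1(1) 2(1) by simp
    apply (rule exI[of _ "\<lambda>s. ux s - vx s"], rule exI[of _ "\<lambda>s. uy s - vy s"],
        rule exI[of _ "uxx - vxx"], rule exI[of _ "uyy - vyy"])
    using 1(4-6) 2(4-6) by (auto intro!: DERIV_diff 1(2,3) 2(2,3))
qed

lemma has_laplacian_cmult:
  assumes "has_laplacian u L w"
  shows "has_laplacian (\<lambda>z. c * u z) (c * L) w"
proof -
  from assms(1) obtain e ux uy uxx uyy where 1: "e > 0"
    "\<And>s. \<bar>s\<bar> < e \<Longrightarrow> ((\<lambda>s. u (w + of_real s)) has_real_derivative ux s) (at s)"
    "\<And>s. \<bar>s\<bar> < e \<Longrightarrow> ((\<lambda>s. u (w + \<i> * of_real s)) has_real_derivative uy s) (at s)"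
    "(ux has_real_derivative uxx) (at 0)" "(uy has_real_derivative uyy) (at 0)" "L = uxx + uyy"
    unfolding has_laplacian_def by blast
  show ?thesis unfolding has_laplacian_def
    apply (rule exI[of _ e], intro conjI)
    subgoal using 1(1) .
    apply (rule exI[of _ "\<lambda>s. c * ux s"], rule exI[of _ "\<lambda>s. c * uy s"],
        rule exI[of _ "c * uxx"], rule exI[of _ "c * uyy"])
    using 1(4-6) by (auto intro!: DERIV_cmult 1(2,3) simp: algebra_simps)
qed

lemma has_laplacian_transform:
  assumes "has_laplacian u L w" "open S" "w \<in> S" "\<And>z. z \<in> S \<Longrightarrow> v z = u z"
  shows "has_laplacian v L w"
proof -
  from assms(1) obtain e ux uy uxx uyy where 1: "e > 0"
    "\<And>s. \<bar>s\<bar> < e \<Longrightarrow> ((\<lambda>s. u (w + of_real s)) has_real_derivative ux s) (at s)"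
    "\<And>s. \<bar>s\<bar> < e \<Longrightarrow> ((\<lambda>s. u (w + \<i> * of_real s)) has_real_derivative uy s) (at s)"
    "(ux has_real_derivative uxx) (at 0)" "(uy has_real_derivative uyy) (at 0)" "L = uxx + uyy"
    unfolding has_laplacian_def by blast
  obtain d where d: "d > 0" "ball w d \<subseteq> S"
    using assms(2,3) open_contains_ball by blast
  have tr: "((\<lambda>s. v (w + a * of_real s)) has_real_derivative l) (at s)"
    if "((\<lambda>s. u (w + a * of_real s)) has_real_derivative l) (at s)" "\<bar>s\<bar> < d" "cmod a = 1" for a s l
  proof (rule has_field_derivative_transform_within[OF that(1), of "d - \<bar>s\<bar>"])
    fix y assume "dist y s < d - \<bar>s\<bar>"
    then have "\<bar>y\<bar> < d" by (auto simp: dist_real_def)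
    then have "w + a * of_real y \<in> ball w d" using that(3) by (simp add: dist_norm norm_mult)
    then show "u (w + a * of_real y) = v (w + a * of_real y)"
      using d assms(4) by auto
  qed (use that in auto)
  show ?thesis unfolding has_laplacian_def
    apply (rule exI[of _ "min e d"], intro conjI)
    subgoal using 1(1) d(1) by simp
    apply (rule exI[of _ ux], rule exI[of _ uy], rule exI[of _ uxx], rule exI[of _ uyy])
    using 1 tr[of 1] tr[of \<i>] by auto
qed

text \<open>At an interior maximum both second derivatives are nonpositive, which a positive
  Laplacian forbids; so the maximum over the compact closure is attained on the frontier.\<close>

lemma strict_maximum_principle:
  fixes u :: "complex \<Rightarrow> real"
  assumes "bounded S" "open S" "continuous_on (closure S) u"
    and lap: "\<And>w. w \<in> S \<Longrightarrow> \<exists>L>0. has_laplacian u L w"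
    and bd: "\<And>w. w \<in> frontier S \<Longrightarrow> u w \<le> M"
    and "w \<in> S"
  shows "u w \<le> M"
proof -
  have "compact (closure S)" "closure S \<noteq> {}" using assms by auto
  then obtain w0 where w0: "w0 \<in> closure S" "\<And>z. z \<in> closure S \<Longrightarrow> u z \<le> u w0"
    using continuous_attains_sup[OF _ _ assms(3)] by blast
  have "w0 \<notin> S"
  proof
    assume "w0 \<in> S"
    from lap[OF this] obtain L where "L > 0" "has_laplacian u L w0" by blast
    then obtain e ux uy uxx uyy where 1: "e > 0"
      "\<And>s. \<bar>s\<bar> < e \<Longrightarrow> ((\<lambda>s. u (w0 + of_real s)) has_real_derivative ux s) (at s)"
      "\<And>s. \<bar>s\<bar> < e \<Longrightarrow> ((\<lambda>s. u (w0 + \<i> * of_real s)) has_real_derivative uy s) (at s)"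
      "(ux has_real_derivative uxx) (at 0)" "(uy has_real_derivative uyy) (at 0)" "L = uxx + uyy"
      unfolding has_laplacian_def by blast
    obtain d where d: "d > 0" "ball w0 d \<subseteq> S"
      using assms(2) \<open>w0 \<in> S\<close> open_contains_ball by blast
    have mx: "u (w0 + a * of_real s) \<le> u w0" if "\<bar>s\<bar> < d" "cmod a = 1" for a s
    proof -
      have "w0 + a * of_real s \<in> ball w0 d" using that by (simp add: dist_norm norm_mult)
      then show ?thesis using d w0 closure_subset by blast
    qed
    have "uxx \<le> 0"
      by (rule second_derivative_nonpos_at_max[of "min e d" "\<lambda>s. u (w0 + of_real s)" ux])
        (use 1 d mx[of _ 1] in auto)
    moreover have "uyy \<le> 0"
      by (rule second_derivative_nonpos_at_max[of "min e d" "\<lambda>s. u (w0 + \<i> * of_real s)" uy])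
        (use 1 d mx[of _ \<i>] in auto)
    ultimately show False using \<open>L > 0\<close> 1 by simp
  qed
  then have "w0 \<in> frontier S" using w0 assms(2) by (simp add: frontier_def interior_open)
  then show ?thesis using bd w0(2)[of w] \<open>w \<in> S\<close> closure_subset by fastforce
qed

text \<open>Two derivatives in the direction i produce the factor \<open>\<i> * \<i>\<close>, which
  makes them cancel the two in the direction 1.\<close>

lemma has_laplacian_Im:
  assumes "H holomorphic_on S" "open S" "w \<in> S"
  shows "has_laplacian (\<lambda>z. Im (H z)) 0 w"
proof -
  obtain d where d: "d > 0" "ball w d \<subseteq> S"
    using assms(2,3) open_contains_ball by blast
  have line: "((\<lambda>s. G (w + a * of_real s)) has_vector_derivative a * deriv G (w + a * of_real s)) (at s)"
    if "G holomorphic_on S" "\<bar>s\<bar> < d" "cmod a = 1" for G a s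
  proof -
    have "w + a * of_real s \<in> ball w d" using that by (simp add: dist_norm norm_mult)
    then have "(G has_field_derivative deriv G (w + a * of_real s)) (at (w + a * of_real s))"
      using d that(1) assms(2) holomorphic_derivI by blast
    moreover have "((\<lambda>s. w + a * of_real s) has_vector_derivative a) (at s)"
      by (auto intro!: derivative_eq_intros)
    ultimately show ?thesis
      using field_vector_diff_chain_at[of "\<lambda>s. w + a * of_real s" a s G] by (simp add: o_def)
  qed
  have dH: "deriv H holomorphic_on S" using assms by (simp add: holomorphic_deriv)
  have Im1: "((\<lambda>s. Im (G s)) has_real_derivative Im G') (at s)"
    if "(G has_vector_derivative G') (at s)" for G G' and s :: real
    using bounded_linear.has_vector_derivative[OF bounded_linear_Im that]
    by (simp add: has_real_derivative_iff_has_vector_derivative)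
  show ?thesis unfolding has_laplacian_def
    apply (rule exI[of _ d], intro conjI)
    subgoal using d(1) .
    apply (rule exI[of _ "\<lambda>s. Im (deriv H (w + of_real s))"],
        rule exI[of _ "\<lambda>s. Im (\<i> * deriv H (w + \<i> * of_real s))"],
        rule exI[of _ "Im (deriv (deriv H) w)"], rule exI[of _ "Im (\<i> * (\<i> * deriv (deriv H) w))"])
    apply (intro conjI allI impI)
    subgoal for s using Im1[OF line[OF assms(1), of s 1]] by simp
    subgoal for s using Im1[OF line[OF assms(1), of s \<i>]] by simp
    subgoal using Im1[OF line[OF dH, of 0 1]] d by simp
    subgoal using Im1[OF has_vector_derivative_mult_right[OF line[OF dH, of 0 \<i>], of \<i>]] d by simp
    subgoal by simp
    done
qed

text \<open>For \<open>\<gamma> = circ h r\<close> and \<open>\<delta> = 0\<close> this is 2 pi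
  times the function \<open>u\<^sub>h\<close> of the overview.\<close>

definition pot :: "(real \<Rightarrow> complex) \<Rightarrow> real \<Rightarrow> real \<Rightarrow> real \<Rightarrow> real"
  where "pot \<gamma> \<delta> x y = cint (\<lambda>t. seg \<delta> (\<gamma> t) x y)"

lemma integral_pos:
  fixes h :: "real \<Rightarrow> real"
  assumes "continuous_on {a..b} h" "a < b" "\<And>t. t \<in> {a..b} \<Longrightarrow> h t > 0"
  shows "integral {a..b} h > 0"
proof -
  have "integral {a..b} h \<ge> 0" using assms(3) by (intro integral_nonneg integrable_continuous_interval assms(1)) (auto intro: less_imp_le)
  moreover have "integral {a..b} h \<noteq> 0"
    using integral_eq_0_iff[OF assms(1,2)] assms(2) assms(3)[of a] by (auto simp: less_imp_le[OF assms(3)])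
  ultimately show ?thesis by simp
qed

lemma line_primitive_smooth_DERIV:
  assumes "\<delta> \<noteq> 0"
  shows "((\<lambda>x. line_primitive (sqrt ((a - x)\<^sup>2 + \<delta>\<^sup>2)) Y) has_real_derivative
      arctan (Y / sqrt ((a - x)\<^sup>2 + \<delta>\<^sup>2)) * ((x - a) / sqrt ((a - x)\<^sup>2 + \<delta>\<^sup>2))) (at x)"
    and "((\<lambda>x. arctan (Y / sqrt ((a - x)\<^sup>2 + \<delta>\<^sup>2)) * ((x - a) / sqrt ((a - x)\<^sup>2 + \<delta>\<^sup>2))) has_real_derivative
      \<delta>\<^sup>2 / sqrt ((a - x)\<^sup>2 + \<delta>\<^sup>2) ^ 3 * arctan (Y / sqrt ((a - x)\<^sup>2 + \<delta>\<^sup>2))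
      - (a - x)\<^sup>2 * Y / (((a - x)\<^sup>2 + \<delta>\<^sup>2) * ((a - x)\<^sup>2 + \<delta>\<^sup>2 + Y\<^sup>2))) (at x)"
proof -
  let ?c = "\<lambda>x. sqrt ((a - x)\<^sup>2 + \<delta>\<^sup>2)"
  have pos: "(a - x)\<^sup>2 + \<delta>\<^sup>2 > 0" using assms by (simp add: add_nonneg_pos)
  have cpos: "?c x > 0" using pos by simp
  have c2: "(?c x)\<^sup>2 = (a - x)\<^sup>2 + \<delta>\<^sup>2" using pos by simp
  have dc: "(?c has_real_derivative (x - a) / ?c x) (at x)"
    using pos by (auto intro!: derivative_eq_intros simp: divide_simps)
  \<comment> \<open>The arctangent and the logarithm contribute opposite multiples of Y c / (c^2 +
    Y^2), so only arctan (Y / c) is left.\<close>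
  have dX: "((\<lambda>X. line_primitive X Y) has_real_derivative arctan (Y / c)) (at c)" if "c > 0" for c
  proof -
    have p: "c\<^sup>2 + Y\<^sup>2 > 0" using that by (simp add: add_pos_nonneg)
    have "((\<lambda>X. arctan (Y / X)) has_real_derivative - Y / (c\<^sup>2 + Y\<^sup>2)) (at c)"
      using that p by (auto intro!: derivative_eq_intros simp: divide_simps power2_eq_square)
    moreover have "((\<lambda>X. ln (X\<^sup>2 + Y\<^sup>2)) has_real_derivative 2 * c / (c\<^sup>2 + Y\<^sup>2)) (at c)"
      using that p by (auto intro!: derivative_eq_intros)
    ultimately have "((\<lambda>X. X * arctan (Y / X) + Y * ln (X\<^sup>2 + Y\<^sup>2) / 2 - Y) has_real_derivative
       (1 * arctan (Y / c) + - Y / (c\<^sup>2 + Y\<^sup>2) * c) + Y * (2 * c / (c\<^sup>2 + Y\<^sup>2)) / 2 - 0) (at c)"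
      by (intro DERIV_diff DERIV_add DERIV_mult DERIV_ident DERIV_cdivide DERIV_cmult DERIV_const)
    moreover have "(1 * A + - Y / S * c) + Y * (2 * c / S) / 2 - 0 = A" for A S :: real
      by simp
    ultimately show ?thesis by (simp only: line_primitive_def)
  qed
  show "((\<lambda>x. line_primitive (?c x) Y) has_real_derivative arctan (Y / ?c x) * ((x - a) / ?c x)) (at x)"
    by (rule DERIV_chain2[OF dX[OF cpos] dc])
  have "((\<lambda>x. arctan (Y / g x) * ((x - a) / g x)) has_real_derivative
     (- Y * g' / (g x)\<^sup>2) / (1 + (Y / g x)\<^sup>2) * ((x - a) / g x)
     + arctan (Y / g x) * ((g x - (x - a) * g') / (g x)\<^sup>2)) (at x)"
    if "(g has_real_derivative g') (at x)" "g x > 0" for g g'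
  proof -
    have "((\<lambda>x. arctan (Y / g x)) has_real_derivative (- Y * g' / (g x)\<^sup>2) / (1 + (Y / g x)\<^sup>2)) (at x)"
      using that by (auto intro!: derivative_eq_intros simp: power2_eq_square divide_inverse)
    moreover have "((\<lambda>x. (x - a) / g x) has_real_derivative (g x - (x - a) * g') / (g x)\<^sup>2) (at x)"
      using that by (auto intro!: derivative_eq_intros simp: power2_eq_square)
    ultimately show ?thesis
      by (subst mult.commute[of "arctan (Y / g x)" "_ / _"]) (rule DERIV_mult)
  qed
  from this[OF dc cpos]
  have D: "((\<lambda>x. arctan (Y / ?c x) * ((x - a) / ?c x)) has_real_derivative
     (- Y * ((x - a) / ?c x) / (?c x)\<^sup>2) / (1 + (Y / ?c x)\<^sup>2) * ((x - a) / ?c x)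
     + arctan (Y / ?c x) * ((?c x - (x - a) * ((x - a) / ?c x)) / (?c x)\<^sup>2)) (at x)" .
  have e1: "(- Y * ((x - a) / c) / c\<^sup>2) / (1 + (Y / c)\<^sup>2) * ((x - a) / c) = - ((a - x)\<^sup>2 * Y / (c\<^sup>2 * (c\<^sup>2 + Y\<^sup>2)))"
    if "c > 0" for c :: real
  proof -
    have "c\<^sup>2 + Y\<^sup>2 > 0" using that by (simp add: add_pos_nonneg)
    then show ?thesis using that by (simp add: divide_simps power2_eq_square) (simp add: algebra_simps)
  qed
  have e2: "(?c x - (x - a) * ((x - a) / ?c x)) / (?c x)\<^sup>2 = \<delta>\<^sup>2 / ?c x ^ 3"
  proof -
    have "?c x - (x - a) * ((x - a) / ?c x) = ((?c x)\<^sup>2 - (x - a)\<^sup>2) / ?c x"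
      using cpos by (simp add: field_simps power2_eq_square)
    also have "\<dots> = \<delta>\<^sup>2 / ?c x" unfolding c2 by (simp add: power2_commute)
    finally show ?thesis by (simp add: power3_eq_cube power2_eq_square)
  qed
  have "(- Y * ((x - a) / ?c x) / (?c x)\<^sup>2) / (1 + (Y / ?c x)\<^sup>2) * ((x - a) / ?c x)
     + arctan (Y / ?c x) * ((?c x - (x - a) * ((x - a) / ?c x)) / (?c x)\<^sup>2)
     = \<delta>\<^sup>2 / ?c x ^ 3 * arctan (Y / ?c x) - (a - x)\<^sup>2 * Y / (((a - x)\<^sup>2 + \<delta>\<^sup>2) * ((a - x)\<^sup>2 + \<delta>\<^sup>2 + Y\<^sup>2))"
    unfolding e1[OF cpos] e2 unfolding c2 by simp
  with D show "((\<lambda>x. arctan (Y / ?c x) * ((x - a) / ?c x)) has_real_derivative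
      \<delta>\<^sup>2 / ?c x ^ 3 * arctan (Y / ?c x) - (a - x)\<^sup>2 * Y / (((a - x)\<^sup>2 + \<delta>\<^sup>2) * ((a - x)\<^sup>2 + \<delta>\<^sup>2 + Y\<^sup>2))) (at x)"
    by (simp only:)
qed

text \<open>For c = sqrt ((a - x)^2 + \<delta>^2), \<open>q Y\<close> is the Laplacian in (x, Y) of
  \<open>line_primitive c Y\<close>. It is odd in Y with derivative 2 \<delta>^2 / (c^2 + Y^2)^2 >
  0, the Laplacian of the smoothed logarithm, so that q (y + b) + q (y - b) = q (b + y) - q (b - y)
  > 0.\<close>

lemma seg_laplacian_pos:
  fixes c y b \<delta> :: real
  assumes "c > 0" "y > 0" "\<delta> \<noteq> 0"
  defines "q \<equiv> \<lambda>Y. \<delta>\<^sup>2 / c ^ 3 * arctan (Y / c) + \<delta>\<^sup>2 * Y / (c\<^sup>2 * (c\<^sup>2 + Y\<^sup>2))"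
  shows "q (y + b) + q (y - b) > 0"
proof -
  have odd: "q (- Y) = - q Y" for Y by (simp add: q_def arctan_minus)
  have p: "c\<^sup>2 + Y\<^sup>2 > 0" for Y using assms(1) by (simp add: add_pos_nonneg)
  have "q (b - y) < q (b + y)"
  proof (rule DERIV_pos_imp_increasing[where f = q])
    fix Y
    have "((\<lambda>Y. Y / (c\<^sup>2 + Y\<^sup>2)) has_real_derivative (c\<^sup>2 - Y\<^sup>2) / (c\<^sup>2 + Y\<^sup>2)\<^sup>2) (at Y)"
      using p[of Y] by (auto intro!: derivative_eq_intros simp: power2_eq_square algebra_simps)
    moreover have "((\<lambda>Y. arctan (Y / c)) has_real_derivative c / (c\<^sup>2 + Y\<^sup>2)) (at Y)"
      using assms(1) p[of Y] by (auto intro!: derivative_eq_intros simp: divide_simps power2_eq_square)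
    ultimately have "((\<lambda>Y. \<delta>\<^sup>2 / c ^ 3 * arctan (Y / c) + \<delta>\<^sup>2 / c\<^sup>2 * (Y / (c\<^sup>2 + Y\<^sup>2))) has_real_derivative
        \<delta>\<^sup>2 / c ^ 3 * (c / (c\<^sup>2 + Y\<^sup>2)) + \<delta>\<^sup>2 / c\<^sup>2 * ((c\<^sup>2 - Y\<^sup>2) / (c\<^sup>2 + Y\<^sup>2)\<^sup>2)) (at Y)"
      by (intro DERIV_add DERIV_cmult)
    moreover have "\<delta>\<^sup>2 / c ^ 3 * (c / s) + \<delta>\<^sup>2 / c\<^sup>2 * ((c\<^sup>2 - Y\<^sup>2) / s\<^sup>2) = \<delta>\<^sup>2 * (s + (c\<^sup>2 - Y\<^sup>2)) / (c\<^sup>2 * s\<^sup>2)"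
      if "s > 0" for s
      using that assms(1) by (simp add: divide_simps power2_eq_square power3_eq_cube) (simp add: algebra_simps)
    from this[OF p] have "\<delta>\<^sup>2 / c ^ 3 * (c / (c\<^sup>2 + Y\<^sup>2)) + \<delta>\<^sup>2 / c\<^sup>2 * ((c\<^sup>2 - Y\<^sup>2) / (c\<^sup>2 + Y\<^sup>2)\<^sup>2) =
        \<delta>\<^sup>2 * (2 * c\<^sup>2) / (c\<^sup>2 * (c\<^sup>2 + Y\<^sup>2)\<^sup>2)" by simp
    moreover have "\<delta>\<^sup>2 * (2 * c\<^sup>2) / (c\<^sup>2 * (c\<^sup>2 + Y\<^sup>2)\<^sup>2) > 0" using p[of Y] assms(1,3) by simp
    moreover have "q = (\<lambda>Y. \<delta>\<^sup>2 / c ^ 3 * arctan (Y / c) + \<delta>\<^sup>2 / c\<^sup>2 * (Y / (c\<^sup>2 + Y\<^sup>2)))"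
      by (auto simp: q_def fun_eq_iff)
    ultimately show "\<exists>y. (q has_real_derivative y) (at Y) \<and> 0 < y"
      by (intro exI[of _ "\<delta>\<^sup>2 * (2 * c\<^sup>2) / (c\<^sup>2 * (c\<^sup>2 + Y\<^sup>2)\<^sup>2)"]) simp
  qed (use assms in auto)
  then show ?thesis using odd[of "b - y"] by (simp add: algebra_simps)
qed

text \<open>For \<delta> \<noteq> 0 the distance \<open>c\<close> never vanishes, so all integrands
  are jointly continuous and one may differentiate twice under the integral in each direction. The
  Laplacian is the integral over the curve of the positive quantity in
  \<open>seg_laplacian_pos\<close>.\<close>

lemma has_laplacian_pot:
  assumes "continuous_on {-pi..pi} \<gamma>" "\<delta> \<noteq> 0" "Im w > 0"
  shows "\<exists>L>0. has_laplacian (\<lambda>z. pot \<gamma> \<delta> (Re z) (Im z)) L w"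
proof -
  define c where "c = (\<lambda>x t. sqrt ((Re (\<gamma> t) - x)\<^sup>2 + \<delta>\<^sup>2))"
  have pos: "(Re (\<gamma> t) - x)\<^sup>2 + \<delta>\<^sup>2 > 0" for x t using assms(2) by (simp add: add_nonneg_pos)
  have cpos: "c x t > 0" for x t using pos by (simp add: c_def)
  have c2: "(c x t)\<^sup>2 = (Re (\<gamma> t) - x)\<^sup>2 + \<delta>\<^sup>2" for x t using pos[of t x] by (simp add: c_def)
  have cne: "c x t \<noteq> 0" for x t using cpos[of x t] by simp
  have p: "(c x t)\<^sup>2 + Y\<^sup>2 > 0" for x t Y using cpos[of x t] by (simp add: add_pos_nonneg)
  have pne: "(c x t)\<^sup>2 + Y\<^sup>2 \<noteq> 0" for x t Y using p[of x t Y] by linarith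
  have ccont [continuous_intros]: "continuous_on S (\<lambda>s. c (u s) (v s))"
    if "continuous_on S u" "continuous_on S v" "v ` S \<subseteq> {-pi..pi}" for S :: "(real\<times>real) set" and u v
    unfolding c_def using that by (intro continuous_intros continuous_on_compose2[OF assms(1)]) auto
  have gcont [continuous_intros]: "continuous_on S (\<lambda>s. \<gamma> (v s))"
    if "continuous_on S v" "v ` S \<subseteq> {-pi..pi}" for S :: "(real\<times>real) set" and v
    using that by (intro continuous_on_compose2[OF assms(1)]) auto
  define x0 where "x0 = Re w"
  define y0 where "y0 = Im w"
  define lx where "lx = (\<lambda>x t Y. arctan (Y / c x t) * ((x - Re (\<gamma> t)) / c x t))"
  define lxx where "lxx = (\<lambda>x t Y. \<delta>\<^sup>2 / c x t ^ 3 * arctan (Y / c x t)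
      - (Re (\<gamma> t) - x)\<^sup>2 * Y / ((c x t)\<^sup>2 * ((c x t)\<^sup>2 + Y\<^sup>2)))"
  define ly where "ly = (\<lambda>x t Y. ln ((c x t)\<^sup>2 + Y\<^sup>2) / 2)"
  define lyy where "lyy = (\<lambda>x t Y. Y / ((c x t)\<^sup>2 + Y\<^sup>2))"
  have dlx: "((\<lambda>x. line_primitive (c x t) Y) has_real_derivative lx x t Y) (at x)"
    and dlxx: "((\<lambda>x. lx x t Y) has_real_derivative lxx x t Y) (at x)" for x t Y
    using line_primitive_smooth_DERIV[OF assms(2), where a = "Re (\<gamma> t)" and Y = Y and x = x]
    unfolding lx_def lxx_def c2 unfolding c_def by auto
  have dly: "((\<lambda>Y. line_primitive (c x t) Y) has_real_derivative ly x t Y) (at Y)" for x t Y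
    using line_primitive_DERIV[of "c x t" Y] cpos[of x t] by (simp add: ly_def)
  have dlyy: "((\<lambda>Y. ly x t Y) has_real_derivative lyy x t Y) (at Y)" for x t Y
  proof -
    have "((\<lambda>Y. ln ((c x t)\<^sup>2 + Y\<^sup>2)) has_real_derivative 2 * Y / ((c x t)\<^sup>2 + Y\<^sup>2)) (at Y)"
      using p[of x t Y] by (auto intro!: derivative_eq_intros)
    from DERIV_cdivide[OF this, of 2]
    show ?thesis unfolding ly_def lyy_def by (simp only: divide_divide_eq_left mult.commute[of _ 2] mult_divide_mult_cancel_left_if) simp
  qed
  have segc: "seg \<delta> (\<gamma> t) x y = line_primitive (c x t) (y + Im (\<gamma> t)) + line_primitive (c x t) (y - Im (\<gamma> t))"
    for t x y by (simp add: seg_def c_def)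
  have sh: "((\<lambda>s. h (v s)) has_real_derivative d) (at s)"
    if "(h has_real_derivative d) (at (v s))" "(v has_real_derivative 1) (at s)" for h v :: "real \<Rightarrow> real" and d s
    using DERIV_chain2[OF that] by simp
  have leibniz: "((\<lambda>s. cint (\<lambda>t. k s t + l s t)) has_real_derivative
      cint (\<lambda>t. k' s t + l' s t)) (at s)"
    if "\<And>s t. ((\<lambda>s. k s t) has_real_derivative k' s t) (at s)" "\<And>s t. ((\<lambda>s. l s t) has_real_derivative l' s t) (at s)"
      and c: "continuous_on (UNIV \<times> {-pi..pi}) (\<lambda>(s, t). k s t + l s t)"
        "continuous_on (UNIV \<times> {-pi..pi}) (\<lambda>(s, t). k' s t + l' s t)"
    for k l k' l' :: "real \<Rightarrow> real \<Rightarrow> real" and s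
    unfolding interval_cbox
  proof (rule leibniz_rule_field_derivative[where U = UNIV])
    fix s :: real
    have "continuous_on {-pi..pi} (\<lambda>t. (s, t))" by (intro continuous_intros)
    from continuous_on_compose2[OF c(1) this]
    show "(\<lambda>t. k s t + l s t) integrable_on cbox (-pi) pi"
      by (auto intro: integrable_continuous_interval)
  qed (use that in \<open>auto intro: DERIV_add\<close>)
  have px: "continuous_on (UNIV \<times> {-pi..pi}) (\<lambda>(s, t). line_primitive (c (x0 + s) t) (y0 + Im (\<gamma> t))
      + line_primitive (c (x0 + s) t) (y0 - Im (\<gamma> t)))"
    and cx: "continuous_on (UNIV \<times> {-pi..pi}) (\<lambda>(s, t). lx (x0 + s) t (y0 + Im (\<gamma> t)) + lx (x0 + s) t (y0 - Im (\<gamma> t)))"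
    and cxx: "continuous_on (UNIV \<times> {-pi..pi}) (\<lambda>(s, t). lxx (x0 + s) t (y0 + Im (\<gamma> t)) + lxx (x0 + s) t (y0 - Im (\<gamma> t)))"
    and py: "continuous_on (UNIV \<times> {-pi..pi}) (\<lambda>(s, t). line_primitive (c x0 t) (y0 + s + Im (\<gamma> t))
      + line_primitive (c x0 t) (y0 + s - Im (\<gamma> t)))"
    and cy: "continuous_on (UNIV \<times> {-pi..pi}) (\<lambda>(s, t). ly x0 t (y0 + s + Im (\<gamma> t)) + ly x0 t (y0 + s - Im (\<gamma> t)))"
    and cyy: "continuous_on (UNIV \<times> {-pi..pi}) (\<lambda>(s, t). lyy x0 t (y0 + s + Im (\<gamma> t)) + lyy x0 t (y0 + s - Im (\<gamma> t)))"
    unfolding lx_def lxx_def ly_def lyy_def case_prod_beta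
    by (intro continuous_intros; auto simp: cne pne)+
  have shift: "((\<lambda>s. x0 + s) has_real_derivative 1) (at s)" "((\<lambda>s. y0 + s + d) has_real_derivative 1) (at s)"
    "((\<lambda>s. y0 + s - d) has_real_derivative 1) (at s)" for s d
    by (auto intro!: derivative_eq_intros)
  note Dx = leibniz[OF sh[OF dlx shift(1)] sh[OF dlx shift(1)] px cx]
    and Dxx = leibniz[OF sh[OF dlxx shift(1)] sh[OF dlxx shift(1)] cx cxx, of 0]
    and Dy = leibniz[OF sh[OF dly shift(2)] sh[OF dly shift(3)] py cy]
    and Dyy = leibniz[OF sh[OF dlyy shift(2)] sh[OF dlyy shift(3)] cy cyy, of 0]
  define L where "L = cint (\<lambda>t. lxx x0 t (y0 + Im (\<gamma> t)) + lxx x0 t (y0 - Im (\<gamma> t)))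
    + cint (\<lambda>t. lyy x0 t (y0 + Im (\<gamma> t)) + lyy x0 t (y0 - Im (\<gamma> t)))"
  have zero: "continuous_on {-pi..pi} (\<lambda>t. (0::real, t))" by (intro continuous_intros)
  have i1: "continuous_on {-pi..pi} (\<lambda>t. lxx x0 t (y0 + Im (\<gamma> t)) + lxx x0 t (y0 - Im (\<gamma> t)))"
    and i2: "continuous_on {-pi..pi} (\<lambda>t. lyy x0 t (y0 + Im (\<gamma> t)) + lyy x0 t (y0 - Im (\<gamma> t)))"
    using continuous_on_compose2[OF cxx zero] continuous_on_compose2[OF cyy zero] by auto
  have "L = cint (\<lambda>t. (lxx x0 t (y0 + Im (\<gamma> t)) + lxx x0 t (y0 - Im (\<gamma> t)))
     + (lyy x0 t (y0 + Im (\<gamma> t)) + lyy x0 t (y0 - Im (\<gamma> t))))"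
    unfolding L_def by (intro integral_add[symmetric] integrable_continuous_interval i1 i2)
  also have "\<dots> > 0"
  proof (rule integral_pos)
    fix t
    \<comment> \<open>After the substitution (Re \<gamma> - x0)^2 = c^2 - \<delta>^2 the parts of
      the two second derivatives without \<delta> cancel; what remains is the function
      \<open>q\<close> of \<open>seg_laplacian_pos\<close>.\<close>
    have eq: "lxx x0 t Y + lyy x0 t Y = \<delta>\<^sup>2 / c x0 t ^ 3 * arctan (Y / c x0 t)
        + \<delta>\<^sup>2 * Y / ((c x0 t)\<^sup>2 * ((c x0 t)\<^sup>2 + Y\<^sup>2))" for Y
    proof -
      have "(Re (\<gamma> t) - x0)\<^sup>2 = (c x0 t)\<^sup>2 - \<delta>\<^sup>2" by (simp add: c2)
      then have "lxx x0 t Y + lyy x0 t Y = \<delta>\<^sup>2 / c x0 t ^ 3 * arctan (Y / c x0 t)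
        - ((c x0 t)\<^sup>2 - \<delta>\<^sup>2) * Y / ((c x0 t)\<^sup>2 * ((c x0 t)\<^sup>2 + Y\<^sup>2)) + Y / ((c x0 t)\<^sup>2 + Y\<^sup>2)"
        by (simp add: lxx_def lyy_def)
      moreover have "- (d - e) * Y / (d * s) + Y / s = e * Y / (d * s)" if "d \<noteq> 0" for d e s :: real
        using that by (cases "s = 0") (simp_all add: field_simps)
      from this[of "(c x0 t)\<^sup>2" "\<delta>\<^sup>2" "(c x0 t)\<^sup>2 + Y\<^sup>2"] cne
      have "- ((c x0 t)\<^sup>2 - \<delta>\<^sup>2) * Y / ((c x0 t)\<^sup>2 * ((c x0 t)\<^sup>2 + Y\<^sup>2)) + Y / ((c x0 t)\<^sup>2 + Y\<^sup>2)
         = \<delta>\<^sup>2 * Y / ((c x0 t)\<^sup>2 * ((c x0 t)\<^sup>2 + Y\<^sup>2))" by simp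
      ultimately show ?thesis by (simp only: minus_divide_left[symmetric] mult_minus_left)
    qed
    have "(lxx x0 t (y0 + Im (\<gamma> t)) + lyy x0 t (y0 + Im (\<gamma> t)))
      + (lxx x0 t (y0 - Im (\<gamma> t)) + lyy x0 t (y0 - Im (\<gamma> t))) > 0"
      unfolding eq using assms(2,3) by (intro seg_laplacian_pos cpos) (auto simp: y0_def)
    then show "0 < (lxx x0 t (y0 + Im (\<gamma> t)) + lxx x0 t (y0 - Im (\<gamma> t)))
     + (lyy x0 t (y0 + Im (\<gamma> t)) + lyy x0 t (y0 - Im (\<gamma> t)))" by simp
  qed (use i1 i2 in \<open>auto intro!: continuous_intros\<close>)
  finally have "L > 0" .
  moreover have "has_laplacian (\<lambda>z. pot \<gamma> \<delta> (Re z) (Im z)) L w"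
    unfolding has_laplacian_def
    apply (rule exI[of _ 1], intro conjI, simp)
    apply (rule exI, rule exI, rule exI, rule exI, intro conjI allI impI)
    using Dx Dy Dxx Dyy by (auto simp: x0_def[symmetric] y0_def[symmetric] L_def pot_def segc)
  ultimately show ?thesis by blast
qed

section \<open>Circular means of logarithms\<close>

lemma integral_periodic_shift:
  fixes v :: "real \<Rightarrow> 'a::banach"
  assumes "continuous_on UNIV v" and per: "\<And>t. v (t + 2 * pi) = v t" and "\<bar>s\<bar> \<le> pi"
  shows "cint (\<lambda>t. v (t + s)) = cint v"
proof -
  have int: "v integrable_on {a..b}" for a b
    by (intro integrable_continuous_interval continuous_on_subset[OF assms(1)]) auto
  have shift: "integral {a..b} (\<lambda>t. v (t + c)) = integral {a + c..b + c} v" for a b c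
    using integral_shift_Icc_real[of a b v c] by (simp add: o_def add.commute)
  have shift2: "integral {a + 2 * pi..b + 2 * pi} v = integral {a..b} v" for a b
    using shift[of a b "2 * pi"] by (simp add: per)
  show ?thesis
  proof (cases "s \<ge> 0")
    case True
    have "integral {-pi + s..pi + s} v = integral {-pi + s..pi} v + integral {pi..pi + s} v"
      using True assms(3) by (intro Henstock_Kurzweil_Integration.integral_combine[symmetric] int) auto
    also have "integral {pi..pi + s} v = integral {-pi..-pi + s} v"
      using shift2[of "-pi" "-pi + s"] by (simp add: algebra_simps)
    also have "integral {-pi + s..pi} v + integral {-pi..-pi + s} v = cint v"
      using True assms(3) by (subst add.commute, intro Henstock_Kurzweil_Integration.integral_combine int) auto
    finally show ?thesis by (simp add: shift)
  next
    case False
    have "integral {-pi + s..pi + s} v = integral {-pi + s..-pi} v + integral {-pi..pi + s} v"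
      using False assms(3) by (intro Henstock_Kurzweil_Integration.integral_combine[symmetric] int) auto
    also have "integral {-pi + s..-pi} v = integral {pi + s..pi} v"
      using shift2[of "-pi + s" "-pi"] by (simp add: algebra_simps)
    also have "integral {pi + s..pi} v + integral {-pi..pi + s} v = cint v"
      using False assms(3) by (subst add.commute, intro Henstock_Kurzweil_Integration.integral_combine int) auto
    finally show ?thesis by (simp add: shift)
  qed
qed

lemma riemann_sum_le_integral:
  fixes v :: "real \<Rightarrow> real"
  assumes "continuous_on UNIV v" "h > 0"
    and osc: "\<And>s t. \<bar>s - t\<bar> \<le> h \<Longrightarrow> {s, t} \<subseteq> {a..a + real n * h} \<Longrightarrow> v s \<le> v t + \<epsilon>"
  shows "(\<Sum>j<n. h * v (a + real j * h)) \<le> integral {a..a + real n * h} v + real n * h * \<epsilon>"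
  using osc
proof (induction n)
  case 0
  then show ?case by simp
next
  case (Suc n)
  have int: "u integrable_on {a..b}" if "continuous_on UNIV u" for u :: "real \<Rightarrow> real" and a b
    by (intro integrable_continuous_interval continuous_on_subset[OF that]) auto
  have le: "a + real n * h \<le> a + real (Suc n) * h" "a \<le> a + real n * h"
    using assms(2) by (auto simp: algebra_simps)
  have "(\<Sum>j<n. h * v (a + real j * h)) \<le> integral {a..a + real n * h} v + real n * h * \<epsilon>"
    by (rule Suc.IH, rule Suc.prems) (use le in auto)
  moreover have "h * v (a + real n * h) \<le> integral {a + real n * h..a + real (Suc n) * h} v + h * \<epsilon>"
  proof -
    have "integral {a + real n * h..a + real (Suc n) * h} (\<lambda>t. v (a + real n * h))
        \<le> integral {a + real n * h..a + real (Suc n) * h} (\<lambda>t. v t + \<epsilon>)"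
    proof (intro integral_le int continuous_intros assms(1) Suc.prems)
      fix t assume t: "t \<in> {a + real n * h..a + real (Suc n) * h}"
      then show "{a + real n * h, t} \<subseteq> {a..a + real (Suc n) * h}" using le by auto
      show "\<bar>a + real n * h - t\<bar> \<le> h" using t by (auto simp: algebra_simps)
    qed
    also have "\<dots> = integral {a + real n * h..a + real (Suc n) * h} v + h * \<epsilon>"
      by (subst integral_add) (auto intro!: int assms(1) simp: algebra_simps assms(2) less_imp_le)
    finally show ?thesis using assms(2) by (simp add: algebra_simps)
  qed
  moreover have "integral {a..a + real (Suc n) * h} v
      = integral {a..a + real n * h} v + integral {a + real n * h..a + real (Suc n) * h} v"
    by (intro Henstock_Kurzweil_Integration.integral_combine[symmetric] int assms(1) le)
  ultimately show ?case by (simp add: algebra_simps)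
qed

text \<open>The maximum principle for the products \<open>\<Prod>j<N. G (\<omega>\<^sup>j z)\<close> over the \<open>N\<close>-th roots of unity
  turns, for large \<open>N\<close>, Riemann sums of \<open>v\<close> into an upper bound for \<open>ln (cmod (G 0))\<close>;
  zeros of \<open>G\<close> need no attention.\<close>

lemma ln_cmod_le_mean_majorant:
  assumes holG: "G holomorphic_on ball 0 R" and r: "0 < r" "r < R" and "G 0 \<noteq> 0"
    and contv: "continuous_on UNIV v" and per: "\<And>t. v (t + 2 * pi) = v t"
    and maj: "\<And>t. cmod (G (of_real r * cis t)) \<le> exp (v t)"
  shows "2 * pi * ln (cmod (G 0)) \<le> cint v"
proof (rule field_le_epsilon)
  fix e :: real assume "e > 0"
  define \<epsilon> where "\<epsilon> = e / (2 * pi)"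
  have "\<epsilon> > 0" using \<open>e > 0\<close> by (simp add: \<epsilon>_def)
  \<comment> \<open>For |\<theta>| \<le> pi the period that starts at \<theta> - pi lies in this
    interval.\<close>
  have "uniformly_continuous_on {-2*pi..2*pi} v"
    by (intro compact_uniformly_continuous continuous_on_subset[OF contv]) auto
  then obtain d where d: "d > 0" "\<And>s t. s \<in> {-2*pi..2*pi} \<Longrightarrow> t \<in> {-2*pi..2*pi} \<Longrightarrow> dist t s < d \<Longrightarrow> dist (v t) (v s) < \<epsilon>"
    unfolding uniformly_continuous_on_def using \<open>\<epsilon> > 0\<close> by blast
  obtain N :: nat where N: "real N > 2 * pi / d" using reals_Archimedean2 by blast
  have "N > 0" using N d by (intro gr0I) (auto simp: field_simps)
  define h where "h = 2 * pi / real N"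
  have h: "h > 0" "h < d" "real N * h = 2 * pi"
    using N d \<open>N > 0\<close> by (auto simp: h_def field_simps)
  \<comment> \<open>On |z| = r, ln |Q| is at most a Riemann sum of \<open>v\<close> divided by
    \<open>h\<close>, whatever the argument of z; at 0 all N = 2 pi / h factors are
    \<open>G 0\<close>.\<close>
  define Q where "Q = (\<lambda>z. \<Prod>j<N. G (cis (- pi + real j * h) * z))"
  have sub: "cis a * z \<in> ball 0 R" if "z \<in> cball 0 r" for a z
    using that r by (auto simp: norm_mult)
  have holQ: "Q holomorphic_on cball 0 r" unfolding Q_def
    by (intro holomorphic_intros holomorphic_on_compose_gen[OF _ holG, unfolded o_def]) (use sub in auto)
  have "cmod (Q 0) \<le> exp ((cint v + e) / h)"
  proof (rule maximum_modulus_frontier[of Q "cball 0 r"])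
    show "Q holomorphic_on interior (cball 0 r)"
      by (rule holomorphic_on_subset[OF holQ]) (rule interior_subset)
    show "continuous_on (closure (cball 0 r)) Q"
      using holQ by (simp add: holomorphic_on_imp_continuous_on)
    fix z :: complex assume "z \<in> frontier (cball 0 r)"
    then have "cmod z = r" using r by (simp add: frontier_cball)
    then obtain \<theta> where \<theta>: "z = of_real r * cis \<theta>" "\<bar>\<theta>\<bar> \<le> pi"
      using rcis_cmod_Arg[of z] Arg_bounded[of z] by (auto simp: rcis_def intro!: that[of "Arg z"])
    have "cmod (Q z) = (\<Prod>j<N. cmod (G (of_real r * cis (\<theta> - pi + real j * h))))"
      unfolding Q_def prod_norm[symmetric] \<theta>
      by (intro prod.cong refl) (simp add: cis_mult[symmetric] cis_divide[symmetric] mult_ac cis_mult[of "real _ * h"] algebra_simps flip: cis_mult)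
    also have "\<dots> \<le> (\<Prod>j<N. exp (v (\<theta> - pi + real j * h)))"
      by (intro prod_mono) (use maj in auto)
    also have "\<dots> = exp ((\<Sum>j<N. h * v (\<theta> - pi + real j * h)) / h)"
      using h(1) by (simp add: exp_sum[symmetric] sum_divide_distrib)
    also have "\<dots> \<le> exp ((cint v + e) / h)"
    proof -
      have "(\<Sum>j<N. h * v (\<theta> - pi + real j * h)) \<le> integral {\<theta> - pi..\<theta> - pi + real N * h} v + real N * h * \<epsilon>"
      proof (rule riemann_sum_le_integral[OF contv h(1)])
        fix s t assume "\<bar>s - t\<bar> \<le> h" "{s, t} \<subseteq> {\<theta> - pi..\<theta> - pi + real N * h}"
        then have "dist (v s) (v t) < \<epsilon>"
          using h \<theta>(2) by (intro d(2)) (auto simp: dist_real_def)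
        then show "v s \<le> v t + \<epsilon>" by (simp add: dist_real_def)
      qed
      also have "integral {\<theta> - pi..\<theta> - pi + real N * h} v = cint v"
        using integral_periodic_shift[OF contv per \<theta>(2)] integral_shift_Icc_real[of "-pi" pi v \<theta>] h(3)
        by (simp add: o_def add.commute)
      also have "real N * h * \<epsilon> = e" unfolding h(3) by (simp add: \<epsilon>_def)
      finally show ?thesis using h(1) by (simp add: divide_right_mono)
    qed
    finally show "cmod (Q z) \<le> exp ((cint v + e) / h)" .
  qed (use r in auto)
  moreover have "cmod (Q 0) = exp (2 * pi * ln (cmod (G 0)) / h)"
  proof -
    have "cmod (Q 0) = exp (real N * ln (cmod (G 0)))"
      using assms(4) by (simp add: Q_def norm_power exp_of_nat_mult)
    also have "real N = 2 * pi / h" using h by (simp add: field_simps)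
    finally show ?thesis by simp
  qed
  ultimately show "2 * pi * ln (cmod (G 0)) \<le> cint v + e"
    using h(1) by (simp add: divide_le_cancel)
qed

text \<open>The one-sided bound, applied to \<open>G\<close> and to \<open>1 / G\<close>, gives the
  two inequalities.\<close>

lemma mean_ln_cmod_nonvanishing:
  assumes holG: "G holomorphic_on ball 0 R" and r: "0 < r" "r < R"
    and nz: "\<And>z. z \<in> ball 0 R \<Longrightarrow> G z \<noteq> 0"
  shows "cint (\<lambda>t. ln (cmod (G (of_real r * cis t)))) = 2 * pi * ln (cmod (G 0))"
proof (rule antisym)
  have mem: "of_real r * cis t \<in> ball 0 R" for t using r by (simp add: norm_mult)
  have cont: "continuous_on UNIV (\<lambda>t. ln (cmod (G (of_real r * cis t))))"
    by (intro continuous_intros continuous_on_compose2[OF holomorphic_on_imp_continuous_on[OF holG]])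
      (use mem nz in auto)
  have per: "cis (t + 2 * pi) = cis t" for t by (simp flip: cis_mult)
  show "2 * pi * ln (cmod (G 0)) \<le> cint (\<lambda>t. ln (cmod (G (of_real r * cis t))))"
    by (rule ln_cmod_le_mean_majorant[OF holG r _ cont]) (use mem nz r in \<open>auto simp: per\<close>)
  have "2 * pi * ln (cmod (1 / G 0)) \<le> cint (\<lambda>t. - ln (cmod (G (of_real r * cis t))))"
    by (rule ln_cmod_le_mean_majorant[of "\<lambda>z. 1 / G z", OF _ r])
      (use mem nz r in \<open>auto simp: per exp_minus norm_divide inverse_eq_divide intro!: holomorphic_intros holG continuous_on_minus cont\<close>)
  then show "cint (\<lambda>t. ln (cmod (G (of_real r * cis t)))) \<le> 2 * pi * ln (cmod (G 0))"
    using nz[of 0] r by (simp add: norm_divide ln_div)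
qed

text \<open>On |z| = r one has |z - a| = |r - cnj a * z / r|, and the right side has no zero in |z|
  < 2 r - |a| because |a| (2 r - |a|) = r^2 - (r - |a|)^2 < r^2. This explains the radius
  \<open>R\<close>, which exceeds r.\<close>

lemma mean_ln_dist_circle:
  assumes "cmod a < r"
  shows "cint (\<lambda>t. ln (cmod (of_real r * cis t - a))) = 2 * pi * ln r"
proof -
  have r: "r > 0" using assms by (rule le_less_trans[OF norm_ge_zero])
  define R where "R = r + (r - cmod a)"
  have "cint (\<lambda>t. ln (cmod ((\<lambda>z. of_real r - cnj a * z / of_real r) (of_real r * cis t)))) =
    2 * pi * ln (cmod ((\<lambda>z. of_real r - cnj a * z / of_real r) 0))"
  proof (rule mean_ln_cmod_nonvanishing)
    fix z :: complex assume "z \<in> ball 0 R"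
    then have "cmod z < 2 * r - cmod a" by (simp add: R_def)
    have "cmod a * cmod z < r * r"
    proof (cases "a = 0")
      case False
      then have "cmod a * cmod z < cmod a * (2 * r - cmod a)"
        using \<open>cmod z < 2 * r - cmod a\<close> by simp
      also have "\<dots> = r * r - (r - cmod a) * (r - cmod a)" by (simp add: algebra_simps)
      also have "\<dots> \<le> r * r" by simp
      finally show ?thesis .
    qed (use r in simp)
    show "of_real r - cnj a * z / of_real r \<noteq> 0"
    proof
      assume "of_real r - cnj a * z / of_real r = (0 :: complex)"
      then have "of_real r * of_real r = cnj a * z" using r by (simp add: field_simps)
      then have "cmod (of_real r * of_real r) = cmod (cnj a * z)" by simp
      then show False using \<open>cmod a * cmod z < r * r\<close> r by (simp add: norm_mult)
    qed
  qed (use assms r in \<open>auto intro!: holomorphic_intros simp: R_def\<close>)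
  moreover have "cmod (of_real r - cnj a * (of_real r * cis t) / of_real r) = cmod (of_real r * cis t - a)" for t
  proof -
    have "of_real r - cnj a * (of_real r * cis t) / of_real r = cis t * cnj (of_real r * cis t - a)"
      using r by (simp add: algebra_simps flip: cis_cnj)
        (simp add: cis_cnj cis_mult)
    then show ?thesis by (simp only: norm_mult norm_cis complex_mod_cnj mult_1)
  qed
  ultimately show ?thesis using r by simp
qed

section \<open>Steiner symmetry of the images of smaller discs\<close>

lemma steiner_symmetric_domain_section:
  assumes "steiner_symmetric_domain D" "Complex x y \<in> D" "\<bar>t\<bar> \<le> \<bar>y\<bar>"
  shows "Complex x t \<in> D"
proof -
  define S where "S = {y::real. Complex x y \<in> D}"
  have "S = {} \<or> S = UNIV \<or> (\<exists>h>0. S = {-h<..<h})"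
    using assms(1) unfolding steiner_symmetric_domain_def S_def by (simp add: Let_def)
  moreover have "y \<in> S" using assms(2) by (simp add: S_def)
  ultimately have "t \<in> S" using assms(3) by auto
  then show ?thesis by (simp add: S_def)
qed

text \<open>Reflection in the line \<open>Im w = \<tau>\<close>: the quotient \<open>q\<close> of the reflected inverse by the
  inverse has modulus \<open>1\<close> on the line and at most \<open>1\<close> on the rest of the boundary.\<close>

lemma steiner_reflection_le:
  assumes hol: "f holomorphic_on \<D>" and inj: "inj_on f \<D>" and f0: "f 0 = 0"
    and st: "steiner_symmetric_domain (f ` \<D>)"
    and \<tau>: "0 < \<tau>" "\<tau> < Im (f z)" and z: "z \<in> \<D>"
  shows "\<exists>z'\<in>\<D>. f z' = Complex (Re (f z)) (2 * \<tau> - Im (f z)) \<and> cmod z' \<le> cmod z"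
proof -
  obtain g where g: "g holomorphic_on f ` \<D>" "\<And>z. z \<in> \<D> \<Longrightarrow> g (f z) = z"
    using holomorphic_has_inverse[OF hol open_ball inj] by metis
  have open_image: "open (f ` \<D>)" using st by (simp add: steiner_symmetric_domain_def)
  define \<sigma> where "\<sigma> = (\<lambda>w. Complex (Re w) (2 * \<tau> - Im w))"
  have \<sigma>_cnj: "\<sigma> w = cnj (w - 2 * \<i> * of_real \<tau>)" for w by (simp add: \<sigma>_def complex_eq_iff)
  \<comment> \<open>On or above the line, reflection does not increase |Im|, so Steiner symmetry
    keeps the reflected point in the domain.\<close>
  have \<sigma>_mem: "\<sigma> (f z) \<in> f ` \<D>" if "z \<in> \<D>" "Im (f z) \<ge> \<tau>" for z
  proof -
    have "Complex (Re (f z)) (Im (f z)) \<in> f ` \<D>" using that(1) by simp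
    moreover have "\<bar>2 * \<tau> - Im (f z)\<bar> \<le> \<bar>Im (f z)\<bar>" using that(2) \<tau>(1) by linarith
    ultimately show ?thesis
      unfolding \<sigma>_def by (rule steiner_symmetric_domain_section[OF st])
  qed
  have g_mem: "g w \<in> \<D>" "f (g w) = w" if "w \<in> f ` \<D>" for w
    using that g(2) by auto
  define q where "q = (\<lambda>z. cnj (g (\<sigma> (f z))) / z)"
  have nz: "z \<noteq> 0" if "Im (f z) \<ge> \<tau>" for z using that f0 \<tau> by auto
  \<comment> \<open>The two conjugations turn the reflection into the translation by -2 i \<tau>,
    followed by the holomorphic map \<open>cnj \<circ> g \<circ> cnj\<close>.\<close>
  have hq: "q holomorphic_on {z \<in> \<D>. \<tau> < Im (f z)}"
  proof -
    let ?B = "cnj ` (f ` \<D>)"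
    have "?B = cnj -` (f ` \<D>)" by (simp add: image_cnj_conv_vimage_cnj)
    moreover have "open (cnj -` (f ` \<D>))"
      using open_image by (rule open_vimage) (intro continuous_intros)
    ultimately have "open ?B" by simp
    have 1: "cnj \<circ> g \<circ> cnj holomorphic_on ?B"
      by (rule holomorphic_on_compose_cnj_cnj) (use g(1) \<open>open ?B\<close> in \<open>auto simp: image_image\<close>)
    have 2: "(\<lambda>z. f z - 2 * \<i> * of_real \<tau>) holomorphic_on {z \<in> \<D>. \<tau> < Im (f z)}"
      by (intro holomorphic_intros holomorphic_on_subset[OF hol]) auto
    have 3: "(\<lambda>z. f z - 2 * \<i> * of_real \<tau>) ` {z \<in> \<D>. \<tau> < Im (f z)} \<subseteq> ?B"
    proof safe
      fix z assume "z \<in> \<D>" "\<tau> < Im (f z)"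
      then have "cnj (f z - 2 * \<i> * of_real \<tau>) \<in> f ` \<D>"
        using \<sigma>_mem[of z] by (simp only: \<sigma>_cnj)
      then show "f z - 2 * \<i> * of_real \<tau> \<in> cnj ` f ` \<D>"
        by (metis complex_cnj_cnj image_eqI)
    qed
    from holomorphic_on_compose_gen[OF 2 1 3]
    have "(\<lambda>z. cnj (g (\<sigma> (f z)))) holomorphic_on {z \<in> \<D>. \<tau> < Im (f z)}"
      by (simp only: o_def \<sigma>_cnj)
    then show ?thesis unfolding q_def
      by (rule holomorphic_on_divide[OF _ holomorphic_on_ident]) (auto dest: less_imp_le nz)
  qed
  have cf: "continuous_on \<D> f" using hol by (rule holomorphic_on_imp_continuous_on)
  have cq: "continuous_on {z \<in> \<D>. \<tau> \<le> Im (f z)} q"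
    unfolding q_def using nz \<sigma>_mem
    by (intro continuous_intros continuous_on_compose2[OF holomorphic_on_imp_continuous_on[OF g(1)]])
      (auto simp: \<sigma>_cnj intro!: continuous_intros continuous_on_subset[OF cf])
  \<comment> \<open>On the arc |\<zeta>| = \<rho> the numerator is known only to be below 1, not
    below \<rho>; the loss 1 / \<rho> disappears as \<rho> tends to 1.\<close>
  have bound: "cmod (q z) \<le> 1 / \<rho>" if \<rho>: "cmod z < \<rho>" "\<rho> < 1" for \<rho>
  proof -
    have \<rho>0: "\<rho> > 0" using \<rho>(1) by (rule le_less_trans[OF norm_ge_zero])
    define W where "W = {z \<in> ball 0 \<rho>. \<tau> < Im (f z)}"
    have Wsub: "W \<subseteq> {z \<in> \<D>. \<tau> < Im (f z)}" using \<rho> by (auto simp: W_def)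
    have "open W"
    proof -
      have "W = ball 0 \<rho> \<inter> (\<lambda>z. Im (f z)) -` {\<tau><..}" by (auto simp: W_def)
      moreover have "continuous_on (ball 0 \<rho>) (\<lambda>z. Im (f z))"
        by (intro continuous_intros continuous_on_subset[OF cf]) (use \<rho> in auto)
      ultimately show ?thesis
        using continuous_open_preimage[of "ball 0 \<rho>" "\<lambda>z. Im (f z)" "{\<tau><..}"] by auto
    qed
    have clW: "closure W \<subseteq> {z \<in> cball 0 \<rho>. \<tau> \<le> Im (f z)}"
    proof (rule closure_minimal)
      have "{z \<in> cball 0 \<rho>. \<tau> \<le> Im (f z)} = cball 0 \<rho> \<inter> (\<lambda>z. Im (f z)) -` {\<tau>..}" by auto
      moreover have "continuous_on (cball 0 \<rho>) (\<lambda>z. Im (f z))"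
        by (intro continuous_intros continuous_on_subset[OF cf]) (use \<rho> in auto)
      ultimately show "closed {z \<in> cball 0 \<rho>. \<tau> \<le> Im (f z)}"
        using continuous_closed_preimage[of "cball 0 \<rho>" "\<lambda>z. Im (f z)" "{\<tau>..}"] by auto
    qed (auto simp: W_def)
    show ?thesis
    proof (rule maximum_modulus_frontier[of q W])
      show "q holomorphic_on interior W"
        using hq \<open>open W\<close> Wsub by (auto simp: interior_open intro: holomorphic_on_subset)
      show "continuous_on (closure W) q"
        by (rule continuous_on_subset[OF cq]) (use clW \<rho> in auto)
      show "bounded W" by (rule bounded_subset[of "ball 0 \<rho>"]) (auto simp: W_def)
      show "z \<in> W" using \<rho> \<tau> by (auto simp: W_def)
      fix \<zeta> assume "\<zeta> \<in> frontier W"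
      then have \<zeta>: "\<zeta> \<in> closure W" "\<zeta> \<notin> W" using \<open>open W\<close> by (auto simp: frontier_def interior_open)
      then have 1: "cmod \<zeta> \<le> \<rho>" "\<tau> \<le> Im (f \<zeta>)" "\<zeta> \<in> \<D>" using clW \<rho> by auto
      show "cmod (q \<zeta>) \<le> 1 / \<rho>"
      proof (cases "Im (f \<zeta>) = \<tau>")
        case True
        then have "\<sigma> (f \<zeta>) = f \<zeta>" by (simp add: \<sigma>_def complex_eq_iff)
        then have "cmod (q \<zeta>) = 1" using g(2) 1 nz[of \<zeta>] by (simp add: q_def norm_divide)
        then show ?thesis using \<rho> \<rho>0 by simp
      next
        case False
        then have "cmod \<zeta> = \<rho>" using 1 \<zeta> by (auto simp: W_def)
        moreover have "cmod (g (\<sigma> (f \<zeta>))) < 1" using g_mem(1)[OF \<sigma>_mem[of \<zeta>]] 1 by simp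
        ultimately show ?thesis using \<rho>0 by (simp add: q_def norm_divide divide_right_mono)
      qed
    qed
  qed
  have "cmod (q z) \<le> 1"
  proof (rule field_le_mult_one_interval)
    fix c :: real assume c: "0 < c" "c < 1"
    define \<rho> where "\<rho> = max c ((1 + cmod z) / 2)"
    have "(1 + cmod z) / 2 \<le> \<rho>" "cmod z < 1" "\<rho> < 1" using z c by (auto simp: \<rho>_def)
    then have "cmod (q z) \<le> 1 / \<rho>" by (intro bound) auto
    then have "\<rho> * cmod (q z) \<le> 1" using c by (simp add: \<rho>_def field_simps)
    moreover have "c * cmod (q z) \<le> \<rho> * cmod (q z)" by (intro mult_right_mono) (auto simp: \<rho>_def)
    ultimately show "c * cmod (q z) \<le> 1" by linarith
  qed
  then have "cmod (g (\<sigma> (f z))) \<le> cmod z"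
    using nz[of z] \<tau> by (simp add: q_def norm_divide divide_simps split: if_splits)
  moreover have "\<sigma> (f z) \<in> f ` \<D>" using \<sigma>_mem[OF z] \<tau> by simp
  ultimately show ?thesis using g_mem[of "\<sigma> (f z)"]
    by (intro bexI[of _ "g (\<sigma> (f z))"]) (auto simp: \<sigma>_def)
qed

text \<open>Reflecting x + i y in the line Im w = (s + y) / 2 gives x + i s without increasing the
  modulus of the preimage, for -y < s < y. The end t = -y would need reflection in the real axis,
  which \<open>steiner_reflection_le\<close> excludes, so it is reached by letting s decrease to
  t.\<close>

lemma steiner_subdisc_section:
  assumes hol: "f holomorphic_on \<D>" and inj: "inj_on f \<D>" and f0: "f 0 = 0"
    and st: "steiner_symmetric_domain (f ` \<D>)"
    and r: "r \<le> 1" and w: "Complex x y \<in> f ` ball 0 r" "y > 0" and t: "\<bar>t\<bar> \<le> y"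
  shows "Complex x t \<in> f ` ball 0 r"
proof -
  obtain z where z: "z \<in> ball 0 r" "f z = Complex x y" using w(1) by auto
  have zD: "z \<in> \<D>" using z r by auto
  obtain g where g: "g holomorphic_on f ` \<D>" "\<And>z. z \<in> \<D> \<Longrightarrow> g (f z) = z"
    using holomorphic_has_inverse[OF hol open_ball inj] by metis
  have inner: "Complex x s \<in> f ` \<D> \<and> cmod (g (Complex x s)) \<le> cmod z" if "-y < s" "s < y" for s
  proof -
    have "0 < (s + y) / 2" "(s + y) / 2 < Im (f z)" using that z by auto
    from steiner_reflection_le[OF hol inj f0 st this zD]
    obtain z' where "z' \<in> \<D>" "f z' = Complex x s" "cmod z' \<le> cmod z"
      unfolding z(2) by (auto simp: add_divide_distrib)
    then show ?thesis using g(2)[of z'] by (metis image_eqI)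
  qed
  have mem: "Complex x t \<in> f ` \<D>"
  proof (rule steiner_symmetric_domain_section[OF st])
    show "Complex x y \<in> f ` \<D>" unfolding z(2)[symmetric] by (rule imageI[OF zD])
  qed (use t w(2) in linarith)
  have "cmod (g (Complex x t)) \<le> cmod z"
  proof (cases "t = y")
    case True
    then show ?thesis using g(2)[OF zD] z by simp
  next
    case False
    have "((\<lambda>s. cmod (g (Complex x s))) \<longlongrightarrow> cmod (g (Complex x t))) (at_right t)"
    proof -
      have "open (f ` \<D>)" using st by (simp add: steiner_symmetric_domain_def)
      then have "isCont g (Complex x t)"
        using g(1) mem continuous_on_eq_continuous_at holomorphic_on_imp_continuous_on by blast
      moreover have "((\<lambda>s. Complex x s) \<longlongrightarrow> Complex x t) (at_right t)"
        by (intro tendsto_intros)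
      ultimately show ?thesis by (rule tendsto_norm[OF isCont_tendsto_compose])
    qed
    moreover have "\<forall>\<^sub>F s in at_right t. cmod (g (Complex x s)) \<le> cmod z"
      by (rule eventually_at_rightI[of t y]) (use inner t False in auto)
    ultimately show ?thesis by (rule tendsto_upperbound) simp
  qed
  moreover obtain z' where "z' \<in> \<D>" "f z' = Complex x t" using mem by auto
  ultimately show ?thesis using g(2)[of z'] z by (intro image_eqI[of _ f z']) auto
qed

section \<open>Potentials of discs\<close>

text \<open>The integral of ln |w - \<zeta>| over the disc |w| < \<rho>, divided by pi, at a point
  \<zeta> with |\<zeta>| = s.\<close>

definition disc_pot :: "real \<Rightarrow> real \<Rightarrow> real"
  where "disc_pot \<rho> s = (if s \<le> \<rho> then \<rho>\<^sup>2 * ln \<rho> + (s\<^sup>2 - \<rho>\<^sup>2) / 2 else \<rho>\<^sup>2 * ln s)"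

lemma continuous_on_disc_pot [continuous_intros]:
  assumes "continuous_on S h" "continuous_on S k" "\<And>x. x \<in> S \<Longrightarrow> k x > 0"
  shows "continuous_on S (\<lambda>x. disc_pot (k x) (h x))"
proof -
  \<comment> \<open>A form with max and min is visibly continuous across s = \<rho>.\<close>
  have "disc_pot \<rho> s = \<rho>\<^sup>2 * ln (max \<rho> s) + ((min s \<rho>)\<^sup>2 - \<rho>\<^sup>2) / 2" if "\<rho> > 0" for \<rho> s
    using that by (auto simp: disc_pot_def max_def min_def)
  then have "continuous_on S (\<lambda>x. disc_pot (k x) (h x)) \<longleftrightarrow>
    continuous_on S (\<lambda>x. (k x)\<^sup>2 * ln (max (k x) (h x)) + ((min (h x) (k x))\<^sup>2 - (k x)\<^sup>2) / 2)"
    by (intro continuous_on_cong) (auto simp: assms(3))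
  also have "\<dots>"
    by (intro continuous_intros assms) (auto simp: max_def dest: assms(3))
  finally show ?thesis .
qed

section \<open>Fourier coefficients of holomorphic functions on circles\<close>

lemma circle_coefficient_integral:
  fixes h :: "complex \<Rightarrow> complex"
  assumes hol: "h holomorphic_on ball 0 R" and r: "0 < r" "r < R"
  shows "cint (\<lambda>t. h (of_real r * cis t) / cis t ^ k)
    = 2 * pi * of_real r ^ k * (deriv ^^ k) h 0 / fact k"
proof -
  define v where "v = (\<lambda>t. h (of_real r * cis t) / cis t ^ k)"
  have sub: "cball 0 r \<subseteq> ball 0 R" using r by auto
  have "((\<lambda>u. h u / (u - 0) ^ Suc k) has_contour_integral
      ((2 * pi * \<i>) / fact k * (deriv ^^ k) h 0)) (circlepath 0 r)"
  proof (rule Cauchy_has_contour_integral_higher_derivative_circlepath)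
    show "continuous_on (cball 0 r) h"
      using hol sub holomorphic_on_imp_continuous_on continuous_on_subset by blast
    show "h holomorphic_on ball 0 r" by (rule holomorphic_on_subset[OF hol]) (use r in auto)
  qed (use r in auto)
  then have "((\<lambda>t. h (of_real r * cis t) / (of_real r * cis t) ^ Suc k * r * \<i> * cis t) has_integral
      ((2 * pi * \<i>) / fact k * (deriv ^^ k) h 0)) {0..2*pi}"
    unfolding circlepath_def by (subst (asm) has_contour_integral_part_circlepath_iff) auto
  then have "((\<lambda>t. - \<i> * of_real r ^ k * (h (of_real r * cis t) / (of_real r * cis t) ^ Suc k * r * \<i> * cis t)) has_integral
      - \<i> * of_real r ^ k * ((2 * pi * \<i>) / fact k * (deriv ^^ k) h 0)) {0..2*pi}"
    by (rule has_integral_mult_right)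
  moreover have "- \<i> * of_real r ^ k * (h (of_real r * cis t) / (of_real r * cis t) ^ Suc k * r * \<i> * cis t) = v t" for t
    using r by (simp add: v_def power_mult_distrib field_simps)
  ultimately have "(v has_integral 2 * pi * of_real r ^ k * (deriv ^^ k) h 0 / fact k) {0..2*pi}"
    by (simp add: mult_ac)
  then have "integral {0..2*pi} v = 2 * pi * of_real r ^ k * (deriv ^^ k) h 0 / fact k"
    by (rule integral_unique)
  \<comment> \<open>Cauchy's formula is parametrised over {0..2 pi}; periodicity moves it to
    {-pi..pi}.\<close>
  moreover have "cint v = integral {0..2*pi} v"
  proof -
    have "continuous_on UNIV v" unfolding v_def
      by (intro continuous_intros continuous_on_compose2[OF holomorphic_on_imp_continuous_on[OF hol]])
        (use r in \<open>auto simp: norm_mult\<close>)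
    moreover have "v (t + 2 * pi) = v t" for t by (simp add: v_def flip: cis_mult)
    ultimately have "cint (\<lambda>t. v (t + pi)) = cint v"
      by (intro integral_periodic_shift) auto
    then show ?thesis using integral_shift_Icc_real[of "-pi" pi v pi]
      by (simp add: o_def add.commute)
  qed
  ultimately show ?thesis by (simp add: v_def)
qed

lemma circle_mean_holomorphic:
  fixes h :: "complex \<Rightarrow> complex"
  assumes "h holomorphic_on ball 0 R" and "0 < r" "r < R"
  shows "cint (\<lambda>t. h (of_real r * cis t)) = 2 * pi * h 0"
  using circle_coefficient_integral[OF assms, of 0] by simp

text \<open>The logarithm is the real part of Ln (1 - q z) on |z| = 1, and sin t = (cis t - 1 / cis
  t) / (2 i). The part with cis t integrates to 0, as Ln (1 - q z) * z vanishes at 0; the part with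
  1 / cis t extracts the derivative -q at 0.\<close>

lemma integral_ln_cmod_sin:
  assumes "cmod q < 1"
  shows "cint (\<lambda>t. ln (cmod (1 - q * cis t)) * sin t) = pi * Im q"
proof -
  \<comment> \<open>A radius R > 1 with R |q| < 1: then 1 - q z has positive real part for |z| < R
    and \<open>Ln\<close> is holomorphic there.\<close>
  define R where "R = 2 / (1 + cmod q)"
  have R: "1 < R" "R * cmod q < 1"
    using assms by (auto simp: R_def field_simps add_pos_nonneg)
  define h where "h = (\<lambda>z. Ln (1 - q * z))"
  have Re: "Re (1 - q * z) > 0" if "z \<in> ball 0 R" for z
  proof -
    have "Re (q * z) \<le> cmod q * cmod z" using complex_Re_le_cmod[of "q * z"] by (simp add: norm_mult)
    also have "\<dots> \<le> cmod q * R" using that by (intro mult_left_mono) auto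
    finally show ?thesis using R by (simp add: mult.commute)
  qed
  have ne: "1 - q * z \<notin> \<real>\<^sub>\<le>\<^sub>0" if "z \<in> ball 0 R" for z
    using Re[OF that] complex_nonpos_Reals_iff by fastforce
  have hol: "h holomorphic_on ball 0 R" unfolding h_def
    by (intro holomorphic_intros ne)
  have dh: "deriv h 0 = - q"
    unfolding h_def by (rule DERIV_imp_deriv) (auto intro!: derivative_eq_intros)
  have mem: "cis t \<in> ball 0 R" for t using R by simp
  have ch: "continuous_on {-pi..pi} (\<lambda>t. h (cis t))"
    by (intro continuous_on_compose2[OF holomorphic_on_imp_continuous_on[OF hol]] continuous_intros)
      (use mem in auto)
  have 1: "cint (\<lambda>t. h (cis t) * cis t) = 0"
    using circle_mean_holomorphic[of "\<lambda>z. h z * z" R 1, OF holomorphic_on_mult[OF hol holomorphic_on_ident]] R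
    by simp
  have 2: "cint (\<lambda>t. h (cis t) / cis t) = - 2 * pi * q"
    using circle_coefficient_integral[OF hol, of 1 1] R dh by simp
  have sin: "complex_of_real (sin t) = (cis t - 1 / cis t) / (2 * \<i>)" for t
  proof -
    have "1 / cis t = cis (- t)" by (simp add: divide_inverse)
    moreover have "cis t - cis (- t) = 2 * \<i> * of_real (sin t)" by (simp add: complex_eq_iff)
    ultimately show ?thesis by simp
  qed
  have "cint (\<lambda>t. h (cis t) * of_real (sin t))
      = cint (\<lambda>t. (h (cis t) * cis t - h (cis t) / cis t) / (2 * \<i>))"
    by (intro integral_cong) (simp add: sin field_simps)
  also have "\<dots> = (cint (\<lambda>t. h (cis t) * cis t) - cint (\<lambda>t. h (cis t) / cis t)) / (2 * \<i>)"
    by (subst integral_divide, subst integral_diff) (auto intro!: integrable_continuous_interval continuous_intros ch)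
  also have "\<dots> = - \<i> * pi * q" unfolding 1 2 by (simp add: field_simps)
  finally have I: "cint (\<lambda>t. h (cis t) * of_real (sin t)) = - \<i> * pi * q" .
  have "(\<lambda>t. h (cis t) * of_real (sin t)) integrable_on {-pi..pi}"
    by (intro integrable_continuous_interval continuous_intros ch)
  from integral_linear[OF this bounded_linear_Re]
  have "cint (\<lambda>t. Re (h (cis t)) * sin t) = pi * Im q"
    by (simp add: o_def I)
  moreover have "Re (h (cis t)) = ln (cmod (1 - q * cis t))" for t
  proof -
    have "1 - q * cis t \<noteq> 0" using Re[OF mem[of t]] by (metis less_irrefl zero_complex.sel(1))
    then show ?thesis unfolding h_def by (rule Re_Ln)
  qed
  ultimately show ?thesis by simp
qed

text \<open>The integrand is the derivative in Im \<zeta> of the one in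
  \<open>seg_semicircle\<close>, and the right side is pi times the corresponding derivative of
  \<open>disc_pot\<close>. As sin is odd, the two half-circles combine to a full circle.\<close>

lemma integral_semicircle_ln_sin:
  assumes \<rho>: "\<rho> > 0" and ne: "cmod \<zeta> \<noteq> \<rho>"
  shows "integral {0..pi} (\<lambda>t. (ln (cmod (\<zeta> - of_real \<rho> * cis (-t))) - ln (cmod (\<zeta> - of_real \<rho> * cis t))) * (\<rho> * sin t))
    = pi * (if cmod \<zeta> < \<rho> then Im \<zeta> else \<rho>\<^sup>2 * Im \<zeta> / (cmod \<zeta>)\<^sup>2)"
proof -
  define v where "v = (\<lambda>t. ln (cmod (\<zeta> - of_real \<rho> * cis t)) * sin t)"
  have nz: "\<zeta> - of_real \<rho> * cis t \<noteq> 0" for t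
    using ne \<rho> by (metis abs_of_pos eq_iff_diff_eq_0 mult.right_neutral norm_cis norm_mult norm_of_real)
  have cv: "continuous_on S v" for S
    unfolding v_def by (intro continuous_intros) (use nz in auto)
  have int: "v integrable_on {a..b}" for a b by (intro integrable_continuous_interval cv)
  have "integral {0..pi} (\<lambda>t. (ln (cmod (\<zeta> - of_real \<rho> * cis (-t))) - ln (cmod (\<zeta> - of_real \<rho> * cis t))) * (\<rho> * sin t))
     = integral {0..pi} (\<lambda>t. - \<rho> * (v (-t) + v t))"
    by (intro integral_cong) (simp add: v_def algebra_simps)
  also have "\<dots> = - \<rho> * (integral {0..pi} (\<lambda>t. v (-t)) + integral {0..pi} v)"
    by (subst integral_mult_right, subst integral_add)
      (auto intro!: integrable_continuous_interval continuous_on_compose2[OF cv] int continuous_intros)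
  also have "integral {0..pi} (\<lambda>t. v (-t)) = integral {-pi..0} v"
    using Henstock_Kurzweil_Integration.integral_reflect_real[of pi 0 "\<lambda>t. v (-t)"] by simp
  also have "integral {-pi..0} v + integral {0..pi} v = cint v"
    by (intro Henstock_Kurzweil_Integration.integral_combine int) auto
  also have "cint v = pi * (if cmod \<zeta> < \<rho> then - Im \<zeta> / \<rho> else - \<rho> * Im \<zeta> / (cmod \<zeta>)\<^sup>2)"
  proof -
    have sin0: "cint (\<lambda>t. sin t) = 0"
      by (intro integral_unique) (rule has_integral_eq_rhs[OF fundamental_theorem_of_calculus[of _ _ "\<lambda>t. - cos t"]],
          auto intro!: derivative_eq_intros simp: has_real_derivative_iff_has_vector_derivative[symmetric])
    \<comment> \<open>The summand \<open>c\<close>, which is ln \<rho> for \<zeta> inside the circle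
      and ln |\<zeta>| outside, drops out because sin has mean 0; \<open>q\<close> is cnj \<zeta> /
      \<rho> or \<rho> / \<zeta>.\<close>
    have split: "cint v = c * 0 + pi * Im q"
      if q: "cmod q < 1" and eq: "\<And>t. ln (cmod (\<zeta> - of_real \<rho> * cis t)) = c + ln (cmod (1 - q * cis t))" for c q
    proof -
      have nzq: "q * cis t \<noteq> 1" for t
        using q by (metis less_irrefl mult.right_neutral norm_cis norm_mult norm_one)
      have "cint v = cint (\<lambda>t. c * sin t + ln (cmod (1 - q * cis t)) * sin t)"
        by (intro integral_cong) (simp only: v_def eq distrib_right)
      also have "\<dots> = c * cint (\<lambda>t. sin t) + cint (\<lambda>t. ln (cmod (1 - q * cis t)) * sin t)"
        by (subst integral_add) (auto intro!: integrable_continuous_interval continuous_intros simp: nzq)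
      finally show ?thesis by (simp add: sin0 integral_ln_cmod_sin[OF q])
    qed
    show ?thesis
    proof (cases "cmod \<zeta> < \<rho>")
      case True
      have "ln (cmod (\<zeta> - of_real \<rho> * cis t)) = ln \<rho> + ln (cmod (1 - cnj \<zeta> / of_real \<rho> * cis t))" for t
      proof -
        have "\<zeta> - of_real \<rho> * cis t = - (of_real \<rho> * cis t * cnj (1 - cnj \<zeta> / of_real \<rho> * cis t))"
          using \<rho> by (simp add: algebra_simps cis_cnj cis_mult)
        then have "cmod (\<zeta> - of_real \<rho> * cis t) = \<rho> * cmod (1 - cnj \<zeta> / of_real \<rho> * cis t)"
          using \<rho> by (simp only: norm_minus_cancel norm_mult complex_mod_cnj norm_cis norm_of_real)
        moreover have "cmod (1 - cnj \<zeta> / of_real \<rho> * cis t) \<noteq> 0"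
          using calculation nz[of t] by auto
        ultimately show ?thesis using \<rho> by (simp add: ln_mult)
      qed
      from split[OF _ this] show ?thesis using True \<rho> by (simp add: norm_divide)
    next
      case False
      then have gt: "cmod \<zeta> > \<rho>" using ne by simp
      then have z0: "\<zeta> \<noteq> 0" using \<rho> by auto
      have "ln (cmod (\<zeta> - of_real \<rho> * cis t)) = ln (cmod \<zeta>) + ln (cmod (1 - of_real \<rho> / \<zeta> * cis t))" for t
      proof -
        have "\<zeta> - of_real \<rho> * cis t = \<zeta> * (1 - of_real \<rho> / \<zeta> * cis t)"
          using z0 by (simp add: field_simps)
        then have "cmod (\<zeta> - of_real \<rho> * cis t) = cmod \<zeta> * cmod (1 - of_real \<rho> / \<zeta> * cis t)"
          by (metis norm_mult)
        moreover have "cmod (1 - of_real \<rho> / \<zeta> * cis t) \<noteq> 0"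
          using calculation nz[of t] by auto
        ultimately show ?thesis using z0 by (simp add: ln_mult)
      qed
      moreover have "cmod (of_real \<rho> / \<zeta>) < 1" using gt \<rho> z0 by (simp add: norm_divide)
      ultimately have "cint v = pi * Im (of_real \<rho> / \<zeta>)"
        using split[of "of_real \<rho> / \<zeta>" "ln (cmod \<zeta>)"] by simp
      also have "Im (of_real \<rho> / \<zeta>) = - \<rho> * Im \<zeta> / (cmod \<zeta>)\<^sup>2"
        by (simp add: Im_divide cmod_power2)
      finally show ?thesis using False by simp
    qed
  qed
  finally show ?thesis using \<rho> by (simp add: power2_eq_square)
qed

text \<open>With x = \<rho> cos t the segments are the vertical chords of the disc and \<rho> sin t
  dt is the element of width, so the left side is the potential of the disc. The proof moves \<zeta>
  along a vertical line: the difference \<open>G\<close> of both sides is continuous in b = Im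
  \<zeta>, has derivative 0 off the circle, and tends to 0 as b grows.\<close>

lemma seg_semicircle:
  assumes \<rho>: "\<rho> > 0"
  shows "integral {0..pi} (\<lambda>t. seg 0 \<zeta> (\<rho> * cos t) (\<rho> * sin t) * (\<rho> * sin t)) = pi * disc_pot \<rho> (cmod \<zeta>)"
proof -
  define a where "a = Re \<zeta>"
  define \<Psi> where "\<Psi> = (\<lambda>b. integral {0..pi} (\<lambda>t. seg 0 (Complex a b) (\<rho> * cos t) (\<rho> * sin t) * (\<rho> * sin t)))"
  define G where "G = (\<lambda>b. \<Psi> b - pi * disc_pot \<rho> (cmod (Complex a b)))"
  have cC [continuous_intros]: "continuous_on S (\<lambda>x. Complex (u x) (v x))"
    if "continuous_on S u" "continuous_on S v" for S :: "'c::topological_space set" and u v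
    unfolding Complex_eq using that by (intro continuous_intros)
  have cseg: "continuous_on S (\<lambda>(b, t). seg 0 (Complex a b) (\<rho> * cos t) (\<rho> * sin t) * (\<rho> * sin t))" for S
    unfolding case_prod_beta by (intro continuous_intros)
  have contG: "continuous_on S G" for S
    unfolding G_def \<Psi>_def using integral_continuous_on_param[of S 0 pi, OF cseg] \<rho>
    by (intro continuous_intros) auto
  have cm_less: "cmod (Complex a s) < \<rho>" if "a\<^sup>2 + s\<^sup>2 < \<rho>\<^sup>2" for s
    using real_sqrt_less_mono[OF that] \<rho> by (simp add: cmod_def)
  have cm_gt: "\<rho> < cmod (Complex a s)" if "\<rho>\<^sup>2 < a\<^sup>2 + s\<^sup>2" for s
    using real_sqrt_less_mono[OF that] \<rho> by (simp add: cmod_def)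
  have derG: "(G has_real_derivative 0) (at b)" if ne: "a\<^sup>2 + b\<^sup>2 \<noteq> \<rho>\<^sup>2" for b
  proof -
    have "open {b. a\<^sup>2 + b\<^sup>2 \<noteq> \<rho>\<^sup>2}" by (intro open_Collect_neq continuous_intros)
    then obtain e where e: "e > 0" "ball b e \<subseteq> {b. a\<^sup>2 + b\<^sup>2 \<noteq> \<rho>\<^sup>2}"
      using ne open_contains_ball by blast
    have cm: "cmod (Complex a s) \<noteq> \<rho>" if "s \<in> ball b e" for s
      using e that \<rho> by (auto simp: cmod_def)
    have nz: "Complex a s - of_real \<rho> * cis t \<noteq> 0" if "s \<in> ball b e" for s t
      using cm[OF that] \<rho> by (metis abs_of_pos eq_iff_diff_eq_0 mult.right_neutral norm_cis norm_mult norm_of_real)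
    have dseg: "((\<lambda>s. seg 0 (Complex a s) (\<rho> * cos t) (\<rho> * sin t)) has_real_derivative
        (ln (cmod (Complex a s - of_real \<rho> * cis (-t))) - ln (cmod (Complex a s - of_real \<rho> * cis t)))) (at s)"
      if s: "s \<in> ball b e" for s t
    proof -
      define X where "X = sqrt ((a - \<rho> * cos t)\<^sup>2 + 0\<^sup>2)"
      have X2: "X\<^sup>2 = (a - \<rho> * cos t)\<^sup>2" by (simp add: X_def)
      have n1: "X \<noteq> 0 \<or> \<rho> * sin t + s \<noteq> 0"
        using nz[OF s, of "-t"] by (auto simp: X_def complex_eq_iff)
      have n2: "X \<noteq> 0 \<or> \<rho> * sin t - s \<noteq> 0"
        using nz[OF s, of t] by (auto simp: X_def complex_eq_iff)
      have "((\<lambda>s. line_primitive X (\<rho> * sin t + s)) has_real_derivative ln (X\<^sup>2 + (\<rho> * sin t + s)\<^sup>2) / 2 * 1) (at s)"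
        by (rule DERIV_chain2[where g = "\<lambda>s. \<rho> * sin t + s", OF line_primitive_DERIV[OF n1]]) (auto intro!: derivative_eq_intros)
      moreover have "((\<lambda>s. line_primitive X (\<rho> * sin t - s)) has_real_derivative ln (X\<^sup>2 + (\<rho> * sin t - s)\<^sup>2) / 2 * (-1)) (at s)"
        by (rule DERIV_chain2[where g = "\<lambda>s. \<rho> * sin t - s", OF line_primitive_DERIV[OF n2]]) (auto intro!: derivative_eq_intros)
      moreover have "ln (X\<^sup>2 + (\<rho> * sin t + s)\<^sup>2) / 2 = ln (cmod (Complex a s - of_real \<rho> * cis (-t)))"
        by (simp add: cmod_def ln_sqrt X2 add.commute)
      moreover have "ln (X\<^sup>2 + (\<rho> * sin t - s)\<^sup>2) / 2 = ln (cmod (Complex a s - of_real \<rho> * cis t))"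
        by (simp add: cmod_def ln_sqrt X2 power2_commute)
      ultimately show ?thesis
        unfolding seg_def X_def[symmetric] using DERIV_add by (fastforce simp: X_def)
    qed
    have d1: "(\<Psi> has_real_derivative integral {0..pi} (\<lambda>t. (ln (cmod (Complex a b - of_real \<rho> * cis (-t)))
        - ln (cmod (Complex a b - of_real \<rho> * cis t))) * (\<rho> * sin t))) (at b within ball b e)"
      unfolding \<Psi>_def interval_cbox
    proof (rule leibniz_rule_field_derivative[where U = "ball b e"])
      fix s t assume "s \<in> ball b e"
      from DERIV_cmult_right[OF dseg[OF this, of t], of "\<rho> * sin t"]
      show "((\<lambda>s. seg 0 (Complex a s) (\<rho> * cos t) (\<rho> * sin t) * (\<rho> * sin t)) has_real_derivative
        (ln (cmod (Complex a s - of_real \<rho> * cis (-t))) - ln (cmod (Complex a s - of_real \<rho> * cis t))) * (\<rho> * sin t)) (at s within ball b e)"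
        by (rule DERIV_subset) simp
    next
      show "(\<lambda>t. seg 0 (Complex a s) (\<rho> * cos t) (\<rho> * sin t) * (\<rho> * sin t)) integrable_on cbox 0 pi" for s
        by (intro integrable_continuous continuous_intros)
      show "continuous_on (ball b e \<times> cbox 0 pi) (\<lambda>(s, t). (ln (cmod (Complex a s - of_real \<rho> * cis (-t)))
          - ln (cmod (Complex a s - of_real \<rho> * cis t))) * (\<rho> * sin t))"
        unfolding case_prod_beta by (intro continuous_intros) (use nz in auto)
    qed (use e in auto)
    have "at b within ball b e = at b" using e by (intro at_within_open) auto
    moreover have "cmod (Complex a b) \<noteq> \<rho>" using cm[of b] e by simp
    ultimately have d1': "(\<Psi> has_real_derivative pi * (if cmod (Complex a b) < \<rho> then b else \<rho>\<^sup>2 * b / (cmod (Complex a b))\<^sup>2)) (at b)"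
      using d1 integral_semicircle_ln_sin[OF \<rho>, of "Complex a b"] by (simp only: complex.sel not_False_eq_True simp_thms)
    have d2: "((\<lambda>s. disc_pot \<rho> (cmod (Complex a s))) has_real_derivative
        (if cmod (Complex a b) < \<rho> then b else \<rho>\<^sup>2 * b / (cmod (Complex a b))\<^sup>2)) (at b)"
    proof (cases "a\<^sup>2 + b\<^sup>2 < \<rho>\<^sup>2")
      case True
      have op: "open {s. a\<^sup>2 + s\<^sup>2 < \<rho>\<^sup>2}" by (intro open_Collect_less continuous_intros)
      have lt: "cmod (Complex a b) < \<rho>" using True by (rule cm_less)
      have "((\<lambda>s. \<rho>\<^sup>2 * ln \<rho> + (a\<^sup>2 + s\<^sup>2 - \<rho>\<^sup>2) / 2) has_real_derivative b) (at b)"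
        by (auto intro!: derivative_eq_intros)
      then have "((\<lambda>s. disc_pot \<rho> (cmod (Complex a s))) has_real_derivative b) (at b)"
      proof (rule has_field_derivative_transform_within_open[OF _ op])
        fix s assume "s \<in> {s. a\<^sup>2 + s\<^sup>2 < \<rho>\<^sup>2}"
        then have "cmod (Complex a s) < \<rho>" using cm_less by simp
        then show "\<rho>\<^sup>2 * ln \<rho> + (a\<^sup>2 + s\<^sup>2 - \<rho>\<^sup>2) / 2 = disc_pot \<rho> (cmod (Complex a s))"
          by (simp add: disc_pot_def cmod_power2)
      qed (use True in simp)
      then show ?thesis using lt by simp
    next
      case False
      then have gt: "\<rho>\<^sup>2 < a\<^sup>2 + b\<^sup>2" using ne by simp
      have op: "open {s. \<rho>\<^sup>2 < a\<^sup>2 + s\<^sup>2}" by (intro open_Collect_less continuous_intros)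
      have nlt: "\<not> cmod (Complex a b) < \<rho>" using cm_gt[OF gt] by simp
      have pos: "a\<^sup>2 + b\<^sup>2 > 0" using gt zero_le_power2[of \<rho>] by linarith
      have "((\<lambda>s. ln (a\<^sup>2 + s\<^sup>2)) has_real_derivative 2 * b / (a\<^sup>2 + b\<^sup>2)) (at b)"
        using pos by (auto intro!: derivative_eq_intros)
      from DERIV_cmult[OF this, of "\<rho>\<^sup>2 / 2"]
      have "((\<lambda>s. \<rho>\<^sup>2 / 2 * ln (a\<^sup>2 + s\<^sup>2)) has_real_derivative \<rho>\<^sup>2 * b / (a\<^sup>2 + b\<^sup>2)) (at b)"
        by simp
      then have "((\<lambda>s. disc_pot \<rho> (cmod (Complex a s))) has_real_derivative \<rho>\<^sup>2 * b / (a\<^sup>2 + b\<^sup>2)) (at b)"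
      proof (rule has_field_derivative_transform_within_open[OF _ op])
        fix s assume "s \<in> {s. \<rho>\<^sup>2 < a\<^sup>2 + s\<^sup>2}"
        then have s: "\<rho>\<^sup>2 < a\<^sup>2 + s\<^sup>2" by simp
        have "\<rho> < cmod (Complex a s)" by (rule cm_gt[OF s])
        moreover have "ln (cmod (Complex a s)) = ln (a\<^sup>2 + s\<^sup>2) / 2" by (simp add: cmod_def ln_sqrt)
        ultimately show "\<rho>\<^sup>2 / 2 * ln (a\<^sup>2 + s\<^sup>2) = disc_pot \<rho> (cmod (Complex a s))"
          by (simp add: disc_pot_def)
      qed (use gt in simp)
      then show ?thesis using nlt by (simp add: cmod_power2)
    qed
    show ?thesis unfolding G_def using DERIV_diff[OF d1' DERIV_cmult[OF d2, of pi]] by simp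
  qed
  \<comment> \<open>Only the at most two points where the vertical line meets the circle are
    excepted in the fundamental theorem of calculus.\<close>
  have fin: "finite {b. a\<^sup>2 + b\<^sup>2 = \<rho>\<^sup>2}"
  proof (rule finite_subset)
    show "{b. a\<^sup>2 + b\<^sup>2 = \<rho>\<^sup>2} \<subseteq> {sqrt (\<rho>\<^sup>2 - a\<^sup>2), - sqrt (\<rho>\<^sup>2 - a\<^sup>2)}"
    proof
      fix b assume "b \<in> {b. a\<^sup>2 + b\<^sup>2 = \<rho>\<^sup>2}"
      then have "\<rho>\<^sup>2 - a\<^sup>2 = b\<^sup>2" by auto
      then have "sqrt (\<rho>\<^sup>2 - a\<^sup>2) = \<bar>b\<bar>" by simp
      then have "b = sqrt (\<rho>\<^sup>2 - a\<^sup>2) \<or> b = - sqrt (\<rho>\<^sup>2 - a\<^sup>2)" by linarith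
      then show "b \<in> {sqrt (\<rho>\<^sup>2 - a\<^sup>2), - sqrt (\<rho>\<^sup>2 - a\<^sup>2)}" by simp
    qed
  qed simp
  have const: "G b1 = G b2" if "b1 \<le> b2" for b1 b2
  proof -
    have "((\<lambda>_. 0) has_integral (G b2 - G b1)) {b1..b2}"
      by (rule fundamental_theorem_of_calculus_strong[OF fin that _ contG])
        (use derG in \<open>auto simp: has_real_derivative_iff_has_vector_derivative\<close>)
    then have "G b2 - G b1 = 0" by (rule has_integral_unique) (rule has_integral_0)
    then show ?thesis by simp
  qed
  \<comment> \<open>For b > 2 \<rho> and |w| \<le> \<rho> the distance from a + i b to w is between
    b - \<rho> and b + |a| + \<rho>. Both potentials lie between the bounds this gives, hence differ
    by at most \<open>bd b\<close>.\<close>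
  define bd where "bd = (\<lambda>b. pi * (\<rho>\<^sup>2 * (ln (b + \<bar>a\<bar> + \<rho>) - ln (b - \<rho>))))"
  have bound: "\<bar>G b\<bar> \<le> bd b" if b: "b > 2 * \<rho>" for b
  proof -
    define lo hi where "lo = ln (b - \<rho>)" and "hi = ln (b + \<bar>a\<bar> + \<rho>)"
    have b0: "b - \<rho> > 0" "b > 0" using b \<rho> by auto
    have ln_dist: "lo \<le> ln (cmod (Complex a b - w)) \<and> ln (cmod (Complex a b - w)) \<le> hi" if "cmod w \<le> \<rho>" for w
    proof -
      have "b \<le> cmod (Complex a b)" "cmod (Complex a b) \<le> \<bar>a\<bar> + b"
        using abs_Im_le_cmod[of "Complex a b"] cmod_le[of "Complex a b"] b0 by auto
      then have "b - \<rho> \<le> cmod (Complex a b - w)" "cmod (Complex a b - w) \<le> b + \<bar>a\<bar> + \<rho>"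
        using norm_triangle_ineq2[of "Complex a b" w] norm_triangle_ineq4[of "Complex a b" w] that by auto
      then show ?thesis unfolding lo_def hi_def using b0
        by (intro conjI iffD2[OF ln_le_cancel_iff]; linarith)
    qed
    have seg_est: "2 * y * lo \<le> seg 0 (Complex a b) (\<rho> * cos t) y \<and> seg 0 (Complex a b) (\<rho> * cos t) y \<le> 2 * y * hi"
      if y: "y = \<rho> * sin t" "y \<ge> 0" for t y
    proof -
      have "cmod (Complex (\<rho> * cos t) s) \<le> \<rho>" if "s \<in> {-y..y}" for s
      proof -
        have "s\<^sup>2 \<le> (\<rho> * sin t)\<^sup>2" using that y abs_le_square_iff[of s y] by auto
        then have "(\<rho> * cos t)\<^sup>2 + s\<^sup>2 \<le> (\<rho> * cos t)\<^sup>2 + (\<rho> * sin t)\<^sup>2" by simp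
        also have "\<dots> = \<rho>\<^sup>2" by (simp add: power_mult_distrib flip: distrib_left)
        finally show ?thesis using real_sqrt_le_mono[of _ "\<rho>\<^sup>2"] \<rho> by (fastforce simp: cmod_def)
      qed
      note le = ln_dist[OF this]
      have c: "((\<lambda>_. c) has_integral 2 * y * c) {-y..y}" for c :: real
        using has_integral_const_real[of c "-y" y] y by simp
      show ?thesis
        using has_integral_le[OF c seg_integral[OF y(2)]] has_integral_le[OF seg_integral[OF y(2)] c] le by blast
    qed
    \<comment> \<open>With a constant \<open>c\<close> in place of the logarithm the chords sum to c
      times the area of the disc.\<close>
    have sin2: "integral {0..pi} (\<lambda>t. 2 * (\<rho> * sin t) * c * (\<rho> * sin t)) = pi * (\<rho>\<^sup>2 * c)" for c
    proof -
      have "((\<lambda>t. (sin t)\<^sup>2) has_integral (pi - sin pi * cos pi) / 2 - (0 - sin 0 * cos 0) / 2) {0..pi}"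
        by (rule fundamental_theorem_of_calculus)
          (auto intro!: derivative_eq_intros simp: has_real_derivative_iff_has_vector_derivative[symmetric] cos_squared_eq power2_eq_square[symmetric])
      from has_integral_mult_right[OF this, of "2 * \<rho>\<^sup>2 * c"]
      have "((\<lambda>t. 2 * \<rho>\<^sup>2 * c * (sin t)\<^sup>2) has_integral pi * (\<rho>\<^sup>2 * c)) {0..pi}"
        by (simp add: mult_ac)
      then show ?thesis by (intro integral_unique) (simp add: power2_eq_square mult_ac)
    qed
    have "pi * (\<rho>\<^sup>2 * lo) \<le> \<Psi> b" "\<Psi> b \<le> pi * (\<rho>\<^sup>2 * hi)"
      unfolding \<Psi>_def sin2[symmetric] using seg_est \<rho>
      by (intro integral_le mult_right_mono integrable_continuous_interval continuous_intros; auto simp: sin_ge_zero)+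
    moreover have "disc_pot \<rho> (cmod (Complex a b)) = \<rho>\<^sup>2 * ln (cmod (Complex a b))"
      using abs_Im_le_cmod[of "Complex a b"] b \<rho> by (auto simp: disc_pot_def)
    then have "pi * (\<rho>\<^sup>2 * lo) \<le> pi * disc_pot \<rho> (cmod (Complex a b))" "pi * disc_pot \<rho> (cmod (Complex a b)) \<le> pi * (\<rho>\<^sup>2 * hi)"
      using ln_dist[of 0] \<rho> by (auto intro!: mult_left_mono)
    moreover have "bd b = pi * (\<rho>\<^sup>2 * hi) - pi * (\<rho>\<^sup>2 * lo)"
      by (simp add: bd_def lo_def hi_def right_diff_distrib)
    ultimately show ?thesis unfolding G_def abs_le_iff by linarith
  qed
  have "\<bar>G (Im \<zeta>)\<bar> \<le> 0"
  proof (rule tendsto_lowerbound)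
    show "(bd \<longlongrightarrow> 0) at_top" unfolding bd_def by real_asymp
    show "\<forall>\<^sub>F b in at_top. \<bar>G (Im \<zeta>)\<bar> \<le> bd b"
      using eventually_gt_at_top[of "max (2 * \<rho>) (Im \<zeta>)"]
    proof eventually_elim
      case (elim b)
      then show ?case using bound[of b] const[of "Im \<zeta>" b] by simp
    qed
  qed simp
  then have "G (Im \<zeta>) = 0" by simp
  then show ?thesis by (simp add: G_def \<Psi>_def a_def)
qed

text \<open>Since R powr (p - 2) + (2 - p) * (integral of \<rho> powr (p - 3) from a to R) = a powr
  (p - 2), the mixture has density max s \<epsilon> powr (p - 2) at distance s \<le> R; the cutoff
  \<epsilon> tames the origin. \<open>disc_pot\<close> has Laplacian 2 in its disc, and |w| powr p
  has Laplacian p^2 |w| powr (p - 2), whence the factor 2 / p^2 below.\<close>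

definition disc_pot_mix :: "real \<Rightarrow> real \<Rightarrow> real \<Rightarrow> real \<Rightarrow> real"
  where "disc_pot_mix p \<epsilon> R s = R powr (p - 2) * disc_pot R s
    + (2 - p) * integral {\<epsilon>..R} (\<lambda>\<rho>. \<rho> powr (p - 3) * disc_pot \<rho> s)"

text \<open>The potential of a disc centred at \<open>0\<close> has Laplacian proportional to the indicator function of
  that disc, and \<open>\<bar>w\<bar> powr (p - 2)\<close>, the Laplacian of \<open>\<bar>w\<bar> powr p\<close> up to a factor, is a
  mixture of such indicator functions.\<close>

lemma disc_pot_mix_approx:
  assumes p: "0 < p" "p < 2" and R: "0 < \<epsilon>" "\<epsilon> < R" and s: "0 \<le> s" "s \<le> R"
  defines "C \<equiv> (2 - p) * (R powr p * ln R / p - R powr p / p\<^sup>2 - R powr p / (2 * p)) + R powr p * ln R - R powr p / 2"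
  shows "\<bar>disc_pot_mix p \<epsilon> R s - C - 2 / p\<^sup>2 * s powr p\<bar>
    \<le> (6 / p\<^sup>2 + 3 / p + 1) * (\<epsilon> powr p * (1 + \<bar>ln \<epsilon>\<bar> + \<bar>ln R\<bar>))"
proof -
  \<comment> \<open>The antiderivative in \<rho> where \<rho> \<ge> s; for \<rho> \<le> s the
    integrand is \<rho> powr (p - 1) * ln s.\<close>
  define B where "B = (\<lambda>\<rho>. \<rho> powr p * ln \<rho> / p - \<rho> powr p / p\<^sup>2 - \<rho> powr p / (2 * p)
      + s\<^sup>2 / 2 * (\<rho> powr (p - 2) / (p - 2)))"
  have outer: "((\<lambda>\<rho>. \<rho> powr (p - 3) * disc_pot \<rho> s) has_integral (B b - B a)) {a..b}"
    if "0 < a" "s \<le> a" "a \<le> b" for a b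
  proof (rule fundamental_theorem_of_calculus)
    fix \<rho> assume "\<rho> \<in> {a..b}"
    then have \<rho>: "\<rho> > 0" "s \<le> \<rho>" using that by auto
    have e: "\<rho> powr (p - 1) = \<rho> powr (p - 3) * \<rho>\<^sup>2"
      using \<rho> by (simp add: powr_add[symmetric] flip: powr_numeral)
    have d: "((\<lambda>\<rho>. \<rho> powr q) has_real_derivative q * \<rho> powr (q - 1)) (at \<rho>)" for q
      using \<rho> by (intro has_real_derivative_powr)
    have collapse: "(p * A * l + A) / p - p * A / p\<^sup>2 - p * A / (2 * p) + s\<^sup>2 / 2 * ((p - 2) * D / (p - 2))
        = A * l - A / 2 + s\<^sup>2 / 2 * D" for A D l
      using p by (simp add: add_divide_distrib power2_eq_square)
    have "(B has_real_derivative (p * \<rho> powr (p - 1) * ln \<rho> + 1 / \<rho> * \<rho> powr p) / p - p * \<rho> powr (p - 1) / p\<^sup>2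
        - p * \<rho> powr (p - 1) / (2 * p) + s\<^sup>2 / 2 * ((p - 2) * \<rho> powr (p - 2 - 1) / (p - 2))) (at \<rho>)"
      unfolding B_def using \<rho>
      by (intro DERIV_add DERIV_diff DERIV_cdivide DERIV_cmult DERIV_mult d DERIV_ln_divide)
    moreover have "1 / \<rho> * \<rho> powr p = \<rho> powr (p - 1)"
      using \<rho> by (simp add: powr_diff)
    moreover have "\<rho> powr (p - 2 - 1) = \<rho> powr (p - 3)" by (simp add: diff_diff_eq)
    ultimately have "(B has_real_derivative \<rho> powr (p - 1) * ln \<rho> - \<rho> powr (p - 1) / 2 + s\<^sup>2 / 2 * \<rho> powr (p - 3)) (at \<rho>)"
      using collapse by (simp only:)
    moreover have "\<rho> powr (p - 1) * ln \<rho> - \<rho> powr (p - 1) / 2 + s\<^sup>2 / 2 * \<rho> powr (p - 3) = \<rho> powr (p - 3) * disc_pot \<rho> s"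
      unfolding e using \<rho> by (simp add: disc_pot_def algebra_simps diff_divide_distrib)
    ultimately show "(B has_vector_derivative \<rho> powr (p - 3) * disc_pot \<rho> s) (at \<rho> within {a..b})"
      by (simp add: has_real_derivative_iff_has_vector_derivative has_vector_derivative_at_within)
  qed (use that in auto)
  have inner: "((\<lambda>\<rho>. \<rho> powr (p - 3) * disc_pot \<rho> s) has_integral (b powr p / p * ln s - a powr p / p * ln s)) {a..b}"
    if "0 < a" "b \<le> s" "a \<le> b" for a b
  proof (rule fundamental_theorem_of_calculus)
    fix \<rho> assume "\<rho> \<in> {a..b}"
    then have \<rho>: "\<rho> > 0" "\<rho> \<le> s" using that by auto
    have e: "\<rho> powr (p - 1) = \<rho> powr (p - 3) * \<rho>\<^sup>2"
      using \<rho> by (simp add: powr_add[symmetric] flip: powr_numeral)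
    have "((\<lambda>\<rho>. \<rho> powr p / p * ln s) has_real_derivative p * \<rho> powr (p - 1) / p * ln s) (at \<rho>)"
      using \<rho> by (intro DERIV_cmult_right DERIV_cdivide has_real_derivative_powr)
    moreover have "p * \<rho> powr (p - 1) / p * ln s = \<rho> powr (p - 3) * disc_pot \<rho> s"
      unfolding e using \<rho> p by (auto simp: disc_pot_def)
    ultimately show "((\<lambda>\<rho>. \<rho> powr p / p * ln s) has_vector_derivative \<rho> powr (p - 3) * disc_pot \<rho> s) (at \<rho> within {a..b})"
      by (simp add: has_real_derivative_iff_has_vector_derivative has_vector_derivative_at_within)
  qed (use that in auto)
  have R2: "R powr (p - 2) * R\<^sup>2 = R powr p" using R by (simp add: powr_add[symmetric] flip: powr_numeral)
  have top: "R powr (p - 2) * disc_pot R s = R powr p * ln R - R powr p / 2 + s\<^sup>2 / 2 * R powr (p - 2)"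
    using s R2 by (simp add: disc_pot_def distrib_left right_diff_distrib diff_divide_distrib add_divide_distrib mult.assoc[symmetric])
  \<comment> \<open>The s^2 terms here and in \<open>top\<close> cancel, which leaves the constant
    \<open>C\<close>, free of \<open>s\<close> and \<open>\<epsilon>\<close>.\<close>
  have BR: "(2 - p) * B R = C - (R powr p * ln R - R powr p / 2) - s\<^sup>2 / 2 * R powr (p - 2)"
  proof -
    have "(2 - p) * (s\<^sup>2 / 2 * (R powr (p - 2) / (p - 2))) = - (s\<^sup>2 / 2 * R powr (p - 2))"
      using p by (simp add: field_simps)
    then show ?thesis unfolding B_def C_def distrib_left by simp
  qed
  define L where "L = 1 + \<bar>ln \<epsilon>\<bar> + \<bar>ln R\<bar>"
  have L: "L \<ge> 1" "\<bar>ln \<epsilon>\<bar> \<le> L" "\<bar>ln \<epsilon>\<bar> + \<bar>ln R\<bar> \<le> L" by (auto simp: L_def)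
  define e where "e = \<epsilon> powr p"
  have e: "e > 0" using R by (simp add: e_def)
  have eL: "e \<le> e * L" "e * \<bar>ln \<epsilon>\<bar> \<le> e * L" using e L by auto
  show ?thesis
  proof (cases "s \<le> \<epsilon>")
    case True
    \<comment> \<open>Because s \<le> \<epsilon>, every term that remains, s powr p included, is
      bounded by a multiple of e * L.\<close>
    have "integral {\<epsilon>..R} (\<lambda>\<rho>. \<rho> powr (p - 3) * disc_pot \<rho> s) = B R - B \<epsilon>"
      using outer[of \<epsilon> R] True R by (intro integral_unique) auto
    then have "disc_pot_mix p \<epsilon> R s - C = - ((2 - p) * B \<epsilon>)"
      using top BR by (simp add: disc_pot_mix_def right_diff_distrib)
    also have "(2 - p) * B \<epsilon> = (2 - p) * (e * ln \<epsilon> / p - e / p\<^sup>2 - e / (2 * p)) - s\<^sup>2 / 2 * \<epsilon> powr (p - 2)"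
    proof -
      have "(2 - p) * (s\<^sup>2 / 2 * (\<epsilon> powr (p - 2) / (p - 2))) = - (s\<^sup>2 / 2 * \<epsilon> powr (p - 2))"
        using p by (simp add: field_simps)
      then show ?thesis unfolding B_def distrib_left e_def by simp
    qed
    finally have eq: "disc_pot_mix p \<epsilon> R s - C = - ((2 - p) / p * (e * ln \<epsilon>)) + (2 - p) / p\<^sup>2 * e + (2 - p) / (2 * p) * e
        + s\<^sup>2 / 2 * \<epsilon> powr (p - 2)"
      by (simp only: right_diff_distrib times_divide_eq_right times_divide_eq_left)
    have 1: "\<bar>(2 - p) / p * (e * ln \<epsilon>)\<bar> \<le> 2 / p * (e * L)"
      unfolding abs_mult using p e eL by (intro mult_mono) (auto simp: divide_right_mono)
    have 2: "0 \<le> (2 - p) / p\<^sup>2 * e" "(2 - p) / p\<^sup>2 * e \<le> 2 / p\<^sup>2 * (e * L)"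
      using p e eL by (auto intro!: mult_mono divide_right_mono)
    have 3: "0 \<le> (2 - p) / (2 * p) * e" "(2 - p) / (2 * p) * e \<le> 1 / p * (e * L)"
    proof -
      have "(2 - p) / (2 * p) \<le> 1 / p" using p by (simp add: field_simps)
      then show "(2 - p) / (2 * p) * e \<le> 1 / p * (e * L)" using p e eL by (intro mult_mono) auto
    qed (use p e in auto)
    have 4: "0 \<le> s\<^sup>2 / 2 * \<epsilon> powr (p - 2)" "s\<^sup>2 / 2 * \<epsilon> powr (p - 2) \<le> e * L"
    proof -
      have "s\<^sup>2 \<le> \<epsilon>\<^sup>2" using True s by (intro power_mono) auto
      then have "s\<^sup>2 / 2 * \<epsilon> powr (p - 2) \<le> \<epsilon>\<^sup>2 * \<epsilon> powr (p - 2)"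
        by (intro mult_right_mono) (use zero_le_power2[of s] in linarith, simp)
      also have "\<dots> = e" using R by (simp add: e_def powr_add[symmetric] flip: powr_numeral)
      finally show "s\<^sup>2 / 2 * \<epsilon> powr (p - 2) \<le> e * L" using eL by linarith
    qed simp
    have 5: "0 \<le> 2 / p\<^sup>2 * s powr p" "2 / p\<^sup>2 * s powr p \<le> 2 / p\<^sup>2 * (e * L)"
    proof -
      have "s powr p \<le> e" unfolding e_def using True s p by (intro powr_mono2) auto
      then show "2 / p\<^sup>2 * s powr p \<le> 2 / p\<^sup>2 * (e * L)" using eL by (intro mult_left_mono) auto
    qed simp
    have comb: "\<bar>- x1 + x2 + x3 + x4 - x5\<bar> \<le> a1 + a2 + a3 + a4 + a5"
      if "\<bar>x1\<bar> \<le> a1" "0 \<le> x2" "x2 \<le> a2" "0 \<le> x3" "x3 \<le> a3" "0 \<le> x4" "x4 \<le> a4" "0 \<le> x5" "x5 \<le> a5"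
      for x1 x2 x3 x4 x5 a1 a2 a3 a4 a5 :: real
      using that by linarith
    have "\<bar>disc_pot_mix p \<epsilon> R s - C - 2 / p\<^sup>2 * s powr p\<bar>
        \<le> 2 / p * (e * L) + 2 / p\<^sup>2 * (e * L) + 1 / p * (e * L) + e * L + 2 / p\<^sup>2 * (e * L)"
      unfolding eq by (rule comb[OF 1 2 3 4 5])
    \<comment> \<open>The five bounds sum to (4 / p^2 + 3 / p + 1) * (e * L); one more 2 / p^2 leads
      to the coefficient in the statement.\<close>
    also have "\<dots> \<le> 2 / p * (e * L) + 2 / p\<^sup>2 * (e * L) + 1 / p * (e * L) + e * L + 2 / p\<^sup>2 * (e * L) + 2 / p\<^sup>2 * (e * L)"
      unfolding le_add_same_cancel1 using e L by (intro mult_nonneg_nonneg) auto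
    also have "\<dots> = (6 / p\<^sup>2 + 3 / p + 1) * (e * L)"
      by (simp add: algebra_simps add_divide_distrib[symmetric])
    finally show ?thesis unfolding e_def L_def .
  next
    case False
    then have s0: "s > 0" "\<epsilon> < s" using R by auto
    \<comment> \<open>Split at \<rho> = s: the terms at s combine to exactly 2 / p^2 * s powr p, and
      the only error is the boundary term with e * ln s at \<rho> = \<epsilon>.\<close>
    have "((\<lambda>\<rho>. \<rho> powr (p - 3) * disc_pot \<rho> s) has_integral (s powr p / p * ln s - e / p * ln s) + (B R - B s)) {\<epsilon>..R}"
      unfolding e_def using inner[of \<epsilon> s] outer[of s R] s s0 R
      by (intro has_integral_combine[of \<epsilon> s R]) auto
    then have "integral {\<epsilon>..R} (\<lambda>\<rho>. \<rho> powr (p - 3) * disc_pot \<rho> s) = (s powr p / p * ln s - e / p * ln s) + (B R - B s)"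
      by (rule integral_unique)
    moreover have "(2 - p) * ((x - e / p * ln s) + (B R - B s)) = (2 - p) * (x - B s) + (2 - p) * B R - (2 - p) / p * (e * ln s)" for x
      by (simp add: right_diff_distrib distrib_left)
    ultimately have "disc_pot_mix p \<epsilon> R s - C = (2 - p) * (s powr p / p * ln s - B s) - (2 - p) / p * (e * ln s)"
      using top BR by (simp only: disc_pot_mix_def)
    also have "(2 - p) * (s powr p / p * ln s - B s) = 2 / p\<^sup>2 * s powr p"
    proof -
      have "s powr (p - 2) * s\<^sup>2 = s powr p" using s0 by (simp add: powr_add[symmetric] flip: powr_numeral)
      then have "B s = s powr p * ln s / p - s powr p / p\<^sup>2 - s powr p / (2 * p) + s powr p / (2 * (p - 2))"
        by (simp add: B_def mult.commute)
      then have "(2 - p) * (s powr p / p * ln s - B s) = (2 - p) * (s powr p / p\<^sup>2 + s powr p / (2 * p) - s powr p / (2 * (p - 2)))"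
        by simp
      also have "\<dots> = 2 / p\<^sup>2 * s powr p"
        using p by (simp add: divide_simps power2_eq_square) (simp add: algebra_simps)
      finally show ?thesis .
    qed
    finally have eq: "disc_pot_mix p \<epsilon> R s - C - 2 / p\<^sup>2 * s powr p = - ((2 - p) / p * (e * ln s))" by simp
    have "ln \<epsilon> \<le> ln s" "ln s \<le> ln R" using s0 s R by auto
    then have "\<bar>ln s\<bar> \<le> L" using L by linarith
    then have "e * \<bar>ln s\<bar> \<le> e * L" using e by simp
    then have "\<bar>(2 - p) / p * (e * ln s)\<bar> \<le> 2 / p * (e * L)"
      unfolding abs_mult using p e by (intro mult_mono) (auto simp: divide_right_mono)
    also have "\<dots> \<le> (6 / p\<^sup>2 + 3 / p + 1) * (e * L)"
      using p e L by (intro mult_right_mono) (auto simp: field_simps)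
    finally show ?thesis unfolding eq e_def L_def by simp
  qed
qed

text \<open>The weights in \<open>disc_pot_mix\<close> are nonnegative for p < 2, so the hypothesis
  on all discs passes to the mixtures once integrals are exchanged. With one bound \<open>R\<close>
  for both functions the constant \<open>C\<close> is common and cancels; the error \<open>E\<close>
  vanishes as \<epsilon> tends to 0.\<close>

lemma integral_powr_le_of_disc_pot:
  fixes u v :: "real \<Rightarrow> real"
  assumes cu: "continuous_on {a..b} u" and cv: "continuous_on {a..b} v"
    and nonneg: "\<And>t. t \<in> {a..b} \<Longrightarrow> u t \<ge> 0" "\<And>t. t \<in> {a..b} \<Longrightarrow> v t \<ge> 0"
    and le: "\<And>\<rho>. \<rho> > 0 \<Longrightarrow> integral {a..b} (\<lambda>t. disc_pot \<rho> (u t)) \<le> integral {a..b} (\<lambda>t. disc_pot \<rho> (v t))"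
    and p: "0 < p" "p < 2" and "a \<le> b"
  shows "integral {a..b} (\<lambda>t. u t powr p) \<le> integral {a..b} (\<lambda>t. v t powr p)"
proof -
  have "bounded (u ` {a..b} \<union> v ` {a..b})"
    using cu cv by (auto intro: compact_imp_bounded compact_continuous_image)
  then obtain R0 where R0: "R0 > 0" "\<And>x. x \<in> u ` {a..b} \<union> v ` {a..b} \<Longrightarrow> norm x \<le> R0"
    unfolding bounded_pos by blast
  define R where "R = R0"
  have R: "R > 0" "\<And>t. t \<in> {a..b} \<Longrightarrow> u t \<le> R" "\<And>t. t \<in> {a..b} \<Longrightarrow> v t \<le> R"
    using R0 by (force simp: R_def)+
  define E where "E = (\<lambda>\<epsilon>. (6 / p\<^sup>2 + 3 / p + 1) * (\<epsilon> powr p * (1 + \<bar>ln \<epsilon>\<bar> + \<bar>ln R\<bar>)))"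
  define C where "C = (2 - p) * (R powr p * ln R / p - R powr p / p\<^sup>2 - R powr p / (2 * p)) + R powr p * ln R - R powr p / 2"
  have cp: "continuous_on {a..b} (\<lambda>t. w t powr p)" if "continuous_on {a..b} w" "\<And>t. t \<in> {a..b} \<Longrightarrow> w t \<ge> 0" for w
    using that p by (intro continuous_on_powr') auto
  have main: "2 / p\<^sup>2 * integral {a..b} (\<lambda>t. u t powr p) \<le> 2 / p\<^sup>2 * integral {a..b} (\<lambda>t. v t powr p) + 2 * E \<epsilon> * (b - a)"
    if \<epsilon>: "0 < \<epsilon>" "\<epsilon> < R" for \<epsilon>
  proof -
    have cont2: "continuous_on (S \<times> {\<epsilon>..R}) (\<lambda>(t, \<rho>). \<rho> powr (p - 3) * disc_pot \<rho> (w t))"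
      if "continuous_on S w" for w and S :: "real set"
      unfolding case_prod_beta using \<epsilon>
      by (intro continuous_intros continuous_on_compose2[OF that]) auto
    have cmix: "continuous_on {a..b} (\<lambda>t. disc_pot_mix p \<epsilon> R (w t))" if "continuous_on {a..b} w" for w
      unfolding disc_pot_mix_def
      using integral_continuous_on_param[of "{a..b}" \<epsilon> R, unfolded cbox_interval, OF cont2[OF that]] R(1)
      by (intro continuous_intros that) auto
    have mix: "integral {a..b} (\<lambda>t. disc_pot_mix p \<epsilon> R (w t)) = R powr (p - 2) * integral {a..b} (\<lambda>t. disc_pot R (w t))
        + (2 - p) * integral {\<epsilon>..R} (\<lambda>\<rho>. \<rho> powr (p - 3) * integral {a..b} (\<lambda>t. disc_pot \<rho> (w t)))"
      if "continuous_on {a..b} w" for w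
    proof -
      have "integral {a..b} (\<lambda>t. integral {\<epsilon>..R} (\<lambda>\<rho>. \<rho> powr (p - 3) * disc_pot \<rho> (w t)))
         = integral {\<epsilon>..R} (\<lambda>\<rho>. integral {a..b} (\<lambda>t. \<rho> powr (p - 3) * disc_pot \<rho> (w t)))"
        using integral_swap_continuous[of a \<epsilon> b R "\<lambda>t \<rho>. \<rho> powr (p - 3) * disc_pot \<rho> (w t)"] cont2[OF that]
        by (simp add: cbox_Pair_eq)
      then show ?thesis unfolding disc_pot_mix_def
        using integral_continuous_on_param[of "{a..b}" \<epsilon> R, unfolded cbox_interval, OF cont2[OF that]] R(1)
        by (subst integral_add) (auto intro!: integrable_continuous_interval continuous_intros that)
    qed
    have cpar: "continuous_on {\<epsilon>..R} (\<lambda>\<rho>. \<rho> powr (p - 3) * integral {a..b} (\<lambda>t. disc_pot \<rho> (w t)))"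
      if "continuous_on {a..b} w" for w
    proof -
      have "continuous_on ({\<epsilon>..R} \<times> cbox a b) (\<lambda>(\<rho>, t). disc_pot \<rho> (w t))"
        unfolding case_prod_beta using \<epsilon>
        by (intro continuous_intros continuous_on_compose2[OF that]) auto
      from integral_continuous_on_param[OF this] show ?thesis
        using \<epsilon> by (intro continuous_intros) auto
    qed
    have "integral {a..b} (\<lambda>t. disc_pot_mix p \<epsilon> R (u t)) \<le> integral {a..b} (\<lambda>t. disc_pot_mix p \<epsilon> R (v t))"
      unfolding mix[OF cu] mix[OF cv] using p \<epsilon> R(1)
      by (intro add_mono mult_left_mono le integral_le integrable_continuous_interval cpar cu cv) auto
    moreover have est: "\<bar>integral {a..b} (\<lambda>t. disc_pot_mix p \<epsilon> R (w t)) - C * (b - a) - 2 / p\<^sup>2 * integral {a..b} (\<lambda>t. w t powr p)\<bar> \<le> E \<epsilon> * (b - a)"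
      if w: "continuous_on {a..b} w" "\<And>t. t \<in> {a..b} \<Longrightarrow> w t \<ge> 0" "\<And>t. t \<in> {a..b} \<Longrightarrow> w t \<le> R" for w
    proof -
      have i: "(\<lambda>t. disc_pot_mix p \<epsilon> R (w t)) integrable_on {a..b}" "(\<lambda>t. 2 / p\<^sup>2 * w t powr p) integrable_on {a..b}"
        "(\<lambda>t. disc_pot_mix p \<epsilon> R (w t) - C) integrable_on {a..b}"
        using p by (auto intro!: integrable_continuous_interval continuous_intros cmix cp w)
      have "integral {a..b} (\<lambda>t. disc_pot_mix p \<epsilon> R (w t) - C - 2 / p\<^sup>2 * w t powr p)
        = integral {a..b} (\<lambda>t. disc_pot_mix p \<epsilon> R (w t)) - C * (b - a) - 2 / p\<^sup>2 * integral {a..b} (\<lambda>t. w t powr p)"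
        using integral_diff[OF i(3) i(2)] integral_diff[OF i(1) integrable_const_ivl[of C]] \<open>a \<le> b\<close> by simp
      then have "integral {a..b} (\<lambda>t. disc_pot_mix p \<epsilon> R (w t)) - C * (b - a) - 2 / p\<^sup>2 * integral {a..b} (\<lambda>t. w t powr p)
        = integral {a..b} (\<lambda>t. disc_pot_mix p \<epsilon> R (w t) - C - 2 / p\<^sup>2 * w t powr p)" ..
      also have "norm \<dots> \<le> integral {a..b} (\<lambda>t. E \<epsilon>)"
      proof (rule integral_norm_bound_integral)
        show "(\<lambda>t. disc_pot_mix p \<epsilon> R (w t) - C - 2 / p\<^sup>2 * w t powr p) integrable_on {a..b}"
          using i(3) i(2) by (rule integrable_diff)
        fix t assume "t \<in> {a..b}"
        then show "norm (disc_pot_mix p \<epsilon> R (w t) - C - 2 / p\<^sup>2 * w t powr p) \<le> E \<epsilon>"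
          unfolding E_def C_def real_norm_def by (intro disc_pot_mix_approx[OF p \<epsilon>] w)
      qed (rule integrable_const_ivl)
      finally show ?thesis using \<open>a \<le> b\<close> by (simp add: mult.commute)
    qed
    ultimately show ?thesis using est[OF cu nonneg(1) R(2)] est[OF cv nonneg(2) R(3)] by linarith
  qed
  have "2 / p\<^sup>2 * integral {a..b} (\<lambda>t. u t powr p) \<le> 2 / p\<^sup>2 * integral {a..b} (\<lambda>t. v t powr p)"
  proof (rule tendsto_lowerbound)
    have "(E \<longlongrightarrow> 0) (at_right 0)" unfolding E_def using p by real_asymp
    then have "((\<lambda>\<epsilon>. 2 / p\<^sup>2 * integral {a..b} (\<lambda>t. v t powr p) + 2 * E \<epsilon> * (b - a)) \<longlongrightarrow>
       2 / p\<^sup>2 * integral {a..b} (\<lambda>t. v t powr p) + 2 * 0 * (b - a)) (at_right 0)"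
      by (intro tendsto_intros)
    then show "((\<lambda>\<epsilon>. 2 / p\<^sup>2 * integral {a..b} (\<lambda>t. v t powr p) + 2 * E \<epsilon> * (b - a)) \<longlongrightarrow>
       2 / p\<^sup>2 * integral {a..b} (\<lambda>t. v t powr p)) (at_right 0)" by simp
    show "\<forall>\<^sub>F \<epsilon> in at_right 0. 2 / p\<^sup>2 * integral {a..b} (\<lambda>t. u t powr p)
       \<le> 2 / p\<^sup>2 * integral {a..b} (\<lambda>t. v t powr p) + 2 * E \<epsilon> * (b - a)"
      by (rule eventually_at_rightI[of 0 R]) (use main R in auto)
  qed simp
  moreover have "2 / p\<^sup>2 > 0" using p by simp
  ultimately show ?thesis by (simp only: mult_le_cancel_left_pos)
qed

section \<open>Convexity preserving functions\<close>

text \<open>Convexity is used on the open half-line; at x = 0 the inequality amounts to 1 \<le>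
  p.\<close>

lemma powr_above_tangent:
  fixes m x p :: real
  assumes "p \<ge> 1" "m > 0" "x \<ge> 0"
  shows "m powr p + p * m powr (p - 1) * (x - m) \<le> x powr p"
proof (cases "x = 0")
  case True
  have "m powr (p - 1) * m = m powr p" using assms by (simp add: powr_diff)
  then have "p * m powr (p - 1) * (x - m) = - (p * m powr p)" using True by simp
  moreover have "m powr p \<le> p * m powr p" using assms by simp
  moreover have "x powr p = 0" using True by simp
  ultimately show ?thesis by linarith
next
  case False
  have "x powr p - m powr p \<ge> p * m powr (p - 1) * (x - m)"
  proof (rule convex_on_imp_above_tangent[where A = "{0<..}"])
    show "convex_on {0<..} (\<lambda>x. x powr p)" using assms(1) by (rule powr_convex)
    show "((\<lambda>x. x powr p) has_real_derivative p * m powr (p - 1)) (at m within {0<..})"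
      by (rule has_field_derivative_at_within[OF has_real_derivative_powr[OF assms(2)]])
  qed (use assms False in \<open>auto simp: interior_open\<close>)
  then show ?thesis by simp
qed

text \<open>Integrate the tangent inequality at \<open>m\<close> against \<open>w\<close>. As the
  slope \<open>k\<close> is nonnegative, \<open>m\<close> need only be at most the weighted mean of
  \<open>u\<close>, which is what the triangle inequality gives for the modulus of an
  average.\<close>

lemma jensen_powr_weighted:
  fixes u w :: "real \<Rightarrow> real"
  assumes "p \<ge> 1" and cu: "continuous_on {a..b} u" and cw: "continuous_on {a..b} w"
    and u: "\<And>s. s \<in> {a..b} \<Longrightarrow> u s \<ge> 0" and w: "\<And>s. s \<in> {a..b} \<Longrightarrow> w s \<ge> 0"
    and W: "integral {a..b} w = W" "W > 0" and m: "m \<ge> 0" "W * m \<le> integral {a..b} (\<lambda>s. u s * w s)"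
  shows "W * m powr p \<le> integral {a..b} (\<lambda>s. u s powr p * w s)"
proof (cases "m = 0")
  case True
  have "continuous_on {a..b} (\<lambda>s. u s powr p)"
    using cu u assms(1) by (intro continuous_on_powr') auto
  then have "0 \<le> integral {a..b} (\<lambda>s. u s powr p * w s)"
    using w by (intro integral_nonneg integrable_continuous_interval continuous_on_mult cw) auto
  then show ?thesis using True by simp
next
  case False
  have cp: "continuous_on {a..b} (\<lambda>s. u s powr p)"
    using cu u assms(1) by (intro continuous_on_powr') auto
  define k where "k = p * m powr (p - 1)"
  have k: "k \<ge> 0" using assms by (simp add: k_def)
  have i1: "w integrable_on {a..b}" "(\<lambda>s. u s * w s) integrable_on {a..b}"
    by (auto intro!: integrable_continuous_interval continuous_intros cu cw)
  have "integral {a..b} (\<lambda>s. (m powr p - k * m) * w s + k * (u s * w s)) \<le> integral {a..b} (\<lambda>s. u s powr p * w s)"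
  proof (rule integral_le)
    fix s assume s: "s \<in> {a..b}"
    have "m powr p + k * (u s - m) \<le> u s powr p"
      unfolding k_def using assms False u[OF s] by (intro powr_above_tangent) auto
    from mult_right_mono[OF this w[OF s]]
    show "(m powr p - k * m) * w s + k * (u s * w s) \<le> u s powr p * w s" by (simp add: algebra_simps)
  qed (auto intro!: integrable_continuous_interval continuous_intros cu cw cp)
  moreover have "integral {a..b} (\<lambda>s. (m powr p - k * m) * w s + k * (u s * w s))
      = (m powr p - k * m) * W + k * integral {a..b} (\<lambda>s. u s * w s)"
    using i1 W(1) by (subst integral_add) (auto intro!: integrable_on_mult_right)
  moreover have "k * (W * m) \<le> k * integral {a..b} (\<lambda>s. u s * w s)"
    using m(2) k by (rule mult_left_mono)
  moreover have "(m powr p - k * m) * W + k * (W * m) = W * m powr p" by (simp add: algebra_simps)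
  ultimately show ?thesis by linarith
qed

text \<open>Integrate \<open>J\<close> over t, exchange the integrals, and use that rotation by s
  does not change the integral over a period. \<open>N\<close> will be a power of the modulus for p
  \<ge> 1 and |Re w - x| for p < 1.\<close>

lemma circle_convolution_mean_le:
  fixes f :: "real \<Rightarrow> complex" and P :: "real \<Rightarrow> real" and N :: "complex \<Rightarrow> real"
  assumes cf: "continuous_on UNIV f" and per: "\<And>t. f (t + 2 * pi) = f t"
    and cP: "continuous_on {-pi..pi} P" and cN: "continuous_on UNIV N" and cg: "continuous_on {-pi..pi} g"
    and P: "cint P = 2 * pi"
    and J: "\<And>t. 2 * pi * N (g t) \<le> cint (\<lambda>s. N (f (t - s)) * P s)"
  shows "cint (\<lambda>t. N (g t)) \<le> cint (\<lambda>t. N (f t))"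
proof -
  have cNf: "continuous_on S (\<lambda>x. N (f (h x)))" if "continuous_on S h" for S :: "'c::topological_space set" and h
    by (intro continuous_on_compose2[OF cN] continuous_on_compose2[OF cf] that) auto
  have cPs: "continuous_on S (\<lambda>x. P (h x))" if "continuous_on S h" "h ` S \<subseteq> {-pi..pi}" for S :: "'c::topological_space set" and h
    by (rule continuous_on_compose2[OF cP that])
  have c2: "continuous_on ({-pi..pi} \<times> {-pi..pi}) (\<lambda>(t, s). N (f (t - s)) * P s)"
    unfolding case_prod_beta by (intro continuous_intros cNf cPs) auto
  have "2 * pi * cint (\<lambda>t. N (g t)) = cint (\<lambda>t. 2 * pi * N (g t))" by simp
  also have "\<dots> \<le> cint (\<lambda>t. cint (\<lambda>s. N (f (t - s)) * P s))"
    using integral_continuous_on_param[of "{-pi..pi}" "-pi" pi, unfolded cbox_interval, OF c2]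
    by (intro integral_le integrable_continuous_interval continuous_intros J continuous_on_compose2[OF cN cg]) auto
  also have "\<dots> = cint (\<lambda>s. cint (\<lambda>t. N (f (t - s)) * P s))"
    using integral_swap_continuous[of "-pi" "-pi" pi pi "\<lambda>t s. N (f (t - s)) * P s"] c2
    by (simp add: cbox_Pair_eq)
  also have "\<dots> = cint (\<lambda>s. cint (\<lambda>t. N (f t)) * P s)"
  proof (rule integral_cong)
    fix s assume "s \<in> {-pi..pi}"
    then have "cint (\<lambda>t. N (f (t + - s))) = cint (\<lambda>t. N (f t))"
      by (intro integral_periodic_shift cNf) (auto simp: per intro: continuous_intros)
    then show "cint (\<lambda>t. N (f (t - s)) * P s) = cint (\<lambda>t. N (f t)) * P s"
      by simp
  qed
  also have "\<dots> = 2 * pi * cint (\<lambda>t. N (f t))" using P by simp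
  finally show ?thesis by simp
qed

section \<open>The averaging kernel of a convexity preserving function\<close>

lemma fps_expansion_sums:
  assumes "f holomorphic_on \<D>" "z \<in> \<D>"
  shows "(\<lambda>n. fps_nth (fps_expansion f 0) n * z ^ n) sums f z"
  using holomorphic_power_series[OF assms] by (simp add: fps_expansion_def)

lemma fps_nth_expansion_0: "fps_nth (fps_expansion f 0) 0 = f 0"
  by (simp add: fps_expansion_def)

lemma convolution_const:
  assumes "F holomorphic_on \<D>" "z \<in> \<D>"
  shows "((\<lambda>_. c) \<star> F) z = c * F 0"
proof -
  have "fps_nth (fps_expansion (\<lambda>_. c) 0) n = (if n = 0 then c else 0)" for n
    by (cases n) (simp_all add: fps_expansion_def higher_deriv_const)
  then have "((\<lambda>_. c) \<star> F) z = (\<Sum>n. if n = 0 then c * F 0 else 0)"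
    unfolding convolution_def by (intro suminf_cong) (auto simp: fps_nth_expansion_0)
  also have "\<dots> = c * F 0" using suminf_finite[of "{0::nat}" "\<lambda>n. if n = 0 then c * F 0 else 0"] by simp
  finally show ?thesis .
qed

text \<open>All coefficients of 1 / (1 - z) are 1. This turns a property of convolutions with
  \<open>F\<close> into one of \<open>F\<close> itself.\<close>

lemma convolution_geometric:
  assumes "F holomorphic_on \<D>" "z \<in> \<D>"
  shows "((\<lambda>z. 1 / (1 - z)) \<star> F) z = F z"
proof -
  have "(\<lambda>z::complex. inverse (1 - z)) has_fps_expansion inverse (1 - fps_X)"
    by (intro fps_expansion_intros) auto
  moreover have "inverse (1 - fps_X) = Abs_fps (\<lambda>_. 1 :: complex)"
    by (subst fps_inverse_gp'[symmetric], rule fps_inverse_idempotent) simp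
  ultimately have "fps_nth (fps_expansion (\<lambda>z::complex. 1 / (1 - z)) 0) n = 1" for n
    using fps_nth_fps_expansion[of "\<lambda>z::complex. inverse (1 - z)" "inverse (1 - fps_X)" n]
    by (simp add: fps_expansion_def inverse_eq_divide)
  then show ?thesis unfolding convolution_def
    using sums_unique[OF fps_expansion_sums[OF assms]] by simp
qed

lemma convexity_preserving_at_0:
  assumes "convexity_preserving F"
  shows "F 0 = 1"
proof -
  have F: "F holomorphic_on \<D>" using assms by (simp add: convexity_preserving_def)
  have "((\<lambda>_. 1) \<star> F) ` \<D> \<subseteq> closure (convex hull ((\<lambda>_. 1) ` \<D>))"
    using assms by (simp add: convexity_preserving_def)
  then have "((\<lambda>_. 1) \<star> F) 0 \<in> closure (convex hull ((\<lambda>_::complex. 1::complex) ` \<D>))" by auto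
  moreover have "(\<lambda>_::complex. 1::complex) ` \<D> = {1}" by (simp add: image_constant_conv)
  ultimately show ?thesis using convolution_const[OF F, of 0 1] by simp
qed

text \<open>The range of 1 / (1 - z) lies in the closed convex half-plane Re w \<ge> 1/2, hence so
  does that of \<open>F\<close>. This makes the kernel 2 Re F - 1 nonnegative.\<close>

lemma convexity_preserving_Re_ge_half:
  assumes "convexity_preserving F" "z \<in> \<D>"
  shows "Re (F z) \<ge> 1 / 2"
proof -
  have F: "F holomorphic_on \<D>" using assms by (simp add: convexity_preserving_def)
  have hol: "(\<lambda>z::complex. 1 / (1 - z)) holomorphic_on \<D>"
    by (intro holomorphic_intros) auto
  have "((\<lambda>z. 1 / (1 - z)) \<star> F) z \<in> closure (convex hull ((\<lambda>z. 1 / (1 - z)) ` \<D>))"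
  proof -
    have "\<forall>f. f holomorphic_on \<D> \<longrightarrow> (f \<star> F) ` \<D> \<subseteq> closure (convex hull (f ` \<D>))"
      using assms(1) by (simp add: convexity_preserving_def)
    from subsetD[OF this[rule_format, OF hol] imageI[OF assms(2)]] show ?thesis .
  qed
  also have "closure (convex hull ((\<lambda>z::complex. 1 / (1 - z)) ` \<D>)) \<subseteq> {w. Re w \<ge> 1 / 2}"
  proof (intro closure_minimal hull_minimal subsetI)
    show "convex {w. Re w \<ge> 1 / 2}" by (rule convex_halfspace_Re_ge)
    show "closed {w. Re w \<ge> 1 / 2}" by (rule closed_halfspace_Re_ge)
    fix w :: complex assume "w \<in> (\<lambda>z. 1 / (1 - z)) ` \<D>"
    then obtain z where z: "cmod z < 1" "w = 1 / (1 - z)" by auto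
    have "(cmod (1 - z))\<^sup>2 = 1 - 2 * Re z + (cmod z)\<^sup>2"
      by (simp add: cmod_power2 power2_diff)
    moreover have "(cmod z)\<^sup>2 < 1" using z by (simp add: power_less_one_iff)
    ultimately have "(cmod (1 - z))\<^sup>2 \<le> 2 * (1 - Re z)" by simp
    moreover have "cmod (1 - z) > 0" using z by auto
    ultimately have "1 / 2 \<le> (1 - Re z) / (cmod (1 - z))\<^sup>2" by (simp add: field_simps)
    then show "w \<in> {w. Re w \<ge> 1 / 2}" by (simp add: z Re_divide cmod_power2)
  qed
  finally show ?thesis using convolution_geometric[OF F assms(2)] by simp
qed

text \<open>Write 2 Re F - 1 = F + cnj F - 1. Pairing the rotated \<open>f\<close> with F gives the
  convolution by termwise integration. Pairing it with cnj F gives 2 pi * f 0, because in u = cis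
  (-s) the integrand is holomorphic, and the term -1 takes this away again. So a real kernel yields
  the same average as F.\<close>

lemma convolution_integral:
  assumes f: "f holomorphic_on \<D>" and F: "F holomorphic_on \<D>" and F0: "F 0 = 1"
    and \<rho>: "0 < \<rho>" "\<rho> < 1" and z: "z \<in> \<D>"
  shows "(\<lambda>n. fps_nth (fps_expansion f 0) n * fps_nth (fps_expansion F 0) n * (of_real \<rho> * z) ^ n)
      sums (f \<star> F) (of_real \<rho> * z)" (is ?sums)
    and "cint (\<lambda>s. f (z * cis (- s)) * of_real (2 * Re (F (of_real \<rho> * cis s)) - 1))
      = 2 * pi * (f \<star> F) (of_real \<rho> * z)" (is ?int)
proof -
  define a where "a = fps_nth (fps_expansion f 0)"
  define b where "b = fps_nth (fps_expansion F 0)"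
  have memf: "z * cis (- s) \<in> \<D>" for s using z by (simp add: norm_mult)
  have memF: "of_real \<rho> * cis s \<in> \<D>" for s using \<rho> by (simp add: norm_mult)
  have cf: "continuous_on S (\<lambda>s. f (z * cis (- s)))" for S
    by (intro continuous_on_compose2[OF holomorphic_on_imp_continuous_on[OF f]] continuous_intros) (use memf in auto)
  have cF: "continuous_on S (\<lambda>s. F (of_real \<rho> * cis s))" for S
    by (intro continuous_on_compose2[OF holomorphic_on_imp_continuous_on[OF F]] continuous_intros) (use memF in auto)
  have "bounded ((\<lambda>s. F (of_real \<rho> * cis s)) ` {-pi..pi})"
    by (intro compact_imp_bounded compact_continuous_image cF) auto
  then obtain B where B: "B > 0" "\<And>s. s \<in> {-pi..pi} \<Longrightarrow> cmod (F (of_real \<rho> * cis s)) \<le> B"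
    unfolding bounded_pos by auto
  have absum: "summable (\<lambda>n. cmod (a n * z ^ n))"
  proof -
    \<comment> \<open>Convergence at a point of larger modulus gives absolute convergence at
      \<open>z\<close>, as the M-test requires.\<close>
    define z' where "z' = complex_of_real ((1 + cmod z) / 2)"
    have "cmod z' = (1 + cmod z) / 2" unfolding z'_def norm_of_real by simp
    then have z': "z' \<in> \<D>" "cmod z < cmod z'" using z by auto
    have "summable (\<lambda>n. a n * z' ^ n)"
      using fps_expansion_sums[OF f z'(1)] by (auto simp: a_def sums_iff)
    from powser_insidea[OF this z'(2)] show ?thesis .
  qed
  have uni: "uniform_limit {-pi..pi} (\<lambda>n s. \<Sum>i<n. a i * (z * cis (- s)) ^ i * F (of_real \<rho> * cis s))
      (\<lambda>s. \<Sum>i. a i * (z * cis (- s)) ^ i * F (of_real \<rho> * cis s)) sequentially"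
  proof (rule Weierstrass_m_test)
    show "summable (\<lambda>n. cmod (a n * z ^ n) * B)" using absum by (rule summable_mult2)
    fix n s assume "s \<in> {-pi..pi}"
    then show "norm (a n * (z * cis (- s)) ^ n * F (of_real \<rho> * cis s)) \<le> cmod (a n * z ^ n) * B"
      unfolding norm_mult norm_power by (intro mult_mono B) (auto intro!: mult_nonneg_nonneg)
  qed
  have lim_eq: "(\<Sum>i. a i * (z * cis (- s)) ^ i * F (of_real \<rho> * cis s)) = f (z * cis (- s)) * F (of_real \<rho> * cis s)" for s
    using sums_unique[OF sums_mult2[OF fps_expansion_sums[OF f memf[of s]], of "F (of_real \<rho> * cis s)"]]
    by (simp add: a_def)
  have cn: "continuous_on {-pi..pi} (\<lambda>s. \<Sum>i<n. a i * (z * cis (- s)) ^ i * F (of_real \<rho> * cis s))" for n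
    by (intro continuous_intros cF)
  obtain I J where IJ: "\<And>n. ((\<lambda>s. \<Sum>i<n. a i * (z * cis (- s)) ^ i * F (of_real \<rho> * cis s)) has_integral I n) {-pi..pi}"
    "((\<lambda>s. \<Sum>i. a i * (z * cis (- s)) ^ i * F (of_real \<rho> * cis s)) has_integral J) {-pi..pi}" "I \<longlonglongrightarrow> J"
    using uniform_limit_integral[OF uni cn] by auto
  have coeff_int: "cint (\<lambda>s. a i * (z * cis (- s)) ^ i * F (of_real \<rho> * cis s)) = 2 * pi * (a i * b i * (of_real \<rho> * z) ^ i)" for i
  proof -
    have "(\<lambda>s. a i * (z * cis (- s)) ^ i * F (of_real \<rho> * cis s)) = (\<lambda>s. a i * z ^ i * (F (of_real \<rho> * cis s) / cis s ^ i))"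
      by (simp add: power_mult_distrib cis_inverse[symmetric] field_simps power_inverse[symmetric])
    then have e: "cint (\<lambda>s. a i * (z * cis (- s)) ^ i * F (of_real \<rho> * cis s))
        = a i * z ^ i * cint (\<lambda>s. F (of_real \<rho> * cis s) / cis s ^ i)"
      by (simp only: integral_mult_right)
    show ?thesis
      unfolding e circle_coefficient_integral[OF F \<rho>]
      by (simp add: b_def fps_expansion_def power_mult_distrib)
  qed
  have I: "I = (\<lambda>n. \<Sum>i<n. 2 * pi * (a i * b i * (of_real \<rho> * z) ^ i))"
  proof
    fix n
    have "I n = cint (\<lambda>s. \<Sum>i<n. a i * (z * cis (- s)) ^ i * F (of_real \<rho> * cis s))"
      using IJ(1)[of n] by (rule integral_unique[symmetric])
    also have "\<dots> = (\<Sum>i<n. cint (\<lambda>s. a i * (z * cis (- s)) ^ i * F (of_real \<rho> * cis s)))"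
      by (intro integral_sum integrable_continuous_interval continuous_intros cF) auto
    finally show "I n = (\<Sum>i<n. 2 * pi * (a i * b i * (of_real \<rho> * z) ^ i))" by (simp only: coeff_int)
  qed
  have "(\<lambda>i. 2 * pi * (a i * b i * (of_real \<rho> * z) ^ i)) sums J"
    using IJ(3) unfolding sums_def I .
  from sums_mult[OF this, of "1 / (2 * pi)"]
  have s: "(\<lambda>i. a i * b i * (of_real \<rho> * z) ^ i) sums (J / (2 * pi))" by simp
  then show ?sums unfolding convolution_def a_def b_def by (simp add: sums_iff)
  have "J / (2 * pi) = (f \<star> F) (of_real \<rho> * z)"
    using sums_unique[OF s] by (simp add: convolution_def a_def b_def)
  then have J: "J = 2 * pi * (f \<star> F) (of_real \<rho> * z)" by (simp add: field_simps)
  have I1: "cint (\<lambda>s. f (z * cis (- s)) * F (of_real \<rho> * cis s)) = J"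
    using IJ(2) unfolding lim_eq by (rule integral_unique)
  \<comment> \<open>The minimum keeps f (z u) and F (\<rho> u) holomorphic for |u| < R with R > 1,
    so that the mean value property applies on the unit circle.\<close>
  define R where "R = min (1 / \<rho>) (2 / (1 + cmod z))"
  have R: "R > 1" using z \<rho> by (auto simp: R_def field_simps add_pos_nonneg)
  have Rz: "cmod z * R < 1"
  proof -
    have "cmod z * R \<le> cmod z * (2 / (1 + cmod z))" by (intro mult_left_mono) (auto simp: R_def)
    also have "\<dots> < 1" using z by (simp add: field_simps add_pos_nonneg)
    finally show ?thesis .
  qed
  have z_in: "z * u \<in> \<D>" if "u \<in> ball 0 R" for u
  proof -
    have "cmod z * cmod u \<le> cmod z * R" using that by (intro mult_left_mono) auto
    then show ?thesis using Rz by (simp add: norm_mult)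
  qed
  have \<rho>_in: "of_real \<rho> * u \<in> \<D>" if "u \<in> ball 0 R" for u :: complex
    using that \<rho> by (simp add: norm_mult R_def field_simps)
  have hf: "(\<lambda>u. f (z * u)) holomorphic_on ball 0 R"
    by (intro holomorphic_on_compose_gen[OF _ f, unfolded o_def] holomorphic_intros) (use z_in in auto)
  have "(\<lambda>u. F (of_real \<rho> * u)) holomorphic_on cnj ` ball 0 R"
    by (intro holomorphic_on_compose_gen[OF _ F, unfolded o_def] holomorphic_intros) (use \<rho>_in in auto)
  from holomorphic_on_compose_cnj_cnj[OF this open_ball]
  have hF: "(\<lambda>u. cnj (F (of_real \<rho> * cnj u))) holomorphic_on ball 0 R" by (simp add: o_def)
  have refl: "cint (\<lambda>s. v (cis (- s))) = cint (\<lambda>s. v (cis s))" for v :: "complex \<Rightarrow> complex"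
    using Henstock_Kurzweil_Integration.integral_reflect_real[of pi "-pi" "\<lambda>s. v (cis s)"] by simp
  have I2: "cint (\<lambda>s. f (z * cis (- s)) * cnj (F (of_real \<rho> * cis s))) = 2 * pi * f 0"
    using circle_mean_holomorphic[OF holomorphic_on_mult[OF hf hF], of 1] R F0
      refl[of "\<lambda>u. f (z * u) * cnj (F (of_real \<rho> * cnj u))"]
    by (simp add: cis_cnj)
  have I3: "cint (\<lambda>s. f (z * cis (- s))) = 2 * pi * f 0"
    using circle_mean_holomorphic[OF hf, of 1] R refl[of "\<lambda>u. f (z * u)"] by simp
  have "cint (\<lambda>s. f (z * cis (- s)) * of_real (2 * Re (F (of_real \<rho> * cis s)) - 1))
     = cint (\<lambda>s. f (z * cis (- s)) * F (of_real \<rho> * cis s) + f (z * cis (- s)) * cnj (F (of_real \<rho> * cis s)) - f (z * cis (- s)))"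
  proof (rule integral_cong)
    have Re: "complex_of_real (2 * Re w - 1) = w + cnj w - 1" for w by (simp add: complex_eq_iff)
    show "f (z * cis (- s)) * of_real (2 * Re (F (of_real \<rho> * cis s)) - 1)
       = f (z * cis (- s)) * F (of_real \<rho> * cis s) + f (z * cis (- s)) * cnj (F (of_real \<rho> * cis s)) - f (z * cis (- s))" for s
      unfolding Re by (simp only: distrib_left right_diff_distrib mult_1_right)
  qed
  also have "\<dots> = J + 2 * pi * f 0 - 2 * pi * f 0"
    by (subst integral_diff, (auto intro!: integrable_continuous_interval continuous_intros cf cF)[2],
        subst integral_add, (auto intro!: integrable_continuous_interval continuous_intros cf cF)[2])
      (simp add: I1 I2 I3)
  finally show ?int by (simp add: J)
qed

section \<open>Comparison of the segment potentials\<close>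

definition circ :: "(complex \<Rightarrow> complex) \<Rightarrow> real \<Rightarrow> real \<Rightarrow> complex"
  where "circ h r t = h (of_real r * cis t)"

lemma continuous_on_circ [continuous_intros]:
  assumes "h holomorphic_on \<D>" "continuous_on S u" "continuous_on S v" "\<And>s. s \<in> S \<Longrightarrow> \<bar>u s\<bar> < 1"
  shows "continuous_on S (\<lambda>s. circ h (u s) (v s))"
  unfolding circ_def
  by (intro continuous_on_compose2[OF holomorphic_on_imp_continuous_on[OF assms(1)]] continuous_intros assms)
    (use assms(4) in \<open>auto simp: norm_mult\<close>)

lemma circ_periodic: "circ h r (t + 2 * pi) = circ h r t"
  by (simp add: circ_def flip: cis_mult)

lemma continuous_on_pot:
  assumes "continuous_on (S \<times> {-pi..pi}) (\<lambda>(s, t). \<gamma> s t)"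
    and "continuous_on S d" "continuous_on S x" "continuous_on S y"
  shows "continuous_on S (\<lambda>s. pot (\<gamma> s) (d s) (x s) (y s))"
proof -
  have "continuous_on (S \<times> {-pi..pi}) (\<lambda>(s, t). seg (d s) (\<gamma> s t) (x s) (y s))"
    unfolding case_prod_beta
    by (intro continuous_intros assms(1)[unfolded case_prod_beta] continuous_on_compose2[OF assms(2)]
        continuous_on_compose2[OF assms(3)] continuous_on_compose2[OF assms(4)]) auto
  from integral_continuous_on_param[of S "-pi" pi, unfolded cbox_interval, OF this]
  show ?thesis by (simp add: pot_def)
qed

text \<open>The derivative of \<open>seg\<close> in its last variable: one logarithm for each of the
  two moving ends of the segment.\<close>

definition pair_ln :: "real \<Rightarrow> complex \<Rightarrow> real \<Rightarrow> real \<Rightarrow> real"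
  where "pair_ln \<delta> \<zeta> x t = ln ((Re \<zeta> - x)\<^sup>2 + \<delta>\<^sup>2 + (t - Im \<zeta>)\<^sup>2) / 2
    + ln ((Re \<zeta> - x)\<^sup>2 + \<delta>\<^sup>2 + (t + Im \<zeta>)\<^sup>2) / 2"

lemma pair_ln_0: "pair_ln 0 \<zeta> x t = ln (cmod (\<zeta> - Complex x t)) + ln (cmod (\<zeta> - Complex x (- t)))"
  by (simp add: pair_ln_def cmod_def ln_sqrt power2_commute add.commute)

lemma pair_ln_integral:
  assumes "y \<le> Y"
  shows "(pair_ln \<delta> \<zeta> x has_integral (seg \<delta> \<zeta> x Y - seg \<delta> \<zeta> x y)) {y..Y}"
  using seg_diff_integral[OF assms] unfolding pair_ln_def[abs_def] .

lemma pot_diff: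
  assumes "continuous_on {-pi..pi} \<gamma>" "y \<le> Y"
    and "continuous_on ({-pi..pi} \<times> {y..Y}) (\<lambda>(\<theta>, t). pair_ln \<delta> (\<gamma> \<theta>) x t)"
  shows "pot \<gamma> \<delta> x Y - pot \<gamma> \<delta> x y = integral {y..Y} (\<lambda>t. cint (\<lambda>\<theta>. pair_ln \<delta> (\<gamma> \<theta>) x t))"
proof -
  have "pot \<gamma> \<delta> x Y - pot \<gamma> \<delta> x y = cint (\<lambda>\<theta>. seg \<delta> (\<gamma> \<theta>) x Y - seg \<delta> (\<gamma> \<theta>) x y)"
    unfolding pot_def
    by (intro integral_diff[symmetric] integrable_continuous_interval continuous_intros assms)
  also have "\<dots> = cint (\<lambda>\<theta>. integral {y..Y} (pair_ln \<delta> (\<gamma> \<theta>) x))"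
    by (intro integral_cong integral_unique[symmetric] pair_ln_integral assms)
  also have "\<dots> = integral {y..Y} (\<lambda>t. cint (\<lambda>\<theta>. pair_ln \<delta> (\<gamma> \<theta>) x t))"
    using integral_swap_continuous[of "-pi" y pi Y "\<lambda>\<theta> t. pair_ln \<delta> (\<gamma> \<theta>) x t"] assms(3)
    by (simp add: cbox_Pair_eq)
  finally show ?thesis .
qed

text \<open>For w outside the image of \<open>ball 0 r\<close>, f - w has no zero in that ball, so
  the mean of ln |f - w| is its value at the centre: each end contributes as if the curve were the
  constant 0. The argument runs on radii r' < r, since on radius r the curve may meet the points x
  \<plusminus> i t; continuity of the potentials then gives r.\<close>

lemma pot_diff_outside:
  assumes hol: "f holomorphic_on \<D>" and f0: "f 0 = 0" and r: "0 < r" "r < 1" and y: "y \<le> Y"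
    and out: "\<And>t. t \<in> {y..Y} \<Longrightarrow> Complex x t \<notin> f ` ball 0 r \<and> Complex x (- t) \<notin> f ` ball 0 r"
  shows "pot (circ f r) 0 x Y - pot (circ f r) 0 x y = 2 * pi * (seg 0 0 x Y - seg 0 0 x y)"
proof -
  define h where "h = (\<lambda>r. pot (circ f r) 0 x Y - pot (circ f r) 0 x y)"
  have inner: "h r' = 2 * pi * (seg 0 0 x Y - seg 0 0 x y)" if r': "0 < r'" "r' < r" for r'
  proof -
    have mem: "circ f r' \<theta> \<in> f ` ball 0 r" for \<theta> using r' by (auto simp: circ_def norm_mult)
    have ne: "circ f r' \<theta> - Complex x t \<noteq> 0" "circ f r' \<theta> - Complex x (-t) \<noteq> 0" if "t \<in> {y..Y}" for \<theta> t
      using mem[of \<theta>] out[OF that] by auto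
    have cc: "continuous_on S (\<lambda>s. circ f r' (v s))" if "continuous_on S v" for S :: "(real \<times> real) set" and v
      using that r' r by (intro continuous_intros hol) auto
    have cC: "continuous_on S (\<lambda>s. Complex x (v s))" if "continuous_on S v" for S :: "(real \<times> real) set" and v
      unfolding Complex_eq using that by (intro continuous_intros)
    have "h r' = integral {y..Y} (\<lambda>t. cint (\<lambda>\<theta>. pair_ln 0 (circ f r' \<theta>) x t))"
      unfolding h_def
    proof (rule pot_diff[OF _ y])
      show "continuous_on {-pi..pi} (circ f r')" using r' r by (intro continuous_intros hol) auto
      show "continuous_on ({-pi..pi} \<times> {y..Y}) (\<lambda>(\<theta>, t). pair_ln 0 (circ f r' \<theta>) x t)"
        unfolding pair_ln_0 case_prod_beta by (intro continuous_intros cc cC) (use ne in auto)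
    qed
    also have "\<dots> = integral {y..Y} (\<lambda>t. 2 * pi * pair_ln 0 0 x t)"
    proof (rule integral_cong)
      fix t assume t: "t \<in> {y..Y}"
      have mean: "cint (\<lambda>\<theta>. ln (cmod (circ f r' \<theta> - w))) = 2 * pi * ln (cmod (0 - w))"
        if "w \<notin> f ` ball 0 r" for w
      proof -
        have "(\<lambda>z. f z - w) holomorphic_on ball 0 r"
          by (intro holomorphic_intros holomorphic_on_subset[OF hol]) (use r in auto)
        moreover have "f z - w \<noteq> 0" if "z \<in> ball 0 r" for z using that \<open>w \<notin> _\<close> by auto
        ultimately have "cint (\<lambda>t. ln (cmod (f (of_real r' * cis t) - w))) = 2 * pi * ln (cmod (f 0 - w))"
          by (rule mean_ln_cmod_nonvanishing[OF _ r'])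
        then show ?thesis by (simp add: circ_def f0)
      qed
      have ci: "continuous_on {-pi..pi} (\<lambda>\<theta>. ln (cmod (circ f r' \<theta> - w)))" if "w \<notin> f ` ball 0 r" for w
        using that mem r' r by (intro continuous_intros hol) auto
      have "cint (\<lambda>\<theta>. pair_ln 0 (circ f r' \<theta>) x t) =
          cint (\<lambda>\<theta>. ln (cmod (circ f r' \<theta> - Complex x t))) + cint (\<lambda>\<theta>. ln (cmod (circ f r' \<theta> - Complex x (-t))))"
        unfolding pair_ln_0 using out[OF t] by (intro integral_add integrable_continuous_interval ci) auto
      also have "\<dots> = 2 * pi * pair_ln 0 0 x t"
        unfolding pair_ln_0 using out[OF t] by (simp add: mean distrib_left)
      finally show "cint (\<lambda>\<theta>. pair_ln 0 (circ f r' \<theta>) x t) = 2 * pi * pair_ln 0 0 x t" .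
    qed
    also have "\<dots> = 2 * pi * (seg 0 0 x Y - seg 0 0 x y)"
      using integral_unique[OF pair_ln_integral[OF y, of 0 0 x]] by simp
    finally show ?thesis .
  qed
  have "continuous_on {0..r} h" unfolding h_def
    by (intro continuous_on_diff continuous_on_pot)
      (use r in \<open>auto simp: case_prod_beta intro!: continuous_intros hol\<close>)
  then have "(h \<longlongrightarrow> h r) (at r within {0..r})" using r by (simp add: continuous_on)
  then have "(h \<longlongrightarrow> h r) (at_left r)"
    using r by (simp add: at_within_Icc_at_left)
  moreover have "\<forall>\<^sub>F r' in at_left r. h r' = 2 * pi * (seg 0 0 x Y - seg 0 0 x y)"
    by (rule eventually_at_leftI[of 0]) (use inner r in auto)
  then have "(h \<longlongrightarrow> 2 * pi * (seg 0 0 x Y - seg 0 0 x y)) (at_left r)"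
    by (rule tendsto_eventually)
  ultimately have "h r = 2 * pi * (seg 0 0 x Y - seg 0 0 x y)"
    by (intro tendsto_unique[of "at_left r" h]) auto
  then show ?thesis by (simp add: h_def)
qed

text \<open>One-sided counterpart of \<open>pot_diff_outside\<close>: the zeros of g - w are
  unknown, but the smoothed logarithm is a continuous majorant of ln |g - w|, so
  \<open>ln_cmod_le_mean_majorant\<close> applies. Positivity of \<open>y\<close> keeps the ends x
  \<plusminus> i t off g 0 = 0; finally \<delta> tends to 0.\<close>

lemma pot_diff_ge:
  assumes hol: "g holomorphic_on \<D>" and g0: "g 0 = 0" and r: "0 < r" "r < 1" and y: "0 < y" "y \<le> Y"
  shows "2 * pi * (seg 0 0 x Y - seg 0 0 x y) \<le> pot (circ g r) 0 x Y - pot (circ g r) 0 x y"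
proof -
  define h where "h = (\<lambda>\<delta>. pot (circ g r) \<delta> x Y - pot (circ g r) \<delta> x y)"
  have cg: "continuous_on S (\<lambda>s. circ g r (v s))" if "continuous_on S v" for S :: "'c::topological_space set" and v
    using that r by (intro continuous_intros hol) auto
  have main: "2 * pi * (seg 0 0 x Y - seg 0 0 x y) \<le> h \<delta>" if \<delta>: "\<delta> > 0" for \<delta>
  proof -
    have pos: "(Re \<zeta> - x)\<^sup>2 + \<delta>\<^sup>2 + s\<^sup>2 > 0" for \<zeta> s
      using \<delta> by (intro add_pos_nonneg add_nonneg_pos) auto
    have ne: "(Re \<zeta> - x)\<^sup>2 + \<delta>\<^sup>2 + s\<^sup>2 \<noteq> 0" for \<zeta> s using pos[of \<zeta> s] by linarith
    have cp: "continuous_on ({-pi..pi} \<times> {y..Y}) (\<lambda>(\<theta>, t). pair_ln \<delta> (circ g r \<theta>) x t)"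
      unfolding pair_ln_def case_prod_beta by (intro continuous_intros cg) (use ne in auto)
    have h: "h \<delta> = integral {y..Y} (\<lambda>t. cint (\<lambda>\<theta>. pair_ln \<delta> (circ g r \<theta>) x t))"
      unfolding h_def by (rule pot_diff[OF _ y(2) cp]) (rule cg[OF continuous_on_id])
    have i1: "((\<lambda>t. 2 * pi * pair_ln 0 0 x t) has_integral 2 * pi * (seg 0 0 x Y - seg 0 0 x y)) {y..Y}"
      by (rule has_integral_mult_right[OF pair_ln_integral[OF y(2)]])
    have i2: "((\<lambda>t. cint (\<lambda>\<theta>. pair_ln \<delta> (circ g r \<theta>) x t)) has_integral
      integral {y..Y} (\<lambda>t. cint (\<lambda>\<theta>. pair_ln \<delta> (circ g r \<theta>) x t))) {y..Y}"
    proof (intro integrable_integral integrable_continuous_interval)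
      have "continuous_on ({y..Y} \<times> cbox (-pi) pi) (\<lambda>(t, \<theta>). pair_ln \<delta> (circ g r \<theta>) x t)"
        unfolding pair_ln_def case_prod_beta by (intro continuous_intros cg) (use ne in auto)
      from integral_continuous_on_param[OF this]
      show "continuous_on {y..Y} (\<lambda>t. cint (\<lambda>\<theta>. pair_ln \<delta> (circ g r \<theta>) x t))" by simp
    qed
    have le: "2 * pi * pair_ln 0 0 x t \<le> cint (\<lambda>\<theta>. pair_ln \<delta> (circ g r \<theta>) x t)" if t: "t \<in> {y..Y}" for t
    proof -
      have one: "2 * pi * ln (cmod (0 - Complex x s)) \<le> cint (\<lambda>\<theta>. ln ((Re (circ g r \<theta>) - x)\<^sup>2 + \<delta>\<^sup>2 + (s - Im (circ g r \<theta>))\<^sup>2) / 2)"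
        and int: "(\<lambda>\<theta>. ln ((Re (circ g r \<theta>) - x)\<^sup>2 + \<delta>\<^sup>2 + (s - Im (circ g r \<theta>))\<^sup>2) / 2) integrable_on {-pi..pi}"
        if "s \<noteq> 0" for s
      proof -
        let ?v = "\<lambda>\<theta>. ln ((Re (circ g r \<theta>) - x)\<^sup>2 + \<delta>\<^sup>2 + (s - Im (circ g r \<theta>))\<^sup>2) / 2"
        have cv: "continuous_on S ?v" for S by (intro continuous_intros cg) (use ne in auto)
        then show "?v integrable_on {-pi..pi}" by (rule integrable_continuous_interval)
        have "2 * pi * ln (cmod ((\<lambda>z. g z - Complex x s) 0)) \<le> cint ?v"
        proof (rule ln_cmod_le_mean_majorant[OF _ r])
          show "(\<lambda>z. g z - Complex x s) holomorphic_on \<D>" by (intro holomorphic_intros hol)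
          show "g 0 - Complex x s \<noteq> 0" using g0 that by (auto simp: complex_eq_iff)
          show "continuous_on UNIV ?v" by (rule cv)
          show "?v (t + 2 * pi) = ?v t" for t by (simp add: circ_periodic)
          show "cmod (g (of_real r * cis t) - Complex x s) \<le> exp (?v t)" for t
          proof -
            have "cmod (g (of_real r * cis t) - Complex x s) \<le> sqrt ((Re (circ g r t) - x)\<^sup>2 + \<delta>\<^sup>2 + (s - Im (circ g r t))\<^sup>2)"
              by (simp add: cmod_def circ_def power2_commute)
            also have "\<dots> = exp (?v t)" using pos[of "circ g r t" "s - Im (circ g r t)"] by (simp add: ln_sqrt[symmetric])
            finally show ?thesis .
          qed
        qed
        then show "2 * pi * ln (cmod (0 - Complex x s)) \<le> cint ?v" by (simp only: g0)
      qed
      have t0: "t \<noteq> 0" "- t \<noteq> 0" using t y by auto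
      have "(- t - Im w)\<^sup>2 = (t + Im w)\<^sup>2" for w by (simp add: power2_eq_square algebra_simps)
      then have "cint (\<lambda>\<theta>. pair_ln \<delta> (circ g r \<theta>) x t) =
          cint (\<lambda>\<theta>. ln ((Re (circ g r \<theta>) - x)\<^sup>2 + \<delta>\<^sup>2 + (t - Im (circ g r \<theta>))\<^sup>2) / 2)
        + cint (\<lambda>\<theta>. ln ((Re (circ g r \<theta>) - x)\<^sup>2 + \<delta>\<^sup>2 + (- t - Im (circ g r \<theta>))\<^sup>2) / 2)"
        unfolding pair_ln_def using integral_add[OF int[OF t0(1)] int[OF t0(2)]] by simp
      then show ?thesis using one[OF t0(1)] one[OF t0(2)] by (simp only: pair_ln_0 distrib_left)
    qed
    show ?thesis unfolding h by (rule has_integral_le[OF i1 i2 le])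
  qed
  have "continuous_on {0..1} h" unfolding h_def
    by (intro continuous_on_diff continuous_on_pot)
      (auto simp: case_prod_beta intro!: continuous_intros cg)
  then have "(h \<longlongrightarrow> h 0) (at 0 within {0..1})" by (simp add: continuous_on)
  then have "(h \<longlongrightarrow> h 0) (at_right 0)" by (simp add: at_within_Icc_at_right)
  moreover have "\<forall>\<^sub>F \<delta> in at_right 0. 2 * pi * (seg 0 0 x Y - seg 0 0 x y) \<le> h \<delta>"
    by (rule eventually_at_rightI[of 0 1]) (use main in auto)
  ultimately have "2 * pi * (seg 0 0 x Y - seg 0 0 x y) \<le> h 0"
    by (rule tendsto_lowerbound) simp
  then show ?thesis by (simp add: h_def)
qed

text \<open>Bookkeeping for \<open>seg_asymp\<close> with all products as atoms: \<open>h\<close>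
  stands for pi / 2 * X, \<open>u\<close> and \<open>v\<close> for z ln z at z = Y \<plusminus> b,
  \<open>m\<close> for Y ln Y, \<open>n\<close> for b ln Y. The terms in \<open>b\<close> and
  \<open>n\<close> cancel between the two ends.\<close>

lemma abs_add_le_combine:
  fixes k l h u v m n b Y q q' e :: real
  assumes "\<bar>k - (h + (u - (Y + b)))\<bar> \<le> e" "\<bar>l - (h + (v - (Y - b)))\<bar> \<le> e"
    and "b \<le> u - (m + n)" "u - (m + n) \<le> b + q" "- b \<le> v - (m - n)" "v - (m - n) \<le> - b + q" "q \<le> q'"
  shows "\<bar>k + l - (h + h + 2 * (m - Y))\<bar> \<le> e + e + q' + q'"
proof -
  have "\<bar>u + v - 2 * m\<bar> \<le> q' + q'" using assms(3-) by linarith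
  moreover have "\<bar>k + l - (h + h + (u + v) - 2 * Y)\<bar> \<le> e + e" using assms(1,2) by linarith
  moreover have "k + l - (h + h + 2 * (m - Y)) = (k + l - (h + h + (u + v) - 2 * Y)) + (u + v - 2 * m)"
    by (simp add: algebra_simps)
  ultimately show ?thesis
    using order_trans[OF abs_triangle_ineq add_mono] by (simp only: add.assoc)
qed

text \<open>The ends are at heights Y \<plusminus> Im \<zeta> relative to \<zeta>, so terms linear
  in Im \<zeta> cancel and to leading order \<zeta> enters only through |Re \<zeta> - x|. The error
  is uniform in |\<zeta>| \<le> M, hence along a curve.\<close>

lemma seg_asymp:
  assumes "cmod \<zeta> \<le> M" "Y > M"
  shows "\<bar>seg 0 \<zeta> x Y - (pi * \<bar>Re \<zeta> - x\<bar> + 2 * (Y * ln Y - Y))\<bar> \<le> (4 * (M + \<bar>x\<bar>)\<^sup>2 + 2 * M\<^sup>2) / (Y - M)"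
proof -
  define X where "X = \<bar>Re \<zeta> - x\<bar>"
  define b where "b = Im \<zeta>"
  have M: "M \<ge> 0" using assms(1) norm_ge_zero order_trans by blast
  have b: "\<bar>b\<bar> \<le> M" using abs_Im_le_cmod[of \<zeta>] assms(1) by (simp add: b_def)
  have "X \<le> M + \<bar>x\<bar>" using abs_Re_le_cmod[of \<zeta>] assms(1) by (simp add: X_def)
  then have X: "X\<^sup>2 \<le> (M + \<bar>x\<bar>)\<^sup>2" by (intro power_mono) (auto simp: X_def)
  have Y: "Y > 0" "Y + b \<ge> Y - M" "Y - b \<ge> Y - M" "Y - M > 0" using b M assms(2) by auto
  have err: "2 * X\<^sup>2 / t \<le> 2 * (M + \<bar>x\<bar>)\<^sup>2 / (Y - M)" if "t \<ge> Y - M" for t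
    using that X Y by (intro frac_le) auto
  \<comment> \<open>Both bounds are ln s \<le> s - 1, at s = z / Y and at s = Y / z.\<close>
  have tl: "z - Y \<le> z * ln z - z * ln Y \<and> z * ln z - z * ln Y \<le> z - Y + (z - Y)\<^sup>2 / Y" if z: "z > 0" for z
  proof -
    have "ln z - ln Y \<le> (z - Y) / Y" using ln_diff_le[of z Y] z Y by simp
    then have "z * (ln z - ln Y) \<le> z * ((z - Y) / Y)" using z by (intro mult_left_mono) auto
    also have "\<dots> = z - Y + (z - Y)\<^sup>2 / Y" using Y by (simp add: field_simps power2_eq_square)
    finally have 1: "z * ln z - z * ln Y \<le> z - Y + (z - Y)\<^sup>2 / Y" by (simp add: right_diff_distrib)
    have "ln Y - ln z \<le> (Y - z) / z" using ln_diff_le[of Y z] z Y by simp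
    then have "z * (ln Y - ln z) \<le> z * ((Y - z) / z)" using z by (intro mult_left_mono) auto
    also have "\<dots> = Y - z" using z by simp
    finally show ?thesis using 1 by (simp add: right_diff_distrib)
  qed
  have A: "\<bar>line_primitive X (Y + b) - (pi / 2 * X + ((Y + b) * ln (Y + b) - (Y + b)))\<bar> \<le> 2 * (M + \<bar>x\<bar>)\<^sup>2 / (Y - M)"
    using line_primitive_asymp[of "Y + b" X] err[OF Y(2)] Y by (auto simp: X_def)
  have B: "\<bar>line_primitive X (Y - b) - (pi / 2 * X + ((Y - b) * ln (Y - b) - (Y - b)))\<bar> \<le> 2 * (M + \<bar>x\<bar>)\<^sup>2 / (Y - M)"
    using line_primitive_asymp[of "Y - b" X] err[OF Y(3)] Y by (auto simp: X_def)
  have b2: "b\<^sup>2 / Y \<le> M\<^sup>2 / (Y - M)"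
    using b M Y abs_le_square_iff[of b M] by (intro frac_le) auto
  have 1: "b \<le> (Y + b) * ln (Y + b) - (Y * ln Y + b * ln Y)" "(Y + b) * ln (Y + b) - (Y * ln Y + b * ln Y) \<le> b + b\<^sup>2 / Y"
    using tl[of "Y + b"] Y by (auto simp: distrib_right)
  have 2: "- b \<le> (Y - b) * ln (Y - b) - (Y * ln Y - b * ln Y)" "(Y - b) * ln (Y - b) - (Y * ln Y - b * ln Y) \<le> - b + b\<^sup>2 / Y"
    using tl[of "Y - b"] Y by (auto simp: left_diff_distrib)
  have eq: "seg 0 \<zeta> x Y = line_primitive X (Y + b) + line_primitive X (Y - b)"
    by (simp add: seg_def X_def b_def)
  have "(4 * (M + \<bar>x\<bar>)\<^sup>2 + 2 * M\<^sup>2) / (Y - M) = 2 * (M + \<bar>x\<bar>)\<^sup>2 / (Y - M) + 2 * (M + \<bar>x\<bar>)\<^sup>2 / (Y - M) + M\<^sup>2 / (Y - M) + M\<^sup>2 / (Y - M)"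
    by (simp add: add_divide_distrib)
  moreover have "pi * X = pi / 2 * X + pi / 2 * X" by simp
  ultimately show ?thesis unfolding eq X_def[symmetric]
    using abs_add_le_combine[OF A B 1 2 b2] by (simp only:)
qed

text \<open>By \<open>seg_asymp\<close> the difference at height Y is pi times the difference of the
  integrals of |Re - x|, which is nonpositive, up to an error that vanishes as Y grows; the part
  depending on Y alone is common to both curves.\<close>

lemma pot_le_of_increasing_difference:
  assumes c1: "continuous_on {-pi..pi} \<gamma>" and c2: "continuous_on {-pi..pi} \<gamma>'"
    and mono: "\<And>Y. Y \<ge> y \<Longrightarrow> pot \<gamma> 0 x y - pot \<gamma>' 0 x y \<le> pot \<gamma> 0 x Y - pot \<gamma>' 0 x Y"
    and Re: "cint (\<lambda>t. \<bar>Re (\<gamma> t) - x\<bar>) \<le> cint (\<lambda>t. \<bar>Re (\<gamma>' t) - x\<bar>)"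
  shows "pot \<gamma> 0 x y \<le> pot \<gamma>' 0 x y"
proof -
  have "bounded (\<gamma> ` {-pi..pi} \<union> \<gamma>' ` {-pi..pi})"
    using c1 c2 by (auto intro: compact_imp_bounded compact_continuous_image)
  then obtain M where M: "\<And>z. z \<in> \<gamma> ` {-pi..pi} \<union> \<gamma>' ` {-pi..pi} \<Longrightarrow> cmod z \<le> M"
    unfolding bounded_iff by blast
  define E where "E = (\<lambda>Y. (4 * (M + \<bar>x\<bar>)\<^sup>2 + 2 * M\<^sup>2) / (Y - M))"
  have est: "\<bar>pot \<beta> 0 x Y - (pi * cint (\<lambda>t. \<bar>Re (\<beta> t) - x\<bar>) + 2 * pi * (2 * (Y * ln Y - Y)))\<bar> \<le> 2 * pi * E Y"
    if Y: "Y > M" and \<beta>: "continuous_on {-pi..pi} \<beta>" "\<And>t. t \<in> {-pi..pi} \<Longrightarrow> cmod (\<beta> t) \<le> M" for Y \<beta>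
  proof -
    have i: "(\<lambda>t. seg 0 (\<beta> t) x Y) integrable_on {-pi..pi}" "(\<lambda>t. pi * \<bar>Re (\<beta> t) - x\<bar>) integrable_on {-pi..pi}"
      "(\<lambda>t. pi * \<bar>Re (\<beta> t) - x\<bar> + 2 * (Y * ln Y - Y)) integrable_on {-pi..pi}"
      by (intro integrable_continuous_interval continuous_intros \<beta>(1))+
    have "cint (\<lambda>t. seg 0 (\<beta> t) x Y - (pi * \<bar>Re (\<beta> t) - x\<bar> + 2 * (Y * ln Y - Y)))
      = pot \<beta> 0 x Y - (pi * cint (\<lambda>t. \<bar>Re (\<beta> t) - x\<bar>) + 2 * pi * (2 * (Y * ln Y - Y)))"
      using integral_diff[OF i(1) i(3)] integral_add[OF i(2) integrable_const_ivl[of "2 * (Y * ln Y - Y)"]]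
      by (simp add: pot_def)
    moreover have "norm (cint (\<lambda>t. seg 0 (\<beta> t) x Y - (pi * \<bar>Re (\<beta> t) - x\<bar> + 2 * (Y * ln Y - Y)))) \<le> cint (\<lambda>t. E Y)"
    proof (rule integral_norm_bound_integral)
      fix t assume "t \<in> {-pi..pi}"
      then show "norm (seg 0 (\<beta> t) x Y - (pi * \<bar>Re (\<beta> t) - x\<bar> + 2 * (Y * ln Y - Y))) \<le> E Y"
        unfolding E_def real_norm_def by (intro seg_asymp \<beta>(2) Y)
    qed (intro integrable_diff i integrable_const_ivl)+
    ultimately show ?thesis by simp
  qed
  have "pot \<gamma> 0 x y - pot \<gamma>' 0 x y \<le> 0"
  proof (rule tendsto_lowerbound)
    show "((\<lambda>Y. 4 * pi * E Y) \<longlongrightarrow> 0) at_top" unfolding E_def by real_asymp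
    show "\<forall>\<^sub>F Y in at_top. pot \<gamma> 0 x y - pot \<gamma>' 0 x y \<le> 4 * pi * E Y"
      using eventually_gt_at_top[of "max y M"]
    proof eventually_elim
      case (elim Y)
      then have Y: "Y \<ge> y" "Y > M" by auto
      have "\<bar>pot \<gamma> 0 x Y - (pi * cint (\<lambda>t. \<bar>Re (\<gamma> t) - x\<bar>) + 2 * pi * (2 * (Y * ln Y - Y)))\<bar> \<le> 2 * pi * E Y"
        by (rule est[OF Y(2) c1]) (use M in auto)
      moreover have "\<bar>pot \<gamma>' 0 x Y - (pi * cint (\<lambda>t. \<bar>Re (\<gamma>' t) - x\<bar>) + 2 * pi * (2 * (Y * ln Y - Y)))\<bar> \<le> 2 * pi * E Y"
        by (rule est[OF Y(2) c2]) (use M in auto)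
      moreover have "pi * cint (\<lambda>t. \<bar>Re (\<gamma> t) - x\<bar>) \<le> pi * cint (\<lambda>t. \<bar>Re (\<gamma>' t) - x\<bar>)"
        using Re by simp
      moreover have "4 * pi * E Y = 2 * pi * E Y + 2 * pi * E Y" by simp
      ultimately show ?case using mono[OF Y(1)] by linarith
    qed
  qed simp
  then show ?thesis by simp
qed

text \<open>Along the segments \<open>[x - iy, x + iy]\<close>, which lie in \<open>f ` ball 0 r\<close>, the circular mean of
  \<open>ln (cmod (f - w))\<close> is by Jensen's formula the real part of a holomorphic function of \<open>w\<close>, so that
  \<open>pot (circ f r) 0\<close> is the imaginary part of one.\<close>

lemma pot_harmonic_inside:
  assumes hol: "f holomorphic_on \<D>" and inj: "inj_on f \<D>" and f0: "f 0 = 0" and r: "0 < r" "r < 1"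
    and sec: "\<And>x y t. Complex x y \<in> f ` ball 0 r \<Longrightarrow> y > 0 \<Longrightarrow> \<bar>t\<bar> \<le> y \<Longrightarrow> Complex x t \<in> f ` ball 0 r"
    and w: "w \<in> f ` ball 0 r" "Im w > 0"
  shows "has_laplacian (\<lambda>z. pot (circ f r) 0 (Re z) (Im z)) 0 w"
proof -
  define \<Omega> where "\<Omega> = f ` ball 0 r"
  have sub: "ball 0 r \<subseteq> \<D>" using r by auto
  have holr: "f holomorphic_on ball 0 r" and injr: "inj_on f (ball 0 r)"
    using hol inj sub by (auto intro: holomorphic_on_subset inj_on_subset)
  obtain \<phi> where \<phi>: "\<phi> holomorphic_on \<Omega>" "\<And>z. z \<in> ball 0 r \<Longrightarrow> deriv f z * deriv \<phi> (f z) = 1"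
    "\<And>z. z \<in> ball 0 r \<Longrightarrow> \<phi> (f z) = z"
    using holomorphic_has_inverse[OF holr open_ball injr] unfolding \<Omega>_def by metis
  have "open \<Omega>" unfolding \<Omega>_def using open_mapping_thm3[OF holr open_ball injr] .
  \<comment> \<open>The difference quotient of \<open>f\<close> at \<open>a\<close>, zero-free by
    injectivity. It splits ln |f - f a| on the circle into a harmonic part and ln |z - a|, whose
    mean is ln r.\<close>
  define G where "G = (\<lambda>a z. if z = a then deriv f a else (f z - f a) / (z - a))"
  have holG: "G a holomorphic_on \<D>" if "a \<in> \<D>" for a
    unfolding G_def using pole_lemma[OF hol, of a] that by (simp add: interior_open)
  have nzG: "G a z \<noteq> 0" if "a \<in> \<D>" "z \<in> \<D>" for a z
    using that holomorphic_injective_imp_regular[OF hol open_ball inj, of a] inj_onD[OF inj, of z a]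
    by (auto simp: G_def)
  have "simply_connected \<D>" by (intro convex_imp_simply_connected convex_ball)
  then obtain l where l: "l holomorphic_on \<D>" "\<And>z. z \<in> \<D> \<Longrightarrow> G 0 z = exp (l z)"
    using holG[of 0] nzG[of 0] open_ball[of 0 1] simply_connected_eq_holomorphic_log[of \<D>] by (metis centre_in_ball zero_less_one)
  define lam where "lam = (\<lambda>z. l z + of_real (ln r))"
  have mean: "cint (\<lambda>t. ln (cmod (circ f r t - f a))) = 2 * pi * Re (lam a)" if a: "a \<in> ball 0 r" for a
  proof -
    have aD: "a \<in> \<D>" using a sub by auto
    \<comment> \<open>The quotient is symmetric in its two points, so the value at the centre
      becomes the value at \<open>a\<close> of the single function \<open>G 0\<close>. This is why
      the mean is the real part of a holomorphic function of \<open>a\<close>.\<close>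
    have G0: "G a 0 = G 0 a" using f0 by (auto simp: G_def divide_simps)
    have mem: "of_real r * cis t \<in> \<D>" for t using r by (simp add: norm_mult)
    have ne: "of_real r * cis t \<noteq> a" for t using a r by (auto simp: norm_mult)
    have "ln (cmod (circ f r t - f a)) = ln (cmod (G a (of_real r * cis t))) + ln (cmod (of_real r * cis t - a))" for t
    proof -
      have "circ f r t - f a = G a (of_real r * cis t) * (of_real r * cis t - a)"
        using ne[of t] by (simp add: G_def circ_def)
      moreover have "cmod (G a (of_real r * cis t)) > 0" "cmod (of_real r * cis t - a) > 0"
        using nzG[OF aD mem] ne by auto
      ultimately show ?thesis by (simp add: norm_mult ln_mult_pos)
    qed
    then have "cint (\<lambda>t. ln (cmod (circ f r t - f a)))
      = cint (\<lambda>t. ln (cmod (G a (of_real r * cis t))) + ln (cmod (of_real r * cis t - a)))"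
      by simp
    also have "\<dots> = cint (\<lambda>t. ln (cmod (G a (of_real r * cis t)))) + cint (\<lambda>t. ln (cmod (of_real r * cis t - a)))"
      by (intro integral_add integrable_continuous_interval continuous_intros
          continuous_on_compose2[OF holomorphic_on_imp_continuous_on[OF holG[OF aD]]])
        (use mem nzG[OF aD mem] ne in auto)
    also have "\<dots> = 2 * pi * ln (cmod (G a 0)) + 2 * pi * ln r"
      using mean_ln_cmod_nonvanishing[OF holG[OF aD] r nzG[OF aD]] mean_ln_dist_circle[of a r] a by simp
    also have "\<dots> = 2 * pi * Re (lam a)"
      unfolding G0 l(2)[OF aD] by (simp add: lam_def distrib_left)
    finally show ?thesis .
  qed
  \<comment> \<open>The primitive in the variable w = f z is taken on the convex disc, with dw = f'
    dz, and carried over to \<Omega> by the inverse \<open>\<phi>\<close>.\<close>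
  have "(\<lambda>z. lam z * deriv f z) holomorphic_on ball 0 r"
    unfolding lam_def using holomorphic_on_subset[OF l(1) sub] holomorphic_deriv[OF holr open_ball]
    by (intro holomorphic_on_mult holomorphic_on_add holomorphic_on_const)
  then obtain P where P: "\<And>z. z \<in> ball 0 r \<Longrightarrow> (P has_field_derivative lam z * deriv f z) (at z within ball 0 r)"
    using holomorphic_convex_primitive'[OF convex_ball open_ball] by blast
  define \<Lambda> where "\<Lambda> = (\<lambda>w. P (\<phi> w))"
  have d\<Lambda>: "(\<Lambda> has_field_derivative lam (\<phi> w)) (at w)" if w: "w \<in> \<Omega>" for w
  proof -
    obtain z where z: "z \<in> ball 0 r" "w = f z" using w by (auto simp: \<Omega>_def)
    have "(P has_field_derivative lam (\<phi> w) * deriv f (\<phi> w)) (at (\<phi> w))"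
      using P[OF z(1)] z \<phi>(3)[OF z(1)] by (simp add: at_within_open[OF z(1) open_ball])
    moreover have "(\<phi> has_field_derivative deriv \<phi> w) (at w)"
      using \<phi>(1) \<open>open \<Omega>\<close> w by (rule holomorphic_derivI)
    ultimately have "(\<Lambda> has_field_derivative lam (\<phi> w) * deriv f (\<phi> w) * deriv \<phi> w) (at w)"
      unfolding \<Lambda>_def by (rule DERIV_chain2)
    moreover have "deriv f (\<phi> w) * deriv \<phi> w = 1" using \<phi>(2,3)[OF z(1)] z by simp
    ultimately show ?thesis by (simp add: mult.assoc)
  qed
  have hol\<Lambda>: "\<Lambda> holomorphic_on \<Omega>"
    unfolding holomorphic_on_def field_differentiable_def
    using d\<Lambda> has_field_derivative_at_within by blast
  define O' where "O' = {w \<in> \<Omega>. Im w > 0}"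
  have openO: "open O'"
  proof -
    have "O' = \<Omega> \<inter> {w. Im w > 0}" by (auto simp: O'_def)
    then show ?thesis using \<open>open \<Omega>\<close> open_halfspace_Im_gt by auto
  qed
  have secO: "Complex (Re w) t \<in> \<Omega>" if "w \<in> O'" "\<bar>t\<bar> \<le> Im w" for w t
    using sec[of "Re w" "Im w" t] that by (auto simp: O'_def \<Omega>_def)
  have cnjO: "cnj w \<in> \<Omega>" if "w \<in> O'" for w
    using secO[OF that, of "- Im w"] that by (simp add: O'_def complex_cnj cnj.code)
  have pot_eq: "pot (circ f r) 0 (Re w) (Im w) = 2 * pi * Im (\<Lambda> w - \<Lambda> (cnj w))" if w: "w \<in> O'" for w
  proof -
    define x where "x = Re w"
    define y where "y = Im w"
    have y: "y > 0" using w by (simp add: y_def O'_def)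
    have seg_in: "Complex x t \<in> \<Omega>" if "t \<in> {-y..y}" for t
      using secO[OF w, of t] that by (auto simp: x_def y_def)
    \<comment> \<open>By injectivity the image of the circle of radius r misses \<Omega>, so no
      logarithm below is singular.\<close>
    have circ_out: "circ f r t \<notin> \<Omega>" for t
    proof
      assume "circ f r t \<in> \<Omega>"
      then obtain z where "z \<in> ball 0 r" "f (of_real r * cis t) = f z" by (auto simp: \<Omega>_def circ_def)
      then have "of_real r * cis t = z" using inj_onD[OF inj, of "of_real r * cis t" z] r sub by (auto simp: norm_mult)
      then show False using \<open>z \<in> _\<close> r by (auto simp: norm_mult)
    qed
    have ne: "circ f r \<theta> - Complex x t \<noteq> 0" if "t \<in> {-y..y}" for \<theta> t
      using circ_out[of \<theta>] seg_in[OF that] by auto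
    have cC: "continuous_on S (\<lambda>s. Complex x (v s))" if "continuous_on S v" for S :: "(real \<times> real) set" and v
      unfolding Complex_eq using that by (intro continuous_intros)
    have "pot (circ f r) 0 x y = cint (\<lambda>\<theta>. integral {-y..y} (\<lambda>t. ln (cmod (circ f r \<theta> - Complex x t))))"
      unfolding pot_def using y by (intro integral_cong integral_unique[symmetric] seg_integral) auto
    also have "\<dots> = integral {-y..y} (\<lambda>t. cint (\<lambda>\<theta>. ln (cmod (circ f r \<theta> - Complex x t))))"
    proof -
      have "continuous_on (cbox (-pi, -y) (pi, y)) (\<lambda>(\<theta>, t). ln (cmod (circ f r \<theta> - Complex x t)))"
        unfolding case_prod_beta cbox_Pair_eq
        by (intro continuous_intros cC hol) (use ne r in auto)
      from integral_swap_continuous[OF this] show ?thesis by simp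
    qed
    also have "\<dots> = integral {-y..y} (\<lambda>t. 2 * pi * Re (lam (\<phi> (Complex x t))))"
    proof (rule integral_cong)
      fix t assume "t \<in> {-y..y}"
      then obtain a where "a \<in> ball 0 r" "Complex x t = f a"
        using seg_in[of t] unfolding \<Omega>_def by blast
      then show "cint (\<lambda>\<theta>. ln (cmod (circ f r \<theta> - Complex x t))) = 2 * pi * Re (lam (\<phi> (Complex x t)))"
        using mean \<phi>(3) by simp
    qed
    also have "\<dots> = 2 * pi * Im (\<Lambda> (Complex x y)) - 2 * pi * Im (\<Lambda> (Complex x (- y)))"
    proof (rule integral_unique, rule fundamental_theorem_of_calculus)
      fix t assume t: "t \<in> {-y..y}"
      have "((\<lambda>t. Complex x t) has_vector_derivative \<i>) (at t)"
        unfolding Complex_eq by (auto intro!: derivative_eq_intros)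
      from field_vector_diff_chain_at[OF this d\<Lambda>[OF seg_in[OF t]]]
      have "((\<lambda>t. \<Lambda> (Complex x t)) has_vector_derivative \<i> * lam (\<phi> (Complex x t))) (at t)"
        by (simp add: o_def)
      from bounded_linear.has_vector_derivative[OF bounded_linear_Im this]
      have "((\<lambda>t. Im (\<Lambda> (Complex x t))) has_real_derivative Re (lam (\<phi> (Complex x t)))) (at t)"
        by (simp add: has_real_derivative_iff_has_vector_derivative)
      from DERIV_cmult[OF this, of "2 * pi"]
      show "((\<lambda>t. 2 * pi * Im (\<Lambda> (Complex x t))) has_vector_derivative 2 * pi * Re (lam (\<phi> (Complex x t)))) (at t within {-y..y})"
        by (simp add: has_real_derivative_iff_has_vector_derivative has_vector_derivative_at_within)
    qed (use y in simp)
    finally show ?thesis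
      by (simp add: x_def y_def right_diff_distrib cnj.code)
  qed
  \<comment> \<open>- \<Lambda> (cnj w) has the same imaginary part as cnj (\<Lambda> (cnj w)),
    which is holomorphic in w.\<close>
  have "\<Lambda> holomorphic_on cnj ` O'" using hol\<Lambda> by (rule holomorphic_on_subset) (use cnjO in auto)
  from holomorphic_on_compose_cnj_cnj[OF this openO]
  have "(\<lambda>w. cnj (\<Lambda> (cnj w))) holomorphic_on O'" by (simp add: o_def)
  moreover have "\<Lambda> holomorphic_on O'" using hol\<Lambda> by (rule holomorphic_on_subset) (auto simp: O'_def)
  ultimately have "(\<lambda>w. \<Lambda> w + cnj (\<Lambda> (cnj w))) holomorphic_on O'" by (intro holomorphic_intros)
  moreover have "w \<in> O'" using w by (simp add: O'_def \<Omega>_def)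
  ultimately have "has_laplacian (\<lambda>z. 2 * pi * Im (\<Lambda> z + cnj (\<Lambda> (cnj z)))) (2 * pi * 0) w"
    using openO by (intro has_laplacian_cmult has_laplacian_Im)
  then have "has_laplacian (\<lambda>z. 2 * pi * Im (\<Lambda> z + cnj (\<Lambda> (cnj z)))) 0 w" by simp
  from has_laplacian_transform[OF this openO \<open>w \<in> O'\<close>] show ?thesis
    using pot_eq by simp
qed

text \<open>For y < 0 the previous result is applied to \<open>cnj \<circ> f \<circ> cnj\<close>,
  which has the same image of the unit disc because a Steiner symmetric domain is symmetric in the
  real axis.\<close>

lemma steiner_subdisc_section_abs:
  assumes hol: "f holomorphic_on \<D>" and inj: "inj_on f \<D>" and f0: "f 0 = 0"
    and st: "steiner_symmetric_domain (f ` \<D>)"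
    and r: "r \<le> 1" and w: "Complex x y \<in> f ` ball 0 r" "y \<noteq> 0" and t: "\<bar>t\<bar> \<le> \<bar>y\<bar>"
  shows "Complex x t \<in> f ` ball 0 r"
proof (cases "y > 0")
  case True
  then show ?thesis using steiner_subdisc_section[OF hol inj f0 st r w(1) True] t by simp
next
  case False
  define f' where "f' = cnj \<circ> f \<circ> cnj"
  have cnj_ball: "cnj ` ball 0 s = ball 0 s" for s
    by (force intro: image_eqI[of _ cnj "cnj _"])
  have img: "f' ` ball 0 s = cnj ` f ` ball 0 s" for s
    by (simp only: f'_def image_comp[symmetric] cnj_ball)
  have "cnj ` f ` \<D> \<subseteq> f ` \<D>"
  proof
    fix u assume "u \<in> cnj ` f ` \<D>"
    then obtain v where "v \<in> f ` \<D>" "u = cnj v" by blast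
    then have "Complex (Re u) (- Im u) \<in> f ` \<D>" by simp
    from steiner_symmetric_domain_section[OF st this, of "Im u"] show "u \<in> f ` \<D>" by simp
  qed
  moreover from image_mono[OF this, of cnj] have "f ` \<D> \<subseteq> cnj ` f ` \<D>" by (simp add: image_image)
  ultimately have D: "f' ` \<D> = f ` \<D>" unfolding img by blast
  have "f' holomorphic_on \<D>" unfolding f'_def
    by (rule holomorphic_on_compose_cnj_cnj) (simp_all add: cnj_ball hol)
  moreover have "inj_on f' \<D>"
  proof (rule inj_onI)
    fix a b assume ab: "a \<in> \<D>" "b \<in> \<D>" "f' a = f' b"
    then have "f (cnj a) = f (cnj b)" by (simp only: f'_def o_def complex_cnj_cancel_iff)
    moreover have "cnj a \<in> \<D>" "cnj b \<in> \<D>" using ab(1,2) by simp_all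
    ultimately have "cnj a = cnj b" by (rule inj_onD[OF inj])
    then show "a = b" by simp
  qed
  moreover have "Complex x (- y) \<in> f' ` ball 0 r"
    using imageI[OF w(1), of cnj] unfolding img complex_cnj .
  moreover have "f' 0 = 0" using f0 by (simp add: f'_def)
  moreover have "steiner_symmetric_domain (f' ` \<D>)" unfolding D by (rule st)
  moreover have "- y > 0" "\<bar>- t\<bar> \<le> - y" using False w(2) t by auto
  ultimately have "Complex x (- t) \<in> f' ` ball 0 r"
    by (intro steiner_subdisc_section[of f' r x "- y" "- t"] r)
  then obtain v where "v \<in> f ` ball 0 r" "Complex x (- t) = cnj v" unfolding img by blast
  then show ?thesis by (metis complex_cnj complex_cnj_cnj minus_minus)
qed

lemma pot_circ_le:
  assumes hol: "f holomorphic_on \<D>" and inj: "inj_on f \<D>" and f0: "f 0 = 0"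
    and st: "steiner_symmetric_domain (f ` \<D>)" and r: "0 < r" "r < 1"
    and holg: "g holomorphic_on \<D>" and g0: "g 0 = 0"
    and Re: "\<And>x. cint (\<lambda>t. \<bar>Re (circ g r t) - x\<bar>) \<le> cint (\<lambda>t. \<bar>Re (circ f r t) - x\<bar>)"
    and y: "y \<ge> 0"
  shows "pot (circ g r) 0 x y \<le> pot (circ f r) 0 x y"
proof -
  define \<Omega> where "\<Omega> = f ` ball 0 r"
  have sub: "ball 0 r \<subseteq> \<D>" "cball 0 r \<subseteq> \<D>" using r by auto
  have sec: "Complex x t \<in> f ` ball 0 r" if "Complex x y \<in> f ` ball 0 r" "y \<noteq> 0" "\<bar>t\<bar> \<le> \<bar>y\<bar>" for x y t
    using steiner_subdisc_section_abs[OF hol inj f0 st _ that] r by simp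
  have cc: "continuous_on S (circ h r)" if "h holomorphic_on \<D>" for h S
    using that r by (intro continuous_intros) auto
  \<comment> \<open>By \<open>sec\<close>, a point x \<plusminus> i t of \<Omega> with t \<ge> y
    would force x + i y into \<Omega>; so both vertical rays avoid \<Omega>.\<close>
  have outside: "pot (circ g r) 0 x y \<le> pot (circ f r) 0 x y" if y: "y > 0" and out: "Complex x y \<notin> \<Omega>" for x y
  proof (rule pot_le_of_increasing_difference[OF cc[OF holg] cc[OF hol] _ Re])
    fix Y assume "y \<le> Y"
    have "Complex x t \<notin> f ` ball 0 r \<and> Complex x (- t) \<notin> f ` ball 0 r" if t: "t \<in> {y..Y}" for t
      using sec[of x t y] sec[of x "-t" y] t y out by (auto simp: \<Omega>_def)
    from pot_diff_outside[OF hol f0 r \<open>y \<le> Y\<close> this]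
    show "pot (circ g r) 0 x y - pot (circ f r) 0 x y \<le> pot (circ g r) 0 x Y - pot (circ f r) 0 x Y"
      using pot_diff_ge[OF holg g0 r y \<open>y \<le> Y\<close>, of x] by linarith
  qed
  have real: "pot (circ h r) 0 x 0 = 0" for h x by (simp add: pot_def)
  \<comment> \<open>Only the potential of \<open>g\<close> is smoothed. That of \<open>f\<close>
    stays harmonic in \<open>O'\<close>, which gives the difference a positive Laplacian.\<close>
  define u where "u = (\<lambda>\<delta> w. pot (circ g r) \<delta> (Re w) (Im w) - pot (circ f r) 0 (Re w) (Im w))"
  define O' where "O' = {w \<in> \<Omega>. Im w > 0}"
  have holr: "f holomorphic_on ball 0 r" and injr: "inj_on f (ball 0 r)"
    using hol inj sub by (auto intro: holomorphic_on_subset inj_on_subset)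
  have "open \<Omega>" unfolding \<Omega>_def using open_mapping_thm3[OF holr open_ball injr] .
  have "O' = \<Omega> \<inter> {w. Im w > 0}" by (auto simp: O'_def)
  then have "open O'" using \<open>open \<Omega>\<close> open_halfspace_Im_gt by auto
  have "compact (f ` cball 0 r)"
    by (intro compact_continuous_image continuous_on_subset[OF holomorphic_on_imp_continuous_on[OF hol]]) (use sub in auto)
  then have "bounded O'"
    by (rule bounded_subset[OF compact_imp_bounded]) (auto simp: O'_def \<Omega>_def)
  have cu: "continuous_on ({0..1} \<times> UNIV) (\<lambda>(\<delta>, w). u \<delta> w)"
    unfolding u_def case_prod_beta
    by (intro continuous_on_diff continuous_on_pot)
      (use r in \<open>auto simp: case_prod_beta intro!: continuous_intros hol holg\<close>)
  have cu1: "continuous_on S (u \<delta>)" if "\<delta> \<in> {0..1}" for S \<delta>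
    by (rule continuous_on_subset[OF continuous_on_compose2[OF cu, of UNIV "\<lambda>w. (\<delta>, w)", simplified]])
      (use that in \<open>auto intro!: continuous_intros\<close>)
  have Im_ge: "Im w \<ge> 0" if "w \<in> closure O'" for w
  proof -
    have "closure O' \<subseteq> {w. Im w \<ge> 0}"
      by (intro closure_minimal closed_halfspace_Im_ge) (auto simp: O'_def)
    then show ?thesis using that by auto
  qed
  \<comment> \<open>This covers the frontier of \<open>O'\<close>: on the real axis both potentials
    vanish, and above it \<open>outside\<close> applies.\<close>
  have notO: "u 0 w \<le> 0" if "Im w \<ge> 0" "w \<notin> O'" for w
  proof (cases "Im w = 0")
    case True
    then show ?thesis by (simp add: u_def real)
  next
    case False
    then have "Im w > 0" "Complex (Re w) (Im w) \<notin> \<Omega>" using that by (auto simp: O'_def)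
    from outside[OF this] show ?thesis by (simp add: u_def)
  qed
  have inO: "u 0 w \<le> 0" if w: "w \<in> O'" for w
  proof (rule field_le_epsilon)
    fix e :: real assume "e > 0"
    \<comment> \<open>Uniform continuity makes the smoothing change \<open>u\<close> by less than e
      / 2 on the whole closure; this is paid once on the frontier and once at
      \<open>w\<close>.\<close>
    have "compact ({0..1::real} \<times> closure O')"
      using \<open>bounded O'\<close> by (intro compact_Times) auto
    then have "uniformly_continuous_on ({0..1} \<times> closure O') (\<lambda>(\<delta>, w). u \<delta> w)"
      by (intro compact_uniformly_continuous continuous_on_subset[OF cu]) auto
    then obtain d where d: "d > 0" "\<And>p q. p \<in> {0..1} \<times> closure O' \<Longrightarrow> q \<in> {0..1} \<times> closure O' \<Longrightarrow> dist q p < d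
        \<Longrightarrow> dist (case q of (\<delta>, w) \<Rightarrow> u \<delta> w) (case p of (\<delta>, w) \<Rightarrow> u \<delta> w) < e / 2"
      unfolding uniformly_continuous_on_def using \<open>e > 0\<close> by (meson half_gt_zero)
    define \<delta> where "\<delta> = min 1 (d / 2)"
    have \<delta>: "\<delta> > 0" "\<delta> \<le> 1" "\<delta> < d" using d(1) by (auto simp: \<delta>_def min_def)
    have close: "\<bar>u \<delta> v - u 0 v\<bar> < e / 2" if "v \<in> closure O'" for v
      using d(2)[of "(0, v)" "(\<delta>, v)"] that \<delta> by (simp add: dist_Pair_Pair dist_real_def)
    have "u \<delta> w \<le> e / 2"
    proof (rule strict_maximum_principle[OF \<open>bounded O'\<close> \<open>open O'\<close>])
      show "continuous_on (closure O') (u \<delta>)" using \<delta> by (intro cu1) auto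
      fix v assume v: "v \<in> O'"
      then have "v \<in> f ` ball 0 r" "Im v > 0" by (auto simp: O'_def \<Omega>_def)
      then have "has_laplacian (\<lambda>z. pot (circ f r) 0 (Re z) (Im z)) 0 v"
        by (intro pot_harmonic_inside[OF hol inj f0 r]) (auto intro: sec)
      moreover obtain L where "L > 0" "has_laplacian (\<lambda>z. pot (circ g r) \<delta> (Re z) (Im z)) L v"
        using has_laplacian_pot[OF cc[OF holg], of \<delta> v] \<delta> \<open>Im v > 0\<close> by auto
      ultimately have "has_laplacian (u \<delta>) (L - 0) v"
        unfolding u_def by (intro has_laplacian_diff)
      then show "\<exists>L>0. has_laplacian (u \<delta>) L v" using \<open>L > 0\<close> by auto
    next
      fix v assume "v \<in> frontier O'"
      then have v: "v \<in> closure O'" "v \<notin> O'" using \<open>open O'\<close> by (auto simp: frontier_def interior_open)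
      have "u 0 v \<le> 0" by (rule notO[OF Im_ge[OF v(1)] v(2)])
      then show "u \<delta> v \<le> e / 2" using close[OF v(1)] by linarith
    qed fact
    moreover have "\<bar>u \<delta> w - u 0 w\<bar> < e / 2" using w closure_subset by (intro close) auto
    ultimately show "u 0 w \<le> 0 + e" by linarith
  qed
  have "u 0 (Complex x y) \<le> 0"
    using notO[of "Complex x y"] inO[of "Complex x y"] y by (cases "Complex x y \<in> O'") auto
  then show ?thesis by (simp add: u_def)
qed

text \<open>Integrating \<open>pot_circ_le\<close> over half-circles with the weight \<rho> sin
  \<phi> \<ge> 0 gives the comparison of \<open>disc_pot\<close> for every \<rho>, which is what
  \<open>integral_powr_le_of_disc_pot\<close> asks for.\<close>

lemma circle_powr_mean_le:
  assumes hol: "f holomorphic_on \<D>" and inj: "inj_on f \<D>" and f0: "f 0 = 0"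
    and st: "steiner_symmetric_domain (f ` \<D>)" and r: "0 < r" "r < 1"
    and holg: "g holomorphic_on \<D>" and g0: "g 0 = 0"
    and Re: "\<And>x. cint (\<lambda>t. \<bar>Re (circ g r t) - x\<bar>) \<le> cint (\<lambda>t. \<bar>Re (circ f r t) - x\<bar>)"
    and p: "0 < p" "p < 2"
  shows "cint (\<lambda>t. cmod (circ g r t) powr p) \<le> cint (\<lambda>t. cmod (circ f r t) powr p)"
proof (rule integral_powr_le_of_disc_pot[OF _ _ _ _ _ p])
  have cc: "continuous_on S (\<lambda>s. circ h r (v s))" if "h holomorphic_on \<D>" "continuous_on S v" for h v and S :: "'c::topological_space set"
    using that r by (intro continuous_intros) auto
  show "continuous_on {-pi..pi} (\<lambda>t. cmod (circ g r t))" "continuous_on {-pi..pi} (\<lambda>t. cmod (circ f r t))"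
    by (intro continuous_intros cc hol holg)+
  fix \<rho> :: real assume \<rho>: "\<rho> > 0"
  have pot_disc: "integral {0..pi} (\<lambda>\<phi>. pot (circ h r) 0 (\<rho> * cos \<phi>) (\<rho> * sin \<phi>) * (\<rho> * sin \<phi>))
      = pi * cint (\<lambda>t. disc_pot \<rho> (cmod (circ h r t)))"
    and pot_int: "(\<lambda>\<phi>. pot (circ h r) 0 (\<rho> * cos \<phi>) (\<rho> * sin \<phi>) * (\<rho> * sin \<phi>)) integrable_on {0..pi}"
    if h: "h holomorphic_on \<D>" for h
  proof -
    have c: "continuous_on (cbox (0, -pi) (pi, pi)) (\<lambda>(\<phi>, t). seg 0 (circ h r t) (\<rho> * cos \<phi>) (\<rho> * sin \<phi>) * (\<rho> * sin \<phi>))"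
      unfolding case_prod_beta by (intro continuous_intros cc h)
    have "integral {0..pi} (\<lambda>\<phi>. pot (circ h r) 0 (\<rho> * cos \<phi>) (\<rho> * sin \<phi>) * (\<rho> * sin \<phi>))
      = integral {0..pi} (\<lambda>\<phi>. cint (\<lambda>t. seg 0 (circ h r t) (\<rho> * cos \<phi>) (\<rho> * sin \<phi>) * (\<rho> * sin \<phi>)))"
      unfolding pot_def by simp
    also have "\<dots> = cint (\<lambda>t. integral {0..pi} (\<lambda>\<phi>. seg 0 (circ h r t) (\<rho> * cos \<phi>) (\<rho> * sin \<phi>) * (\<rho> * sin \<phi>)))"
      using integral_swap_continuous[OF c] by simp
    also have "\<dots> = pi * cint (\<lambda>t. disc_pot \<rho> (cmod (circ h r t)))"
      by (simp add: seg_semicircle[OF \<rho>])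
    finally show "integral {0..pi} (\<lambda>\<phi>. pot (circ h r) 0 (\<rho> * cos \<phi>) (\<rho> * sin \<phi>) * (\<rho> * sin \<phi>))
      = pi * cint (\<lambda>t. disc_pot \<rho> (cmod (circ h r t)))" .
    show "(\<lambda>\<phi>. pot (circ h r) 0 (\<rho> * cos \<phi>) (\<rho> * sin \<phi>) * (\<rho> * sin \<phi>)) integrable_on {0..pi}"
      by (intro integrable_continuous_interval continuous_on_mult continuous_on_pot)
        (auto simp: case_prod_beta intro!: continuous_intros cc h)
  qed
  have "integral {0..pi} (\<lambda>\<phi>. pot (circ g r) 0 (\<rho> * cos \<phi>) (\<rho> * sin \<phi>) * (\<rho> * sin \<phi>))
     \<le> integral {0..pi} (\<lambda>\<phi>. pot (circ f r) 0 (\<rho> * cos \<phi>) (\<rho> * sin \<phi>) * (\<rho> * sin \<phi>))"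
  proof (rule integral_le[OF pot_int[OF holg] pot_int[OF hol]])
    fix \<phi> assume "\<phi> \<in> {0..pi}"
    then have "\<rho> * sin \<phi> \<ge> 0" using \<rho> by (simp add: sin_ge_zero)
    then show "pot (circ g r) 0 (\<rho> * cos \<phi>) (\<rho> * sin \<phi>) * (\<rho> * sin \<phi>) \<le> pot (circ f r) 0 (\<rho> * cos \<phi>) (\<rho> * sin \<phi>) * (\<rho> * sin \<phi>)"
      by (intro mult_right_mono pot_circ_le[OF hol inj f0 st r holg g0 Re])
  qed
  then show "cint (\<lambda>t. disc_pot \<rho> (cmod (circ g r t))) \<le> cint (\<lambda>t. disc_pot \<rho> (cmod (circ f r t)))"
    by (simp add: pot_disc[OF hol] pot_disc[OF holg])
qed auto

theorem theorem4:
  fixes f F :: "complex \<Rightarrow> complex" and p r :: real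
  assumes "f \<in> \<Z>" and "F holomorphic_on \<D>" and "convexity_preserving F"
    and "p > 0" and "0 < r" and "r < 1"
  shows "integral_mean p r (f \<star> F) \<le> integral_mean p r f"
proof -
  have hol: "f holomorphic_on \<D>" and inj: "inj_on f \<D>" and f0: "f 0 = 0" and st: "steiner_symmetric_domain (f ` \<D>)"
    using assms(1) by (auto simp: class_Z_def)
  note F = assms(2) and p = assms(4) and r = assms(5,6)
  have F0: "F 0 = 1" using assms(3) by (rule convexity_preserving_at_0)
  have holc: "(f \<star> F) holomorphic_on \<D>"
  proof (rule power_series_holomorphic)
    fix w assume w: "w \<in> \<D>"
    \<comment> \<open>A radius strictly between |w| and 1, so that w = \<rho> z with z in the
      disc.\<close>
    define \<rho> where "\<rho> = (1 + cmod w) / 2"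
    have \<rho>: "0 < \<rho>" "\<rho> < 1" "cmod w < \<rho>" using w by (auto simp: \<rho>_def add_pos_nonneg)
    have "w / of_real \<rho> \<in> \<D>" using \<rho> by (simp add: norm_divide)
    from convolution_integral(1)[OF hol F F0 \<rho>(1,2) this]
    show "(\<lambda>n. fps_nth (fps_expansion f 0) n * fps_nth (fps_expansion F 0) n * (w - 0) ^ n) sums (f \<star> F) w"
      using \<rho> by simp
  qed
  have c0: "(f \<star> F) 0 = 0"
    using convolution_integral(1)[OF hol F F0, of "1/2" 0] sums_unique2[OF _ powser_sums_zero]
    by (fastforce simp: fps_nth_expansion_0 f0)
  have cc: "continuous_on S (\<lambda>s. circ h r (v s))" if "h holomorphic_on \<D>" "continuous_on S v" for h v and S :: "'c::topological_space set"
    using that r by (intro continuous_intros) auto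
  have main: "cint (\<lambda>t. cmod (circ (f \<star> F) (\<rho> * r) t) powr p) \<le> cint (\<lambda>t. cmod (circ f r t) powr p)"
    if \<rho>: "0 < \<rho>" "\<rho> < 1" for \<rho>
  proof -
    define g where "g = (\<lambda>z. (f \<star> F) (of_real \<rho> * z))"
    define P where "P = (\<lambda>s. 2 * Re (F (of_real \<rho> * cis s)) - 1)"
    have memF: "of_real \<rho> * cis s \<in> \<D>" for s using \<rho> by (simp add: norm_mult)
    have P0: "P s \<ge> 0" for s
      using convexity_preserving_Re_ge_half[OF assms(3) memF[of s]] by (simp add: P_def)
    have cP: "continuous_on S P" for S
      unfolding P_def
      by (intro continuous_intros continuous_on_compose2[OF holomorphic_on_imp_continuous_on[OF F]]) (use memF in auto)
    have cF: "continuous_on {-pi..pi} (\<lambda>s. F (of_real \<rho> * cis s))"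
      by (intro continuous_intros continuous_on_compose2[OF holomorphic_on_imp_continuous_on[OF F]]) (use memF in auto)
    have Pint: "cint P = 2 * pi"
    proof -
      have "Re (cint (\<lambda>s. F (of_real \<rho> * cis s))) = cint (\<lambda>s. Re (F (of_real \<rho> * cis s)))"
        using integral_linear[OF integrable_continuous_interval[OF cF] bounded_linear_Re] by (simp add: o_def)
      then have R: "cint (\<lambda>s. Re (F (of_real \<rho> * cis s))) = 2 * pi"
        using circle_mean_holomorphic[OF F \<rho>] F0 by simp
      have "cint P = cint (\<lambda>s. 2 * Re (F (of_real \<rho> * cis s))) - cint (\<lambda>s. 1)"
        unfolding P_def by (intro integral_diff integrable_continuous_interval continuous_intros cF)
      then show ?thesis by (simp add: R)
    qed
    have "(\<lambda>z. of_real \<rho> * z) ` \<D> \<subseteq> \<D>"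
    proof safe
      fix z :: complex assume "z \<in> \<D>"
      then have "\<rho> * cmod z < 1 * 1" using \<rho> by (intro mult_strict_mono) auto
      then show "of_real \<rho> * z \<in> \<D>" using \<rho> by (simp add: norm_mult)
    qed
    from holomorphic_on_compose_gen[OF _ holc this] have holg: "g holomorphic_on \<D>"
      by (simp add: g_def o_def holomorphic_on_mult)
    have g0: "g 0 = 0" by (simp add: g_def c0)
    have rep: "cint (\<lambda>s. circ f r (t - s) * of_real (P s)) = 2 * pi * circ g r t" for t
    proof -
      have "of_real r * cis t \<in> \<D>" using r by (simp add: norm_mult)
      from convolution_integral(2)[OF hol F F0 \<rho> this] show ?thesis
        by (simp add: P_def g_def circ_def mult.assoc cis_mult)
    qed
    have cint: "(\<lambda>s. circ f r (t - s) * of_real (P s)) integrable_on {-pi..pi}" for t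
      by (intro integrable_continuous_interval continuous_intros cc hol cP)
    have conv: "cint (\<lambda>t. N (circ g r t)) \<le> cint (\<lambda>t. N (circ f r t))"
      if "continuous_on UNIV N" "\<And>t. 2 * pi * N (circ g r t) \<le> cint (\<lambda>s. N (circ f r (t - s)) * P s)" for N
      by (rule circle_convolution_mean_le[OF _ _ cP that(1) _ Pint that(2)])
        (intro cc hol holg continuous_on_id circ_periodic)+
    have "cint (\<lambda>t. cmod (circ g r t) powr p) \<le> cint (\<lambda>t. cmod (circ f r t) powr p)"
    proof (cases "p \<ge> 1")
      case True
      show ?thesis
      proof (rule conv)
        show "continuous_on UNIV (\<lambda>z::complex. cmod z powr p)"
          using p by (intro continuous_on_powr' continuous_intros) auto
        fix t
        have "2 * pi * cmod (circ g r t) = cmod (cint (\<lambda>s. circ f r (t - s) * of_real (P s)))"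
          unfolding rep by (simp add: norm_mult)
        also have "\<dots> \<le> cint (\<lambda>s. cmod (circ f r (t - s)) * P s)"
          using P0 by (intro integral_norm_bound_integral cint integrable_continuous_interval continuous_intros cc hol cP)
            (simp add: norm_mult)
        finally show "2 * pi * cmod (circ g r t) powr p \<le> cint (\<lambda>s. cmod (circ f r (t - s)) powr p * P s)"
          using P0 by (intro jensen_powr_weighted[OF True _ cP _ _ Pint]) (auto intro!: continuous_intros cc hol)
      qed
    next
      case False
      show ?thesis
      proof (rule circle_powr_mean_le[OF hol inj f0 st r holg g0 _ p])
        fix x
        show "cint (\<lambda>t. \<bar>Re (circ g r t) - x\<bar>) \<le> cint (\<lambda>t. \<bar>Re (circ f r t) - x\<bar>)"
        proof (rule conv)
          show "continuous_on UNIV (\<lambda>z. \<bar>Re z - x\<bar>)" by (intro continuous_intros)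
          fix t
          have i: "(\<lambda>s. Re (circ f r (t - s)) * P s) integrable_on {-pi..pi}" "(\<lambda>s. x * P s) integrable_on {-pi..pi}"
            by (intro integrable_continuous_interval continuous_intros cc hol cP)+
          have "2 * pi * Re (circ g r t) = cint (\<lambda>s. Re (circ f r (t - s)) * P s)"
            using integral_linear[OF cint[of t] bounded_linear_Re] by (simp add: o_def rep)
          \<comment> \<open>The constant x can be moved into the average because \<open>P\<close>
            has integral 2 pi.\<close>
          then have "2 * pi * (Re (circ g r t) - x) = cint (\<lambda>s. Re (circ f r (t - s)) * P s - x * P s)"
            using integral_diff[OF i] by (simp add: Pint right_diff_distrib)
          then have "2 * pi * \<bar>Re (circ g r t) - x\<bar> = norm (cint (\<lambda>s. Re (circ f r (t - s)) * P s - x * P s))"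
            by (metis abs_mult abs_of_pos real_norm_def pi_gt_zero mult_pos_pos zero_less_numeral)
          also have "\<dots> \<le> cint (\<lambda>s. \<bar>Re (circ f r (t - s)) - x\<bar> * P s)"
            using P0 by (intro integral_norm_bound_integral integrable_diff i integrable_continuous_interval continuous_intros cc hol cP)
              (simp add: left_diff_distrib[symmetric] abs_mult)
          finally show "2 * pi * \<bar>Re (circ g r t) - x\<bar> \<le> cint (\<lambda>s. \<bar>Re (circ f r (t - s)) - x\<bar> * P s)" .
        qed
      qed (use False in simp)
    qed
    then show ?thesis by (simp add: g_def circ_def mult.assoc)
  qed
  \<comment> \<open>The circle of radius r for \<open>g\<close> is the circle of radius \<rho> r for
    the convolution; as r < 1, the integral is continuous up to \<rho> = 1.\<close>
  define I where "I = (\<lambda>\<rho>. cint (\<lambda>t. cmod (circ (f \<star> F) (\<rho> * r) t) powr p))"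
  have "continuous_on {0..1} I"
  proof -
    have "continuous_on ({0..1} \<times> cbox (-pi) pi) (\<lambda>(\<rho>, t). cmod (circ (f \<star> F) (\<rho> * r) t) powr p)"
      unfolding case_prod_beta
    proof (intro continuous_on_powr' continuous_intros holc)
      fix s :: "real \<times> real" assume "s \<in> {0..1} \<times> cbox (-pi) pi"
      then have "fst s * r \<le> 1 * r" "0 \<le> fst s * r" using r by (auto intro!: mult_right_mono)
      then show "\<bar>fst s * r\<bar> < 1" using r by linarith
    qed (use p in auto)
    from integral_continuous_on_param[OF this] show ?thesis by (simp add: I_def)
  qed
  then have "(I \<longlongrightarrow> I 1) (at 1 within {0..1})" by (simp add: continuous_on)
  then have "(I \<longlongrightarrow> I 1) (at_left 1)" by (simp add: at_within_Icc_at_left)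
  moreover have "\<forall>\<^sub>F \<rho> in at_left 1. I \<rho> \<le> cint (\<lambda>t. cmod (circ f r t) powr p)"
    by (rule eventually_at_leftI[of 0]) (use main in \<open>auto simp: I_def\<close>)
  ultimately have le: "I 1 \<le> cint (\<lambda>t. cmod (circ f r t) powr p)"
    by (rule tendsto_upperbound) simp
  have mean: "integral_mean p r h = (cint (\<lambda>t. cmod (circ h r t) powr p) / (2 * pi)) powr (1 / p)" for h
    by (simp add: integral_mean_def circ_def cis_conv_exp)
  have "I 1 \<ge> 0" unfolding I_def using holc r p
    by (intro integral_nonneg integrable_continuous_interval continuous_on_powr' continuous_intros) auto
  then show ?thesis unfolding mean
    using le p by (intro powr_mono2 divide_right_mono) (auto simp: I_def)
qed

end
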